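(* Let $C_E$ be the edit cost function with vertex insertion cost $0$, vertex deletion cost $0$, vertex relabeling cost $\infty$, edge insertion cost $1$, edge deletion cost $1$, and edge relabeling cost $2$. Computing the graph edit distance $\mathrm{GED}(G_1,G_2;C_E)$ is $\mathsf{NP}$-hard even when both input graphs $G_1$ and $G_2$ are edge-labeled paths.
   Context: Graphs are finite, simple and undirected. A labeled graph is a graph $G=(V,E)$ with a labeling function $\ell\colon V\cup E\to\Sigma$, where $\Sigma$ is a finite alphabet; an edge-labeled path is a path graph with labels on its edges (all vertices may be taken to carry the same label). Isomorphisms of labeled graphs preserve adjacency, non-adjacency, and all labels. Graph edit distance. An edit operation is an insertion, deletion, or relabeling of a vertex or an edge, with a non-negative cost given by a cost function $C$; the relabeling cost is charged when the labels do not match (leaving a label unchanged costs $0$). An edit path $\gamma=(o_1,\dots,o_k)$ from $G_1$ to $G_2$ is a sequence of edit operations transforming $G_1$ into a graph isomorphic to $G_2$, with cost $C(\gamma)=\sum_i C(o_i)$. A restricted edit path is an edit path in which a vertex can only be deleted after its incident edges have been deleted, an edge can only be inserted if its endpoints exist, each vertex and each edge is edited at most once, and deleting and reinserting an edge between relabeled (i.e. substituted) vertices is forbidden. Then $\mathrm{GED}(G_1,G_2;C)=\min_{\gamma} C(\gamma)$ over all restricted edit paths $\gamma$ from $G_1$ to $G_2$. It is a known fact that this is equivalent to the node map formulation: the minimum, over all bijections $\phi$ from a subset $U_1\subseteq V_1$ to a subset $U_2\subseteq V_2$, of the total induced cost, where vertices in $U_1$ are mapped (relabeled if the labels differ), vertices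 of $V_1\setminus U_1$ are deleted, vertices of $V_2\setminus U_2$ are inserted, an edge $(u,v)\in E_1$ with $u,v\in U_1$ and $(\phi(u),\phi(v))\in E_2$ is kept (relabeled if the labels differ), all other edges of $E_1$ are deleted, and all other edges of $E_2$ are inserted. $\mathsf{NP}$-hardness refers to the associated decision problem: given $G_1,G_2$ and a number $k$, decide whether $\mathrm{GED}(G_1,G_2;C_E)\le k$. *)

theory Defs
  imports
    "HOL-Computational_Algebra.Polynomial"
    "HOL-Library.Extended_Nonnegative_Real"
begin

section \<open>Multi-tape Turing machines, NP and NP-hardness\<close>

text \<open>
  States and tape symbols are natural numbers. Symbol \<open>0\<close> is the blank, \<open>1\<close> and \<open>2\<close> stand for
  the input bits. Tapes are infinite in both directions. A transition
  \<open>(q, rs, q', as)\<close> applies in state \<open>q\<close> if the heads read the symbols \<open>rs\<close> (one per tape); it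
  changes the state to \<open>q'\<close> and, for each tape, \<open>as\<close> gives the symbol to write and the head
  movement in \<open>{-1, 0, 1}\<close>. Machines are nondeterministic unless stated otherwise.
\<close>

type_synonym transition = "nat \<times> nat list \<times> nat \<times> (nat \<times> int) list"

record turing_machine =
  tm_tapes :: nat
  tm_states :: "nat set"
  tm_symbols :: "nat set"
  tm_start :: nat
  tm_final :: nat
  tm_trans :: "transition set"

definition turing_machine :: "turing_machine \<Rightarrow> bool" where
  "turing_machine M \<longleftrightarrow>
     tm_tapes M \<ge> 1 \<and>
     finite (tm_states M) \<and> tm_start M \<in> tm_states M \<and> tm_final M \<in> tm_states M \<and>
     finite (tm_symbols M) \<and> {0, 1, 2} \<subseteq> tm_symbols M \<and>
     (\<forall>(q, rs, q', as) \<in> tm_trans M.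
        q \<in> tm_states M \<and> q \<noteq> tm_final M \<and> q' \<in> tm_states M \<and>
        length rs = tm_tapes M \<and> set rs \<subseteq> tm_symbols M \<and>
        length as = tm_tapes M \<and> set as \<subseteq> tm_symbols M \<times> {-1, 0, 1})"

definition deterministic :: "turing_machine \<Rightarrow> bool" where
  "deterministic M \<longleftrightarrow>
     (\<forall>q rs a b. (q, rs, a) \<in> tm_trans M \<longrightarrow> (q, rs, b) \<in> tm_trans M \<longrightarrow> a = b)"

text \<open>A tape is its content together with the head position.\<close>

type_synonym tape = "(int \<Rightarrow> nat) \<times> int"
type_synonym config = "nat \<times> tape list"

definition tape_read :: "tape \<Rightarrow> nat" where
  "tape_read T = fst T (snd T)"

definition tape_act :: "nat \<times> int \<Rightarrow> tape \<Rightarrow> tape" where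
  "tape_act a T = ((fst T)(snd T := fst a), snd T + snd a)"

definition tm_step :: "turing_machine \<Rightarrow> config \<Rightarrow> config \<Rightarrow> bool" where
  "tm_step M c c' \<longleftrightarrow>
     (\<exists>q' as. (fst c, map tape_read (snd c), q', as) \<in> tm_trans M \<and>
              c' = (q', map2 tape_act as (snd c)))"

definition word_content :: "bool list \<Rightarrow> int \<Rightarrow> nat" where
  "word_content x i =
     (if 0 \<le> i \<and> i < int (length x) then (if x ! nat i then 2 else 1) else 0)"

definition tm_init :: "turing_machine \<Rightarrow> bool list \<Rightarrow> config" where
  "tm_init M x =
     (tm_start M, (word_content x, 0) # replicate (tm_tapes M - 1) (\<lambda>_. 0, 0))"

definition accepts_in :: "turing_machine \<Rightarrow> bool list \<Rightarrow> nat \<Rightarrow> bool" where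
  "accepts_in M x t \<longleftrightarrow> (\<exists>c. (tm_step M ^^ t) (tm_init M x) c \<and> fst c = tm_final M)"

text \<open>The output is read off the last tape.\<close>

definition outputs_in :: "turing_machine \<Rightarrow> bool list \<Rightarrow> bool list \<Rightarrow> nat \<Rightarrow> bool" where
  "outputs_in M x y t \<longleftrightarrow>
     (\<exists>c. (tm_step M ^^ t) (tm_init M x) c \<and> fst c = tm_final M \<and>
          fst (last (snd c)) = word_content y)"

definition polytime_computable :: "(bool list \<Rightarrow> bool list) \<Rightarrow> bool" where
  "polytime_computable f \<longleftrightarrow>
     (\<exists>M (p :: nat poly). turing_machine M \<and> deterministic M \<and>
        (\<forall>x. \<exists>t \<le> poly p (length x). outputs_in M x (f x) t))"

definition NP :: "bool list set set" where
  "NP = {L. \<exists>M (p :: nat poly). turing_machine M \<and>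
              (\<forall>x. x \<in> L \<longleftrightarrow> (\<exists>t. accepts_in M x t)) \<and>
              (\<forall>x \<in> L. \<exists>t \<le> poly p (length x). accepts_in M x t)}"

definition polytime_reducible :: "bool list set \<Rightarrow> bool list set \<Rightarrow> bool" where
  "polytime_reducible A B \<longleftrightarrow> (\<exists>f. polytime_computable f \<and> (\<forall>x. x \<in> A \<longleftrightarrow> f x \<in> B))"

definition NP_hard :: "bool list set \<Rightarrow> bool" where
  "NP_hard L \<longleftrightarrow> (\<forall>A \<in> NP. polytime_reducible A L)"


section \<open>Labeled graphs\<close>

text \<open>Labels are natural numbers; the alphabet is a set of labels. Edges are two-element sets.\<close>

record lgraph =
  verts :: "nat set"
  edges :: "nat set set"
  vlab :: "nat \<Rightarrow> nat"
  elab :: "nat set \<Rightarrow> nat"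

definition labeled_graph :: "nat set \<Rightarrow> lgraph \<Rightarrow> bool" where
  "labeled_graph \<Sigma> G \<longleftrightarrow>
     finite (verts G) \<and> (\<forall>e \<in> edges G. e \<subseteq> verts G \<and> card e = 2) \<and>
     (\<forall>v \<in> verts G. vlab G v \<in> \<Sigma>) \<and> (\<forall>e \<in> edges G. elab G e \<in> \<Sigma>)"

definition lgraph_iso :: "lgraph \<Rightarrow> lgraph \<Rightarrow> bool" where
  "lgraph_iso G H \<longleftrightarrow>
     (\<exists>f. bij_betw f (verts G) (verts H) \<and>
          (\<forall>v \<in> verts G. vlab H (f v) = vlab G v) \<and>
          (\<forall>u \<in> verts G. \<forall>v \<in> verts G. {u, v} \<in> edges G \<longleftrightarrow> {f u, f v} \<in> edges H) \<and>
          (\<forall>e \<in> edges G. elab H (f ` e) = elab G e))"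

definition path_graph :: "lgraph \<Rightarrow> bool" where
  "path_graph G \<longleftrightarrow>
     (\<exists>vs. vs \<noteq> [] \<and> distinct vs \<and> verts G = set vs \<and>
           edges G = {{vs ! i, vs ! Suc i} | i. Suc i < length vs})"

text \<open>The parameter \<open>a\<close> is the label common to all vertices.\<close>

definition edge_labeled_path :: "nat set \<Rightarrow> nat \<Rightarrow> lgraph \<Rightarrow> bool" where
  "edge_labeled_path \<Sigma> a G \<longleftrightarrow>
     labeled_graph \<Sigma> G \<and> path_graph G \<and> (\<forall>v \<in> verts G. vlab G v = a)"


section \<open>Graph edit distance\<close>

datatype edit_op =
    VIns nat nat
  | VDel nat
  | VRel nat nat
  | EIns "nat set" nat
  | EDel "nat set"
  | ERel "nat set" nat

record cost_function =
  vins_cost :: ennreal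
  vdel_cost :: ennreal
  vrel_cost :: ennreal
  eins_cost :: ennreal
  edel_cost :: ennreal
  erel_cost :: ennreal

fun applicable :: "lgraph \<Rightarrow> edit_op \<Rightarrow> bool" where
  "applicable G (VIns v l) \<longleftrightarrow> v \<notin> verts G"
| "applicable G (VDel v) \<longleftrightarrow> v \<in> verts G \<and> (\<forall>e \<in> edges G. v \<notin> e)"
| "applicable G (VRel v l) \<longleftrightarrow> v \<in> verts G"
| "applicable G (EIns e l) \<longleftrightarrow> e \<subseteq> verts G \<and> card e = 2 \<and> e \<notin> edges G"
| "applicable G (EDel e) \<longleftrightarrow> e \<in> edges G"
| "applicable G (ERel e l) \<longleftrightarrow> e \<in> edges G"

fun apply_op :: "lgraph \<Rightarrow> edit_op \<Rightarrow> lgraph" where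
  "apply_op G (VIns v l) = G\<lparr>verts := insert v (verts G), vlab := (vlab G)(v := l)\<rparr>"
| "apply_op G (VDel v) = G\<lparr>verts := verts G - {v}\<rparr>"
| "apply_op G (VRel v l) = G\<lparr>vlab := (vlab G)(v := l)\<rparr>"
| "apply_op G (EIns e l) = G\<lparr>edges := insert e (edges G), elab := (elab G)(e := l)\<rparr>"
| "apply_op G (EDel e) = G\<lparr>edges := edges G - {e}\<rparr>"
| "apply_op G (ERel e l) = G\<lparr>elab := (elab G)(e := l)\<rparr>"

fun op_cost :: "cost_function \<Rightarrow> lgraph \<Rightarrow> edit_op \<Rightarrow> ennreal" where
  "op_cost C G (VIns v l) = vins_cost C"
| "op_cost C G (VDel v) = vdel_cost C"
| "op_cost C G (VRel v l) = (if vlab G v = l then 0 else vrel_cost C)"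
| "op_cost C G (EIns e l) = eins_cost C"
| "op_cost C G (EDel e) = edel_cost C"
| "op_cost C G (ERel e l) = (if elab G e = l then 0 else erel_cost C)"

fun op_target :: "edit_op \<Rightarrow> nat + nat set" where
  "op_target (VIns v l) = Inl v"
| "op_target (VDel v) = Inl v"
| "op_target (VRel v l) = Inl v"
| "op_target (EIns e l) = Inr e"
| "op_target (EDel e) = Inr e"
| "op_target (ERel e l) = Inr e"

fun all_applicable :: "lgraph \<Rightarrow> edit_op list \<Rightarrow> bool" where
  "all_applicable G [] \<longleftrightarrow> True"
| "all_applicable G (x # xs) \<longleftrightarrow> applicable G x \<and> all_applicable (apply_op G x) xs"

fun edit_cost :: "cost_function \<Rightarrow> lgraph \<Rightarrow> edit_op list \<Rightarrow> ennreal" where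
  "edit_cost C G [] = 0"
| "edit_cost C G (x # xs) = op_cost C G x + edit_cost C (apply_op G x) xs"

text \<open>
  Applicability forces incident edges to be deleted before a vertex and endpoints to exist before
  an edge is inserted. Since an edge is identified with the pair of its endpoints, distinctness of
  the targets says that every vertex and edge is edited at most once and also rules out deleting
  and reinserting an edge between two vertices that are kept. Inserting a vertex never needs to
  reuse the name of a deleted one, as there are infinitely many names.
\<close>

definition restricted_edit_path :: "lgraph \<Rightarrow> lgraph \<Rightarrow> edit_op list \<Rightarrow> bool" where
  "restricted_edit_path G H ops \<longleftrightarrow>
     all_applicable G ops \<and> distinct (map op_target ops) \<and>
     lgraph_iso (foldl apply_op G ops) H"

definition GED :: "cost_function \<Rightarrow> lgraph \<Rightarrow> lgraph \<Rightarrow> ennreal" where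
  "GED C G H = (INF ops \<in> {ops. restricted_edit_path G H ops}. edit_cost C G ops)"

definition C_E :: cost_function where
  "C_E = \<lparr>vins_cost = 0, vdel_cost = 0, vrel_cost = \<infinity>,
          eins_cost = 1, edel_cost = 1, erel_cost = 2\<rparr>"


section \<open>The decision problem\<close>

text \<open>
  A graph with vertex set \<open>{..<n}\<close> is encoded by \<open>n\<close>, its vertex labels and its adjacency matrix
  below the diagonal, with entry \<open>0\<close> for a non-edge and \<open>Suc l\<close> for an edge labeled \<open>l\<close>. All
  numbers are written in unary. For the threshold \<open>k\<close> this can only make hardness a stronger
  claim than it is for binary notation.
\<close>

definition enc_nat :: "nat \<Rightarrow> bool list" where
  "enc_nat n = replicate n True @ [False]"

definition enc_graph :: "lgraph \<Rightarrow> bool list" where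
  "enc_graph G =
     (let n = card (verts G) in
        enc_nat n @
        concat (map (\<lambda>v. enc_nat (vlab G v)) [0..<n]) @
        concat (map (\<lambda>v. concat (map (\<lambda>u.
          enc_nat (if {u, v} \<in> edges G then Suc (elab G {u, v}) else 0)) [0..<v])) [0..<n]))"

definition enc_instance :: "lgraph \<Rightarrow> lgraph \<Rightarrow> nat \<Rightarrow> bool list" where
  "enc_instance G H k = enc_graph G @ enc_graph H @ enc_nat k"

definition GED_path_problem :: "nat set \<Rightarrow> cost_function \<Rightarrow> bool list set" where
  "GED_path_problem \<Sigma> C =
     {enc_instance G H k | G H k.
        (\<exists>a. edge_labeled_path \<Sigma> a G \<and> edge_labeled_path \<Sigma> a H) \<and>
        verts G = {..<card (verts G)} \<and> verts H = {..<card (verts H)} \<and>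
        GED C G H \<le> of_nat k}"

end

(*
  Relabelling an edge costs as much as deleting and reinserting it, and vertices are free. So the
  distance is |E1| + |E2| - 2m, where m is the largest number of edges of G2 that an injective
  vertex map sends to edges of G1 with the same label. If the first path consists of runs of
  0-edges separated by 1-edges, and the second one of runs of 0-edges separated by 2-edges, then
  only 0-edges can be matched, and they can all be matched iff the runs of the second path can be
  packed into those of the first one: bin packing with unary numbers.

  Packing is shown to be hard directly for tilings of a space-time diagram. There is a bin for
  every cell and tile. Every cell has one real token, to be put into the bin of the chosen tile,
  and dummy tokens for its other bins. Every pair of conflicting tiles of neighbouring cells has a
  real token and a dummy, shared by the two bins; a bin with the real token of its cell has no room
  for dummies of conflicts, so one bin of the pair is not chosen. The high-order digits of the sizes
  force every token into a bin that it belongs to, and the lowest digit expresses the capacity.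

  The reduction is a nest of loops with polynomial bounds, which is compiled to a Turing machine
  whose tapes are counters and whose states are the residual programs.
*)
theory Submission
  imports Defs "HOL-Library.Countable"
begin

section \<open>Structured programs for multi-tape machines\<close>

text \<open>Unary sizes must stay polynomial, so a digit of its own for every cell is out of the
  question. Digits are spent only on the kinds of tokens, of which there are \<open>T + 1\<close>, a
  number that depends on the machine alone. The position \<open>x\<close> of a token is recorded by
  value instead, in the three digits 1, x and x^2: a bin is to receive at most two tokens of a kind,
  and two numbers are determined by their sum and the sum of their squares. Total capacity and total
  size agree in the high-order digits, so no bin can deviate from its prescribed contents, and the
  large numbers cancel in the threshold. The tableau keeps all heads of a multi-tape machine in one
  column and shifts the tapes instead, so that a local rule sees all symbols read at once. The loop
  language has neither reset nor decrement. Its counters only grow, so polynomial bounds on their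
  final values control the whole computation.\<close>

datatype com = Skip | Act nat "nat option" int | Seq com com | If nat nat com com | While nat nat com

instance com :: countable
  by countable_datatype

definition keep :: "nat list \<Rightarrow> (nat \<times> int) list" where
  "keep rs = map (\<lambda>r. (r, 0)) rs"

text \<open>A machine transition acts on every tape, so tapes that are not concerned rewrite the
  symbol read (\<open>keep\<close>). In \<open>While j s c\<close> the symbol \<open>s\<close> stops
  the loop. Passing from \<open>Seq Skip d\<close> to \<open>d\<close> is a step of its own.\<close>

fun cstep :: "com \<Rightarrow> nat list \<Rightarrow> com \<times> (nat \<times> int) list" where
  "cstep Skip rs = (Skip, keep rs)"
| "cstep (Act j w m) rs = (Skip, (keep rs)[j := (case w of None \<Rightarrow> rs ! j | Some s \<Rightarrow> s, m)])"
| "cstep (Seq c d) rs =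
     (if c = Skip then (d, keep rs) else (Seq (fst (cstep c rs)) d, snd (cstep c rs)))"
| "cstep (If j s c d) rs = (if rs ! j = s then c else d, keep rs)"
| "cstep (While j s c) rs = (if rs ! j = s then Skip else Seq c (While j s c), keep rs)"

text \<open>The possible control states, in the manner of the partial derivatives of a regular
  expression. A pass through a loop returns to the loop itself, so the set is finite although runs
  are unbounded.\<close>

fun residuals :: "com \<Rightarrow> com set" where
  "residuals Skip = {Skip}"
| "residuals (Act j w m) = {Act j w m, Skip}"
| "residuals (Seq c d) = (\<lambda>c'. Seq c' d) ` residuals c \<union> residuals d"
| "residuals (If j s c d) = insert (If j s c d) (residuals c \<union> residuals d)"
| "residuals (While j s c) =
     {While j s c, Skip} \<union> (\<lambda>c'. Seq c' (While j s c)) ` residuals c"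

lemma finite_residuals: "finite (residuals c)"
  by (induction c) auto

lemma self_in_residuals: "c \<in> residuals c"
  by (induction c) auto

lemma Skip_in_residuals: "Skip \<in> residuals c"
  by (induction c) auto

lemma cstep_in_residuals: "d \<in> residuals c \<Longrightarrow> fst (cstep d rs) \<in> residuals c"
proof (induction c arbitrary: d)
  case (Seq c1 c2)
  from Seq.prems consider c' where "c' \<in> residuals c1" "d = Seq c' c2" | "d \<in> residuals c2"
    by auto
  then show ?case
    by cases (simp_all add: Seq.IH self_in_residuals)
next
  case (While j s c)
  from While.prems consider "d = While j s c" | "d = Skip"
    | c' where "c' \<in> residuals c" "d = Seq c' (While j s c)"
    by auto
  then show ?case
    by cases (simp_all add: While.IH self_in_residuals)
next
  case (If j s c1 c2)
  from If.prems consider "d = If j s c1 c2" | "d \<in> residuals c1" | "d \<in> residuals c2"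
    by auto
  then show ?case
    by cases (simp_all add: If.IH self_in_residuals)
qed auto

fun wf_com :: "nat \<Rightarrow> com \<Rightarrow> bool" where
  "wf_com k Skip \<longleftrightarrow> True"
| "wf_com k (Act j w m) \<longleftrightarrow> j < k \<and> w \<in> {None, Some 0, Some 1, Some 2} \<and> m \<in> {-1, 0, 1}"
| "wf_com k (Seq c d) \<longleftrightarrow> wf_com k c \<and> wf_com k d"
| "wf_com k (If j s c d) \<longleftrightarrow> j < k \<and> wf_com k c \<and> wf_com k d"
| "wf_com k (While j s c) \<longleftrightarrow> j < k \<and> wf_com k c"

lemma wf_com_residuals: "wf_com k c \<Longrightarrow> d \<in> residuals c \<Longrightarrow> wf_com k d"
proof (induction c arbitrary: d)
  case (Seq c1 c2)
  from Seq.prems(2) consider c' where "c' \<in> residuals c1" "d = Seq c' c2" | "d \<in> residuals c2"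
    by auto
  then show ?case
  proof cases
    case (1 c')
    then show ?thesis using Seq.prems(1) Seq.IH(1)[of c'] by simp
  next
    case 2
    then show ?thesis using Seq.prems(1) Seq.IH(2)[of d] by simp
  qed
next
  case (If j s c1 c2)
  from If.prems(2) consider "d = If j s c1 c2" | "d \<in> residuals c1" | "d \<in> residuals c2"
    by auto
  then show ?case
  proof cases
    case 2
    then show ?thesis using If.prems(1) If.IH(1)[of d] by simp
  next
    case 3
    then show ?thesis using If.prems(1) If.IH(2)[of d] by simp
  qed (use If.prems(1) in simp)
next
  case (While j s c)
  from While.prems(2) consider "d = While j s c" | "d = Skip"
    | c' where "c' \<in> residuals c" "d = Seq c' (While j s c)"
    by auto
  then show ?case
  proof cases
    case (3 c')
    then show ?thesis using While.prems(1) While.IH[of c'] by simp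
  qed (use While.prems(1) in simp_all)
next
  case (Act j w m)
  then have "d = Act j w m \<or> d = Skip" by simp
  then show ?case using Act.prems(1) by (elim disjE) simp_all
qed simp

lemma length_cstep: "length (snd (cstep c rs)) = length rs"
  by (induction c) (auto simp: keep_def)

definition actions :: "(nat \<times> int) set" where
  "actions = {0, 1, 2} \<times> {-1, 0, 1}"

lemma set_keep: "set rs \<subseteq> {0, 1, 2} \<Longrightarrow> set (keep rs) \<subseteq> actions"
  unfolding keep_def actions_def set_map by blast

lemma set_cstep:
  assumes "wf_com (length rs) c" and "set rs \<subseteq> {0, 1, 2}"
  shows "set (snd (cstep c rs)) \<subseteq> actions"
  using assms(1)
proof (induction c)
  case (Act j w m)
  then have "rs ! j \<in> {0, 1, 2}"
    using assms(2) nth_mem[of j rs] by (simp add: subset_iff)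
  then have "(case w of None \<Rightarrow> rs ! j | Some s \<Rightarrow> s, m) \<in> actions"
    using Act by (cases w) (auto simp: actions_def)
  then show ?case
    using set_keep[OF assms(2)] set_update_subset_insert[of "keep rs" j]
    by (simp only: cstep.simps snd_conv) blast
qed (simp_all add: set_keep[OF assms(2)])

text \<open>Commands become states through their countable numbering. \<open>Skip\<close> is the
  final state and gets no outgoing transition, as \<open>turing_machine\<close> demands.\<close>

definition machine :: "nat \<Rightarrow> com \<Rightarrow> turing_machine" where
  "machine k c =
     \<lparr>tm_tapes = k, tm_states = to_nat ` residuals c, tm_symbols = {0, 1, 2},
      tm_start = to_nat c, tm_final = to_nat Skip,
      tm_trans = {(to_nat d, rs, to_nat (fst (cstep d rs)), snd (cstep d rs)) | d rs.
        d \<in> residuals c \<and> d \<noteq> Skip \<and> length rs = k \<and> set rs \<subseteq> {0, 1, 2}}\<rparr>"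

lemma turing_machine_machine:
  assumes "k \<ge> 1" and "wf_com k c"
  shows "turing_machine (machine k c)"
proof -
  have *: "set (snd (cstep d rs)) \<subseteq> actions"
    if "d \<in> residuals c" "length rs = k" "set rs \<subseteq> {0, 1, 2}" for d rs
    using set_cstep wf_com_residuals assms(2) that by blast
  have "q \<in> to_nat ` residuals c \<and> q \<noteq> to_nat Skip \<and> q' \<in> to_nat ` residuals c \<and>
      length rs = k \<and> set rs \<subseteq> {0, 1, 2} \<and> length as = k \<and> set as \<subseteq> actions"
    if tr: "(q, rs, q', as) \<in> tm_trans (machine k c)" for q rs q' as
  proof -
    obtain d where d: "d \<in> residuals c" "d \<noteq> Skip" "length rs = k" "set rs \<subseteq> {0, 1, 2}"
      "q = to_nat d" "q' = to_nat (fst (cstep d rs))" "as = snd (cstep d rs)"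
      using tr by (auto simp: machine_def)
    show ?thesis
      unfolding d(5-7) using d(1-4) *[OF d(1,3,4)]
      by (simp add: cstep_in_residuals length_cstep)
  qed
  then show ?thesis
    using assms
    by (auto simp: turing_machine_def machine_def finite_residuals self_in_residuals
        Skip_in_residuals actions_def split: prod.splits)
qed

text \<open>\<open>cstep\<close> is a function and \<open>to_nat\<close> is injective.\<close>

lemma deterministic_machine: "deterministic (machine k c)"
  by (auto simp: deterministic_def machine_def)

section \<open>Execution of commands in exact time\<close>

definition com_step :: "com \<times> tape list \<Rightarrow> com \<times> tape list \<Rightarrow> bool" where
  "com_step s s' \<longleftrightarrow> fst s \<noteq> Skip \<and>
     s' = (fst (cstep (fst s) (map tape_read (snd s))),
           map2 tape_act (snd (cstep (fst s) (map tape_read (snd s)))) (snd s))"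

lemma map2_keep: "map2 tape_act (keep (map tape_read T)) T = T"
  by (rule nth_equalityI) (auto simp: keep_def tape_act_def tape_read_def)

text \<open>Big-step semantics with exact step counts. The extra 1 in a sequence is the step that
  discards the finished \<open>Skip\<close>.\<close>

inductive exec :: "com \<Rightarrow> tape list \<Rightarrow> nat \<Rightarrow> tape list \<Rightarrow> bool" where
  exec_Skip: "exec Skip T 0 T"
| exec_Act: "j < length T \<Longrightarrow>
     exec (Act j w m) T 1
       (T[j := tape_act (case w of None \<Rightarrow> tape_read (T ! j) | Some s \<Rightarrow> s, m) (T ! j)])"
| exec_Seq: "exec c T t T' \<Longrightarrow> exec d T' u T'' \<Longrightarrow> exec (Seq c d) T (t + 1 + u) T''"
| exec_If: "j < length T \<Longrightarrow> exec (if tape_read (T ! j) = s then c else d) T t T' \<Longrightarrow>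
     exec (If j s c d) T (1 + t) T'"
| exec_While_done: "j < length T \<Longrightarrow> tape_read (T ! j) = s \<Longrightarrow> exec (While j s c) T 1 T"
| exec_While_loop: "j < length T \<Longrightarrow> tape_read (T ! j) \<noteq> s \<Longrightarrow> exec c T t T' \<Longrightarrow>
     exec (While j s c) T' u T'' \<Longrightarrow> exec (While j s c) T (1 + (t + 1 + u)) T''"

lemma exec_Seq_le:
  assumes "exec c T t T'" and "exec d T' u T''" and "t + u + 1 \<le> b"
  shows "\<exists>t \<le> b. exec (Seq c d) T t T''"
  using exec_Seq[OF assms(1,2)] assms(3) by (intro exI[of _ "t + 1 + u"]) simp

lemma com_step_Seq:
  "com_step (c, T) (c', T') \<Longrightarrow> com_step (Seq c d, T) (Seq c' d, T')"
  by (auto simp: com_step_def)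

lemma com_steps_Seq:
  "(com_step ^^ t) (c, T) (c', T') \<Longrightarrow> (com_step ^^ t) (Seq c d, T) (Seq c' d, T')"
proof (induction t arbitrary: c' T')
  case (Suc t)
  then obtain e U where "(com_step ^^ t) (c, T) (e, U)" "com_step (e, U) (c', T')"
    by (auto elim: relpowp_Suc_E)
  then show ?case
    using Suc.IH com_step_Seq by (blast intro: relpowp_Suc_I)
qed auto

lemma relpowp_add_I: "(P ^^ m) x y \<Longrightarrow> (P ^^ n) y z \<Longrightarrow> (P ^^ (m + n)) x z"
  by (auto simp: relpowp_add)

lemma relpowp_1_I: "P x y \<Longrightarrow> (P ^^ 1) x y"
  for P :: "'a \<Rightarrow> 'a \<Rightarrow> bool"
  using relpowp_Suc_I[of 0 P x x y] by simp

lemma com_steps_Skip_Seq: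
  assumes "(com_step ^^ t) (c, T) (Skip, T')" and "(com_step ^^ u) (d, T') s"
  shows "(com_step ^^ (t + 1 + u)) (Seq c d, T) s"
proof -
  have "com_step (Seq Skip d, T') (d, T')"
    by (simp add: com_step_def map2_keep)
  then show ?thesis
    using com_steps_Seq[OF assms(1)] assms(2) relpowp_add_I relpowp_1_I by metis
qed

lemma exec_com_steps: "exec c T t T' \<Longrightarrow> (com_step ^^ t) (c, T) (Skip, T')"
proof (induction rule: exec.induct)
  case (exec_Act j T w m)
  have "map2 tape_act ((keep (map tape_read T))[j := (case w of None \<Rightarrow> map tape_read T ! j | Some s \<Rightarrow> s, m)]) T
     = T[j := tape_act (case w of None \<Rightarrow> tape_read (T ! j) | Some s \<Rightarrow> s, m) (T ! j)]"
    using exec_Act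
    by (intro nth_equalityI)
      (auto simp: keep_def nth_list_update tape_act_def tape_read_def split: option.splits)
  then show ?case
    by (intro relpowp_1_I) (simp add: com_step_def)
next
  case (exec_Seq c T t T' d u T'')
  then show ?case by (blast intro: com_steps_Skip_Seq)
next
  case (exec_If j T s c d t T')
  then have "com_step (If j s c d, T) (if tape_read (T ! j) = s then c else d, T)"
    by (simp add: com_step_def map2_keep)
  then show ?case
    using exec_If by (blast intro: relpowp_add_I relpowp_1_I)
next
  case (exec_While_done j T s c)
  then show ?case
    by (intro relpowp_1_I) (simp add: com_step_def map2_keep)
next
  case (exec_While_loop j T s c t T' u T'')
  then have "com_step (While j s c, T) (Seq c (While j s c), T)"
    by (simp add: com_step_def map2_keep)
  then show ?case
    using exec_While_loop com_steps_Skip_Seq by (blast intro: relpowp_add_I relpowp_1_I)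
qed auto

text \<open>The machine has transitions only for the symbols 0, 1 and 2, so simulating a command on
  it requires this invariant.\<close>

definition good_tapes :: "nat \<Rightarrow> tape list \<Rightarrow> bool" where
  "good_tapes k T \<longleftrightarrow> length T = k \<and> (\<forall>A \<in> set T. \<forall>i. fst A i \<le> 2)"

lemma le_2_iff: "n \<le> 2 \<longleftrightarrow> n \<in> {0, 1, 2 :: nat}"
  by auto

lemma good_tapes_act:
  assumes "good_tapes k T" and "length as = k" and "set as \<subseteq> actions"
  shows "good_tapes k (map2 tape_act as T)"
proof -
  have "fst (map2 tape_act as T ! i) j \<le> 2" if "i < k" for i j
  proof -
    have "as ! i \<in> actions" "T ! i \<in> set T"
      using that assms by (auto simp: good_tapes_def)
    then have "fst (as ! i) \<le> 2" "\<forall>j. fst (T ! i) j \<le> 2"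
      using assms(1) by (auto simp: good_tapes_def actions_def)
    then show ?thesis
      using that assms by (simp add: good_tapes_def tape_act_def)
  qed
  then show ?thesis
    using assms by (simp add: good_tapes_def all_set_conv_all_nth)
qed

lemma com_steps_machine:
  assumes "(com_step ^^ t) (c, T) (d, T')" and "wf_com k c" and "good_tapes k T"
  shows "(tm_step (machine k c) ^^ t) (to_nat c, T) (to_nat d, T') \<and> d \<in> residuals c \<and>
    good_tapes k T'"
  using assms
proof (induction t arbitrary: d T')
  case 0
  then show ?case by (auto simp: self_in_residuals)
next
  case (Suc t)
  then obtain e U where e: "(com_step ^^ t) (c, T) (e, U)" "com_step (e, U) (d, T')"
    by (auto elim: relpowp_Suc_E)
  then have IH: "(tm_step (machine k c) ^^ t) (to_nat c, T) (to_nat e, U)" "e \<in> residuals c"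
    "good_tapes k U"
    using Suc by auto
  let ?rs = "map tape_read U"
  have rs: "length ?rs = k" "set ?rs \<subseteq> {0, 1, 2}"
    unfolding subset_iff le_2_iff[symmetric]
    using IH(3) by (auto simp: good_tapes_def tape_read_def)
  have d: "e \<noteq> Skip" "d = fst (cstep e ?rs)" "T' = map2 tape_act (snd (cstep e ?rs)) U"
    using e(2) by (auto simp: com_step_def)
  have "tm_step (machine k c) (to_nat e, U) (to_nat d, T')"
    unfolding tm_step_def
    using d rs IH(2) by (auto simp: machine_def)
  moreover have "good_tapes k T'"
    unfolding d using IH rs wf_com_residuals[OF Suc.prems(2)] set_cstep[of ?rs e]
    by (intro good_tapes_act) (simp_all add: length_cstep)
  ultimately show ?case
    using IH d cstep_in_residuals by (auto intro: relpowp_Suc_I)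
qed

lemma exec_outputs_in:
  assumes "exec c ((word_content x, 0) # replicate (k - 1) (\<lambda>_. 0, 0)) t T" and "wf_com k c"
    and "k \<ge> 1" and "fst (last T) = word_content y"
  shows "outputs_in (machine k c) x y t"
proof -
  have "good_tapes k ((word_content x, 0) # replicate (k - 1) (\<lambda>_. 0, 0))"
    using \<open>k \<ge> 1\<close> by (simp add: good_tapes_def word_content_def set_replicate_conv_if)
  then have "(tm_step (machine k c) ^^ t)
      (to_nat c, (word_content x, 0) # replicate (k - 1) (\<lambda>_. 0, 0)) (to_nat Skip, T)"
    using com_steps_machine exec_com_steps assms by blast
  then show ?thesis
    using assms(4) by (auto simp: outputs_in_def tm_init_def machine_def)
qed


section \<open>Loop programs\<close>

text \<open>The emitted letters are polymorphic so that a word of edge labels can be described first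
  and replaced by bits later. \<open>Rep v p\<close> uses the value that \<open>v\<close> has on
  entry; the body may increment \<open>v\<close>.\<close>

datatype 'a prog = Nop | Inc nat | Emit 'a | Then "'a prog" "'a prog" | Rep nat "'a prog"
  | Input "'a prog" "'a prog"

fun run :: "bool list \<Rightarrow> 'a prog \<Rightarrow> (nat \<Rightarrow> nat) \<times> 'a list \<Rightarrow> (nat \<Rightarrow> nat) \<times> 'a list" where
  "run x Nop s = s"
| "run x (Inc v) s = ((fst s)(v := Suc (fst s v)), snd s)"
| "run x (Emit a) s = (fst s, snd s @ [a])"
| "run x (Then p q) s = run x q (run x p s)"
| "run x (Rep v p) s = (run x p ^^ fst s v) s"
| "run x (Input p q) s = fold (\<lambda>b. if b then run x p else run x q) x s"

fun pvars :: "'a prog \<Rightarrow> nat set" where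
  "pvars Nop = {}"
| "pvars (Inc v) = {v}"
| "pvars (Emit a) = {}"
| "pvars (Then p q) = pvars p \<union> pvars q"
| "pvars (Rep v p) = insert v (pvars p)"
| "pvars (Input p q) = pvars p \<union> pvars q"

fun no_input :: "'a prog \<Rightarrow> bool" where
  "no_input (Then p q) \<longleftrightarrow> no_input p \<and> no_input q"
| "no_input (Rep v p) \<longleftrightarrow> no_input p"
| "no_input (Input p q) \<longleftrightarrow> False"
| "no_input _ \<longleftrightarrow> True"

text \<open>There is one input head, and it is rewound only after a full scan. Scans may be repeated
  but not nested.\<close>

fun flat_input :: "'a prog \<Rightarrow> bool" where
  "flat_input (Then p q) \<longleftrightarrow> flat_input p \<and> flat_input q"
| "flat_input (Rep v p) \<longleftrightarrow> flat_input p"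
| "flat_input (Input p q) \<longleftrightarrow> no_input p \<and> no_input q"
| "flat_input _ \<longleftrightarrow> True"

lemma no_input_flat_input: "no_input p \<Longrightarrow> flat_input p"
  by (induction p) auto

lemma funpow_invariant:
  assumes "P s" and "\<And>s. P s \<Longrightarrow> P (f s)"
  shows "P ((f ^^ n) s)"
  using assms by (induction n) auto

lemma fold_invariant:
  assumes "P s" and "\<And>b s. b \<in> set x \<Longrightarrow> P s \<Longrightarrow> P (f b s)"
  shows "P (fold f x s)"
  using assms by (induction x arbitrary: s) auto

text \<open>No operation lowers a counter. A bound on the final values therefore holds in every
  intermediate state as well.\<close>

lemma run_mono: "fst s v \<le> fst (run x p s) v"
proof (induction p arbitrary: s)
  case (Then p q)
  then show ?case using le_trans by fastforce
next
  case (Rep w p)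
  then show ?case
    by (auto intro!: funpow_invariant[where P = "\<lambda>s'. fst s v \<le> fst s' v"] intro: le_trans)
next
  case (Input p q)
  then show ?case
    by (auto intro!: fold_invariant[where P = "\<lambda>s'. fst s v \<le> fst s' v"] intro: le_trans)
qed auto

lemma run_frame: "v \<notin> pvars p \<Longrightarrow> fst (run x p s) v = fst s v"
proof (induction p arbitrary: s)
  case (Rep w p)
  then show ?case
    by (auto intro!: funpow_invariant[where P = "\<lambda>s'. fst s' v = fst s v"])
next
  case (Input p q)
  then show ?case
    by (auto intro!: fold_invariant[where P = "\<lambda>s'. fst s' v = fst s v"])
qed auto

definition upd :: "nat \<Rightarrow> nat \<Rightarrow> (nat \<Rightarrow> nat) \<times> 'a list \<Rightarrow> (nat \<Rightarrow> nat) \<times> 'a list" where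
  "upd v a s = ((fst s)(v := a), snd s)"

text \<open>For the scratch variable in which \<open>compile\<close> keeps the remaining number of
  passes: the body neither reads nor changes it.\<close>

lemma run_upd: "v \<notin> pvars p \<Longrightarrow> run x p (upd v a s) = upd v a (run x p s)"
proof (induction p arbitrary: s)
  case (Rep w p)
  have "(run x p ^^ n) (upd v a s) = upd v a ((run x p ^^ n) s)" for n
    using Rep by (induction n) auto
  then show ?case
    using Rep by (simp add: upd_def)
next
  case (Input p q)
  have "fold (\<lambda>b. if b then run x p else run x q) y (upd v a s) =
      upd v a (fold (\<lambda>b. if b then run x p else run x q) y s)" for y
    using Input by (induction y arbitrary: s) auto
  then show ?case by simp
qed (auto simp: upd_def fun_upd_twist)

section \<open>Compilation to counters on tapes\<close>

text \<open>Tape 0 holds the input, tape \<open>Suc j\<close> encodes counter \<open>j\<close> as the head position relative to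
  a mark at 0, and the last tape holds the output.\<close>

definition mark :: "int \<Rightarrow> nat" where
  "mark i = (if i = 0 then 1 else 0)"

definition tapes :: "nat \<Rightarrow> bool list \<Rightarrow> int \<Rightarrow> (nat \<Rightarrow> nat) \<times> bool list \<Rightarrow> tape list" where
  "tapes K x h s =
     (word_content x, h) # map (\<lambda>j. (mark, int (fst s j))) [0..<K] @
     [(word_content (snd s), int (length (snd s)))]"

abbreviation "cinc j \<equiv> Act (Suc j) None 1"
abbreviation "cdec j \<equiv> Act (Suc j) None (-1)"
abbreviation "while_nz j c \<equiv> While (Suc j) 1 c"

text \<open>\<open>d\<close> is the first free scratch counter. A loop empties \<open>v\<close> into
  both \<open>d\<close> and \<open>Suc d\<close>, restores \<open>v\<close> from
  \<open>Suc d\<close> and then counts \<open>d\<close> down, so the body is free to change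
  \<open>v\<close>. A scan of the input ends at the blank behind the word, walks back to the blank
  in front of it and steps right once.\<close>

fun compile :: "nat \<Rightarrow> nat \<Rightarrow> bool prog \<Rightarrow> com" where
  "compile K d Nop = Skip"
| "compile K d (Inc v) = cinc v"
| "compile K d (Emit b) = Act (Suc K) (Some (if b then 2 else 1)) 1"
| "compile K d (Then p q) = Seq (compile K d p) (compile K d q)"
| "compile K d (Rep v p) =
     Seq (while_nz v (Seq (cdec v) (Seq (cinc d) (cinc (Suc d)))))
       (Seq (while_nz (Suc d) (Seq (cdec (Suc d)) (cinc v)))
         (while_nz d (Seq (cdec d) (compile K (d + 2) p))))"
| "compile K d (Input p q) =
     Seq (While 0 0 (Seq (If 0 2 (compile K d p) (compile K d q)) (Act 0 None 1)))
       (Seq (Act 0 None (-1)) (Seq (While 0 0 (Act 0 None (-1))) (Act 0 None 1)))"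

fun rep_depth :: "'a prog \<Rightarrow> nat" where
  "rep_depth (Then p q) = max (rep_depth p) (rep_depth q)"
| "rep_depth (Rep v p) = Suc (rep_depth p)"
| "rep_depth (Input p q) = max (rep_depth p) (rep_depth q)"
| "rep_depth _ = 0"

text \<open>A time bound with slack, where \<open>b\<close> is to bound the input length and all
  counters. For a fixed program it is polynomial in \<open>b\<close>.\<close>

fun cost :: "'a prog \<Rightarrow> nat \<Rightarrow> nat" where
  "cost Nop b = 0"
| "cost (Inc v) b = 1"
| "cost (Emit a) b = 1"
| "cost (Then p q) b = cost p b + cost q b + 1"
| "cost (Rep v p) b = b * (cost p b + 20) + 20"
| "cost (Input p q) b = b * (cost p b + cost q b + 20) + 20"

lemma wf_compile:
  assumes "\<forall>v \<in> pvars p. v < d" and "d + 2 * rep_depth p \<le> K"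
  shows "wf_com (K + 2) (compile K d p)"
proof -
  have "\<lbrakk>\<forall>v \<in> pvars p. v < e; e \<le> d; d + 2 * rep_depth p \<le> K\<rbrakk> \<Longrightarrow>
      wf_com (K + 2) (compile K d p)" for e d
  proof (induction p arbitrary: d)
    case (Rep v p)
    then have "wf_com (K + 2) (compile K (d + 2) p)"
      by simp
    then show ?case using Rep.prems by simp
  qed simp_all
  then show ?thesis using assms by blast
qed

text \<open>The run of the loop is given as a sequence \<open>S\<close> of tape states. A pass costs
  the body plus 2, for the test and for discarding the finished body; the last test costs 1.\<close>

lemma exec_While_iterate:
  assumes "j < length (S 0)"
    and "\<And>i. i < n \<Longrightarrow> length (S (Suc i)) = length (S i)"
    and "\<And>i. i < n \<Longrightarrow> tape_read (S i ! j) \<noteq> a"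
    and "\<And>i. i < n \<Longrightarrow> \<exists>t \<le> b. exec c (S i) t (S (Suc i))"
    and "tape_read (S n ! j) = a"
  shows "\<exists>t \<le> n * (b + 2) + 1. exec (While j a c) (S 0) t (S n)"
  using assms
proof (induction n arbitrary: S)
  case 0
  then have "exec (While j a c) (S 0) 1 (S 0)"
    by (intro exec_While_done) auto
  then show ?case by auto
next
  case (Suc n)
  obtain t where t: "t \<le> b" "exec c (S 0) t (S 1)"
    using Suc.prems(4)[of 0] by auto
  have "\<exists>t \<le> n * (b + 2) + 1. exec (While j a c) (S (Suc 0)) t (S (Suc n))"
    using Suc.prems(1) Suc.prems(2)[of 0] Suc.prems
    by (intro Suc.IH[of "\<lambda>i. S (Suc i)"]) auto
  then obtain u where u: "u \<le> n * (b + 2) + 1" "exec (While j a c) (S 1) u (S (Suc n))"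
    by auto
  have "exec (While j a c) (S 0) (1 + (t + 1 + u)) (S (Suc n))"
    using Suc.prems t u by (intro exec_While_loop[of _ _ _ _ _ "S 1"]) auto
  moreover have "1 + (t + 1 + u) \<le> Suc n * (b + 2) + 1"
    using t(1) u(1) by (simp add: algebra_simps)
  ultimately show ?case by blast
qed


lemma upd_simps [simp]:
  "fst (upd v a s) w = (if w = v then a else fst s w)" "snd (upd v a s) = snd s"
  by (auto simp: upd_def)

lemma state_eqI: "(\<And>v. fst s v = fst s' v) \<Longrightarrow> snd s = snd s' \<Longrightarrow> s = s'"
  for s :: "(nat \<Rightarrow> nat) \<times> 'a list"
  by (simp add: prod_eq_iff fun_eq_iff)

lemma length_tapes [simp]: "length (tapes K x h s) = K + 2"
  by (simp add: tapes_def)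

lemma tapes_nth [simp]:
  "tapes K x h s ! 0 = (word_content x, h)"
  "j < K \<Longrightarrow> tapes K x h s ! Suc j = (mark, int (fst s j))"
  "tapes K x h s ! Suc K = (word_content (snd s), int (length (snd s)))"
  by (simp_all add: tapes_def nth_append)

lemma tapes_update_counter: "j < K \<Longrightarrow> (tapes K x h s)[Suc j := (mark, int a)] = tapes K x h (upd j a s)"
  by (rule nth_equalityI)
    (auto simp: tapes_def nth_list_update nth_append nth_Cons split: nat.splits)

lemma exec_cinc:
  "j < K \<Longrightarrow> exec (cinc j) (tapes K x h s) 1 (tapes K x h (upd j (Suc (fst s j)) s))"
  using exec_Act[of "Suc j" "tapes K x h s" None 1]
  by (simp add: tape_act_def tape_read_def add.commute flip: tapes_update_counter)

lemma exec_cdec: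
  "j < K \<Longrightarrow> 0 < fst s j \<Longrightarrow>
     exec (cdec j) (tapes K x h s) 1 (tapes K x h (upd j (fst s j - 1) s))"
  using exec_Act[of "Suc j" "tapes K x h s" None "-1"]
  by (simp add: tape_act_def tape_read_def of_nat_diff flip: tapes_update_counter)

lemma exec_move_input: "exec (Act 0 None m) (tapes K x h s) 1 (tapes K x (h + m) s)"
  using exec_Act[of 0 "tapes K x h s" None m]
  by (simp add: tape_act_def tape_read_def) (simp add: tapes_def)

lemma word_content_snoc:
  "(word_content u)(int (length u) := (if b then 2 else 1)) = word_content (u @ [b])"
  by (rule ext) (auto simp: word_content_def nth_append)

lemma exec_emit:
  "exec (Act (Suc K) (Some (if b then 2 else 1)) 1) (tapes K x h s) 1
     (tapes K x h (fst s, snd s @ [b]))"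
proof -
  have "(tapes K x h s)[Suc K := (word_content (snd s @ [b]), int (length (snd s @ [b])))] =
      tapes K x h (fst s, snd s @ [b])"
    by (rule nth_equalityI)
      (auto simp: tapes_def nth_list_update nth_append nth_Cons split: nat.splits)
  then show ?thesis
    using exec_Act[of "Suc K" "tapes K x h s" "Some (if b then 2 else 1)" 1]
    by (simp add: tape_act_def word_content_snoc add.commute)
qed

lemma exec_while_nz:
  assumes "j < K" and "\<And>i. i < n \<Longrightarrow> 0 < fst (s i) j" and "fst (s n) j = 0"
    and "\<And>i. i < n \<Longrightarrow> \<exists>t \<le> b. exec c (tapes K x h (s i)) t (tapes K x h (s (Suc i)))"
  shows "\<exists>t \<le> n * (b + 2) + 1. exec (while_nz j c) (tapes K x h (s 0)) t (tapes K x h (s n))"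
  using assms exec_While_iterate[of "Suc j" "\<lambda>i. tapes K x h (s i)" n 1 b c]
  by (simp add: tape_read_def mark_def)

lemma run_funpow_mono:
  assumes "i \<le> m"
  shows "fst ((run x p ^^ i) s) v \<le> fst ((run x p ^^ m) s) v"
  using assms
proof (induction rule: dec_induct)
  case (step n)
  then show ?case
    using run_mono[of "(run x p ^^ n) s" v x p] by simp
qed simp

lemma fold_take_mono:
  "fst (fold (\<lambda>b. run x (g b)) (take i y) s) v \<le> fst (fold (\<lambda>b. run x (g b)) y s) v"
proof -
  have "fold (\<lambda>b. run x (g b)) y s =
      fold (\<lambda>b. run x (g b)) (drop i y) (fold (\<lambda>b. run x (g b)) (take i y) s)"
    by (metis append_take_drop_id comp_apply fold_append)
  moreover have "fst s' v \<le> fst (fold (\<lambda>b. run x (g b)) z s') v" for z s'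
    by (rule fold_invariant) (auto intro: le_trans run_mono)
  ultimately show ?thesis by simp
qed

text \<open>The scratch counters from \<open>d\<close> on are 0 at entry and again at the end, so a
  loop body can use those from \<open>d + 2\<close> on in every pass. The bound \<open>b\<close> is
  asked of the final state; \<open>run_mono\<close> carries it to all earlier ones.\<close>

lemma exec_compile:
  assumes "\<forall>v \<in> pvars p. v < e" and "e \<le> d" and "d + 2 * rep_depth p \<le> K"
    and "\<forall>j \<ge> d. fst s j = 0" and "flat_input p" and "h = 0 \<or> no_input p"
    and "\<forall>j < e. fst (run x p s) j \<le> b" and "length x \<le> b"
  shows "\<exists>t \<le> cost p b. exec (compile K d p) (tapes K x h s) t (tapes K x h (run x p s))"
  using assms
proof (induction p arbitrary: d h s)
  case Nop
  then show ?case using exec_Skip by auto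
next
  case (Inc v)
  then have "exec (cinc v) (tapes K x h s) 1 (tapes K x h (upd v (Suc (fst s v)) s))"
    by (intro exec_cinc) auto
  then show ?case by (auto simp: upd_def)
next
  case (Emit a)
  then show ?case using exec_emit[of K a x h s] by auto
next
  case (Then p q)
  let ?s = "run x p s"
  have "fst ?s j \<le> b" if "j < e" for j
    using Then.prems(7) run_mono[of ?s j x q] that by (simp add: le_trans)
  then have "\<exists>t \<le> cost p b. exec (compile K d p) (tapes K x h s) t (tapes K x h ?s)"
    using Then.prems by (intro Then.IH(1)) auto
  moreover have "fst ?s j = 0" if "j \<ge> d" for j
  proof -
    have "j \<notin> pvars p"
      using Then.prems(1)[rule_format, of j] Then.prems(2) that by auto
    then show ?thesis
      using Then.prems(4) that by (simp add: run_frame)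
  qed
  then have "\<exists>t \<le> cost q b. exec (compile K d q) (tapes K x h ?s) t (tapes K x h (run x q ?s))"
    using Then.prems by (intro Then.IH(2)) auto
  ultimately obtain t u where t: "t \<le> cost p b" "u \<le> cost q b"
    and exec: "exec (compile K d p) (tapes K x h s) t (tapes K x h ?s)"
      "exec (compile K d q) (tapes K x h ?s) u (tapes K x h (run x q ?s))"
    by blast
  from t have "t + u + 1 \<le> cost (Then p q) b" by simp
  from exec_Seq_le[OF exec this] show ?case
    by simp
next
  case (Rep v p)
  let ?c = "tapes K x h"
  define m where "m = fst s v"
  have v: "v < e" "v < d" "v < K" "d < K" "Suc d < K"
    using Rep.prems by auto
  have p: "w < e" if "w \<in> pvars p" for w
    using Rep.prems that by auto
  have m: "m \<le> b"
    using Rep.prems(7) v(1) run_mono[of s v x "Rep v p"] le_trans unfolding m_def by blast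
  \<comment> \<open>The states during the three loops: \<open>v\<close> is moved to both scratch
    counters, \<open>v\<close> is refilled, and the body runs while \<open>d\<close> counts
    down.\<close>
  define s1 where "s1 = (\<lambda>i. upd v (m - i) (upd d i (upd (Suc d) i s)))"
  define s2 where "s2 = (\<lambda>i. upd v i (upd d m (upd (Suc d) (m - i) s)))"
  define s3 where "s3 = (\<lambda>i. upd d (m - i) ((run x p ^^ i) s))"
  have d_notin: "w \<notin> pvars p" if "w \<ge> d" for w
    using p[of w] that Rep.prems(2) by linarith
  have frame: "fst ((run x p ^^ i) s) w = 0" if "w \<ge> d" for i w
    using that Rep.prems(4) run_frame[OF d_notin[OF that]]
    by (intro funpow_invariant[where P = "\<lambda>s. fst s w = 0"]) auto
  have "s1 0 = s"
    using Rep.prems(4) by (intro state_eqI) (auto simp: s1_def m_def)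
  have "s1 m = s2 0"
    using v by (intro state_eqI) (auto simp: s1_def s2_def)
  have "s2 m = s3 0"
    using v Rep.prems(4) by (intro state_eqI) (auto simp: s2_def s3_def m_def)
  have s3m: "s3 m = run x (Rep v p) s"
    using frame by (intro state_eqI) (auto simp: s3_def m_def)
  have "\<exists>t \<le> m * (5 + 2) + 1. exec (while_nz v (Seq (cdec v) (Seq (cinc d) (cinc (Suc d)))))
      (?c (s1 0)) t (?c (s1 m))"
  proof (rule exec_while_nz)
    fix i assume i: "i < m"
    have 1: "exec (cdec v) (?c (s1 i)) 1 (?c (upd v (m - i - 1) (s1 i)))"
      using exec_cdec[of v K "s1 i"] v i by (simp add: s1_def)
    have 2: "exec (cinc d) (?c (upd v (m - i - 1) (s1 i))) 1
        (?c (upd d (Suc i) (upd v (m - i - 1) (s1 i))))"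
      using exec_cinc[of d K x h "upd v (m - i - 1) (s1 i)"] v by (simp add: s1_def)
    have 3: "exec (cinc (Suc d)) (?c (upd d (Suc i) (upd v (m - i - 1) (s1 i)))) 1
        (?c (upd (Suc d) (Suc i) (upd d (Suc i) (upd v (m - i - 1) (s1 i)))))"
      using exec_cinc[of "Suc d" K x h "upd d (Suc i) (upd v (m - i - 1) (s1 i))"] v
      by (simp add: s1_def)
    have "upd (Suc d) (Suc i) (upd d (Suc i) (upd v (m - i - 1) (s1 i))) = s1 (Suc i)"
      using v by (intro state_eqI) (auto simp: s1_def)
    then show "\<exists>t \<le> 5. exec (Seq (cdec v) (Seq (cinc d) (cinc (Suc d))))
        (?c (s1 i)) t (?c (s1 (Suc i)))"
      using exec_Seq_le[OF 1 exec_Seq[OF 2 3], of 5] by simp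
  qed (use v in \<open>auto simp: s1_def\<close>)
  then obtain t1 where t1: "t1 \<le> m * 7 + 1"
    "exec (while_nz v (Seq (cdec v) (Seq (cinc d) (cinc (Suc d))))) (?c s) t1 (?c (s2 0))"
    using \<open>s1 0 = s\<close> \<open>s1 m = s2 0\<close> by (auto simp: add_ac)
  have "\<exists>t \<le> m * (3 + 2) + 1. exec (while_nz (Suc d) (Seq (cdec (Suc d)) (cinc v)))
      (?c (s2 0)) t (?c (s2 m))"
  proof (rule exec_while_nz)
    fix i assume i: "i < m"
    have 1: "exec (cdec (Suc d)) (?c (s2 i)) 1 (?c (upd (Suc d) (m - i - 1) (s2 i)))"
      using exec_cdec[of "Suc d" K "s2 i"] v i by (simp add: s2_def)
    have 2: "exec (cinc v) (?c (upd (Suc d) (m - i - 1) (s2 i))) 1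
        (?c (upd v (Suc i) (upd (Suc d) (m - i - 1) (s2 i))))"
      using exec_cinc[of v K x h "upd (Suc d) (m - i - 1) (s2 i)"] v by (simp add: s2_def)
    have "upd v (Suc i) (upd (Suc d) (m - i - 1) (s2 i)) = s2 (Suc i)"
      using v by (intro state_eqI) (auto simp: s2_def)
    then show "\<exists>t \<le> 3. exec (Seq (cdec (Suc d)) (cinc v)) (?c (s2 i)) t (?c (s2 (Suc i)))"
      using exec_Seq_le[OF 1 2, of 3] by simp
  qed (use v in \<open>auto simp: s2_def\<close>)
  then obtain t2 where t2: "t2 \<le> m * 5 + 1"
    "exec (while_nz (Suc d) (Seq (cdec (Suc d)) (cinc v))) (?c (s2 0)) t2 (?c (s3 0))"
    using \<open>s2 m = s3 0\<close> by (auto simp: add_ac)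
  have "\<exists>t \<le> m * ((cost p b + 2) + 2) + 1.
      exec (while_nz d (Seq (cdec d) (compile K (d + 2) p))) (?c (s3 0)) t (?c (s3 m))"
  proof (rule exec_while_nz)
    fix i assume i: "i < m"
    let ?s = "upd d (m - i - 1) (s3 i)"
    have 1: "exec (cdec d) (?c (s3 i)) 1 (?c ?s)"
      using exec_cdec[of d K "s3 i"] v i by (simp add: s3_def)
    have s: "?s = upd d (m - i - 1) ((run x p ^^ i) s)"
      by (intro state_eqI) (auto simp: s3_def)
    \<comment> \<open>The body commutes with setting \<open>d\<close>, which it does not
      mention.\<close>
    have run: "run x p ?s = s3 (Suc i)"
      unfolding s using run_upd[OF d_notin[of d]] by (simp add: s3_def)
    have "fst (run x p ?s) j \<le> b" if "j < e" for j
    proof -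
      have "fst ((run x p ^^ Suc i) s) j \<le> fst ((run x p ^^ m) s) j"
        using i by (intro run_funpow_mono) simp
      also have "\<dots> \<le> b"
        using Rep.prems(7) that by (simp add: m_def)
      finally show ?thesis
        unfolding run using Rep.prems(2) that by (simp add: s3_def)
    qed
    then have "\<exists>t \<le> cost p b. exec (compile K (d + 2) p) (?c ?s) t (?c (run x p ?s))"
      using Rep.prems p frame by (intro Rep.IH) (auto simp: s3_def)
    then obtain t where "t \<le> cost p b" "exec (compile K (d + 2) p) (?c ?s) t (?c (s3 (Suc i)))"
      unfolding run by blast
    then show "\<exists>t \<le> cost p b + 2.
        exec (Seq (cdec d) (compile K (d + 2) p)) (?c (s3 i)) t (?c (s3 (Suc i)))"
      by (intro exec_Seq_le[OF 1]) simp_all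
  qed (use v frame in \<open>auto simp: s3_def\<close>)
  then obtain t3 where t3: "t3 \<le> m * ((cost p b + 2) + 2) + 1"
    "exec (while_nz d (Seq (cdec d) (compile K (d + 2) p))) (?c (s3 0)) t3
      (?c (run x (Rep v p) s))"
    using s3m by auto
  have "exec (compile K d (Rep v p)) (?c s) (t1 + 1 + (t2 + 1 + t3)) (?c (run x (Rep v p) s))"
    unfolding compile.simps by (intro exec_Seq[OF t1(2)] exec_Seq[OF t2(2)] t3(2))
  moreover have "t1 + 1 + (t2 + 1 + t3) \<le> m * (cost p b + 16) + 5"
    using t1(1) t2(1) t3(1) by (simp add: algebra_simps)
  moreover have "m * (cost p b + 16) \<le> b * (cost p b + 20)"
    using m by (intro mult_le_mono) auto
  ultimately show ?case by (intro exI[of _ "t1 + 1 + (t2 + 1 + t3)"]) simp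
next
  case (Input p q)
  let ?n = "length x"
  define g where "g = (\<lambda>b. if b then p else q)"
  define st where "st = (\<lambda>i. fold (\<lambda>b. run x (g b)) (take i x) s)"
  have step: "st (Suc i) = run x (g (x ! i)) (st i)" if "i < ?n" for i
    using that by (simp add: st_def take_Suc_conv_app_nth)
  have run: "run x (Input p q) s = st ?n"
    by (simp add: st_def g_def if_distrib[where f = "run x"])
  have g: "no_input (g b)" "pvars (g b) \<subseteq> pvars p \<union> pvars q"
    "rep_depth (g b) \<le> max (rep_depth p) (rep_depth q)" for b
    using Input.prems(5) by (auto simp: g_def)
  have h: "h = 0" using Input.prems by simp
  have "\<exists>t \<le> ?n * (cost p b + cost q b + 3 + 2) + 1.
      exec (While 0 0 (Seq (If 0 2 (compile K d p) (compile K d q)) (Act 0 None 1)))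
        (tapes K x (int 0) (st 0)) t (tapes K x (int ?n) (st ?n))"
  proof (rule exec_While_iterate)
    fix i assume i: "i < ?n"
    show "tape_read (tapes K x (int i) (st i) ! 0) \<noteq> 0"
      using i by (simp add: tape_read_def word_content_def)
    have zero: "fst (st i) j = 0" if "d \<le> j" for j
    proof -
      have "j \<notin> pvars (g b)" for b
        using g(2)[of b] Input.prems(1)[rule_format, of j] Input.prems(2) that by auto
      then show ?thesis
        unfolding st_def using Input.prems(4) that
        by (intro fold_invariant[where P = "\<lambda>s. fst s j = 0"]) (auto simp: run_frame)
    qed
    have "fst (st (Suc i)) j \<le> b" if "j < e" for j
      using Input.prems(7) that fold_take_mono[of x g "Suc i" x s j] unfolding run
      by (simp add: st_def le_trans)
    then have bound: "\<forall>j < e. fst (run x (g (x ! i)) (st i)) j \<le> b"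
      using step[OF i] by simp
    have "\<exists>t \<le> cost (g (x ! i)) b. exec (compile K d (g (x ! i))) (tapes K x (int i) (st i)) t
        (tapes K x (int i) (run x (g (x ! i)) (st i)))"
    proof (cases "x ! i")
      case True
      then show ?thesis
        using Input.prems zero bound by (simp add: g_def) (intro Input.IH(1); simp add: no_input_flat_input)
    next
      case False
      then show ?thesis
        using Input.prems zero bound by (simp add: g_def) (intro Input.IH(2); simp add: no_input_flat_input)
    qed
    then obtain t where t: "t \<le> cost p b + cost q b"
      "exec (compile K d (g (x ! i))) (tapes K x (int i) (st i)) t (tapes K x (int i) (st (Suc i)))"
      using step[OF i] by (auto simp: g_def split: if_splits intro: trans_le_add1 trans_le_add2)
    have "exec (If 0 2 (compile K d p) (compile K d q)) (tapes K x (int i) (st i)) (1 + t)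
        (tapes K x (int i) (st (Suc i)))"
      using t(2) i by (intro exec_If) (auto simp: tape_read_def word_content_def g_def)
    from exec_Seq[OF this exec_move_input[of 1]]
    show "\<exists>t \<le> cost p b + cost q b + 3.
        exec (Seq (If 0 2 (compile K d p) (compile K d q)) (Act 0 None 1))
          (tapes K x (int i) (st i)) t (tapes K x (int (Suc i)) (st (Suc i)))"
      using t(1) by (intro exI[of _ "1 + t + 1 + 1"]) (simp add: add.commute)
  qed (auto simp: tape_read_def word_content_def)
  then obtain t1 where t1: "t1 \<le> ?n * (cost p b + cost q b + 5) + 1"
    "exec (While 0 0 (Seq (If 0 2 (compile K d p) (compile K d q)) (Act 0 None 1)))
        (tapes K x h s) t1 (tapes K x (int ?n) (st ?n))"
    using h by (auto simp: st_def add_ac)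
  \<comment> \<open>The head walks back from the last bit to the blank at position -1.\<close>
  let ?t = "\<lambda>i. tapes K x (int ?n - 1 - int i) (st ?n)"
  have "\<exists>t \<le> ?n * (1 + 2) + 1. exec (While 0 0 (Act 0 None (-1))) (?t 0) t (?t ?n)"
  proof (rule exec_While_iterate)
    fix i assume i: "i < ?n"
    then show "tape_read (?t i ! 0) \<noteq> 0"
      by (simp add: tape_read_def word_content_def)
    show "\<exists>t \<le> 1. exec (Act 0 None (-1)) (?t i) t (?t (Suc i))"
      using exec_move_input[of "-1" K x "int ?n - 1 - int i" "st ?n"]
      by (intro exI[of _ 1]) (simp add: algebra_simps)
  qed (auto simp: tape_read_def word_content_def)
  then obtain t2 where t2: "t2 \<le> ?n * (1 + 2) + 1"
    "exec (While 0 0 (Act 0 None (-1))) (tapes K x (int ?n + -1) (st ?n)) t2 (tapes K x (-1) (st ?n))"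
    by auto
  have "exec (compile K d (Input p q)) (tapes K x h s) (t1 + 1 + (1 + 1 + (t2 + 1 + 1)))
      (tapes K x 0 (st ?n))"
    unfolding compile.simps
    using exec_move_input[of 1 K x "-1" "st ?n"]
    by (intro exec_Seq[OF t1(2)] exec_Seq[OF exec_move_input] exec_Seq[OF t2(2)]) simp
  moreover have "t1 + 1 + (1 + 1 + (t2 + 1 + 1)) \<le> ?n * (cost p b + cost q b + 8) + 7"
    using t1(1) t2(1) by (simp add: algebra_simps)
  moreover have "?n * (cost p b + cost q b + 8) \<le> b * (cost p b + cost q b + 20)"
    using Input.prems(8) by (intro mult_le_mono) auto
  ultimately show ?case
    using run h by (intro exI[of _ "t1 + 1 + (1 + 1 + (t2 + 1 + 1))"]) simp
qed

lemma cost_poly: "\<exists>q :: nat poly. \<forall>b. cost p b = poly q b"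
proof (induction p)
  case Nop
  show ?case by (intro exI[of _ 0]) simp
next
  case (Then p1 p2)
  then obtain q1 q2 where "\<forall>b. cost p1 b = poly q1 b" "\<forall>b. cost p2 b = poly q2 b" by blast
  then show ?case by (intro exI[of _ "q1 + q2 + 1"]) simp
next
  case (Rep v p)
  then obtain q where "\<forall>b. cost p b = poly q b" by blast
  then show ?case by (intro exI[of _ "[:0, 1:] * (q + [:20:]) + [:20:]"]) simp
next
  case (Input p1 p2)
  then obtain q1 q2 where "\<forall>b. cost p1 b = poly q1 b" "\<forall>b. cost p2 b = poly q2 b" by blast
  then show ?case by (intro exI[of _ "[:0, 1:] * (q1 + q2 + [:20:]) + [:20:]"]) simp
next
  case (Inc v)
  show ?case by (intro exI[of _ 1]) simp
next
  case (Emit a)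
  show ?case by (intro exI[of _ 1]) simp
qed

section \<open>Initialisation and polynomial time\<close>

text \<open>All tapes except for the input start out blank, whereas a counter is a distance from a
  mark. The marks have to be written before the compiled program runs; the output tape gets
  none.\<close>

fun init_marks :: "nat \<Rightarrow> com" where
  "init_marks 0 = Skip"
| "init_marks (Suc j) = Seq (init_marks j) (Act (Suc j) (Some 1) 0)"

lemma wf_init_marks: "m \<le> K \<Longrightarrow> wf_com (K + 2) (init_marks m)"
  by (induction m) auto

lemma exec_init_marks:
  assumes "m \<le> K"
  shows "exec (init_marks m) ((word_content x, 0) # replicate (Suc K) (\<lambda>_. 0, 0)) (2 * m)
    ((word_content x, 0) # replicate m (mark, 0) @ replicate (Suc K - m) (\<lambda>_. 0, 0))"
  using assms
proof (induction m)
  case 0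
  then show ?case using exec_Skip by simp
next
  case (Suc m)
  define k where "k = K - m"
  have K: "Suc K - m = Suc k" "Suc K - Suc m = k"
    using Suc.prems by (simp_all add: k_def)
  let ?z = "(\<lambda>_. 0, 0) :: tape"
  let ?T = "(word_content x, 0) # replicate m (mark, 0) @ ?z # replicate k ?z"
  have "exec (Act (Suc m) (Some 1) 0) ?T 1 (?T[Suc m := tape_act (1, 0) (?T ! Suc m)])"
    using exec_Act[of "Suc m" ?T "Some 1" 0] by simp
  also have "?T[Suc m := tape_act (1, 0) (?T ! Suc m)] =
      (word_content x, 0) # replicate m (mark, 0) @ (mark, 0) # replicate k ?z"
    by (simp add: nth_append list_update_append tape_act_def fun_eq_iff mark_def)
  finally have "exec (Act (Suc m) (Some 1) 0)
      ((word_content x, 0) # replicate m (mark, 0) @ replicate (Suc K - m) (\<lambda>_. 0, 0)) 1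
      ((word_content x, 0) # replicate (Suc m) (mark, 0) @ replicate (Suc K - Suc m) (\<lambda>_. 0, 0))"
    by (simp add: K(1) replicate_app_Cons_same flip: k_def)
  from exec_Seq[OF Suc.IH this] show ?case
    using Suc.prems by simp
qed

text \<open>What has to be shown of a program is a polynomial bound on its counters. The running
  time follows, because \<open>cost p\<close> is a polynomial in that bound.\<close>

lemma polytime_computable_run:
  assumes flat: "flat_input p"
    and out: "\<And>x. snd (run x p (\<lambda>_. 0, [])) = f x"
    and bound: "\<And>x v. fst (run x p (\<lambda>_. 0, [])) v \<le> poly r (length x)"
  shows "polytime_computable f"
proof -
  obtain q where q: "\<forall>b. cost p b = poly q b" using cost_poly by blast
  have "finite (pvars p)" by (induction p) auto
  then obtain e where e: "\<forall>v \<in> pvars p. v < e"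
    using finite_nat_set_iff_bounded by auto
  define K where "K = e + 2 * rep_depth p"
  define c where "c = Seq (init_marks K) (compile K e p)"
  \<comment> \<open>The input length is added because scanning the input requires it to be below the
    bound, too.\<close>
  define r' where "r' = r + [:0, 1:]"
  have wf: "wf_com (K + 2) c"
    unfolding c_def using wf_init_marks[of K K] wf_compile[OF e, of K] by (simp add: K_def)
  have "\<exists>t \<le> poly ([:2 * K + 1:] + pcompose q r') (length x). outputs_in (machine (K + 2) c) x (f x) t"
    for x
  proof -
    let ?s = "(\<lambda>_. 0, [])"
    let ?b = "poly r' (length x)"
    have "fst (run x p ?s) v \<le> ?b" for v
      using bound[of x v] by (simp add: r'_def)
    then have "\<exists>t \<le> cost p ?b. exec (compile K e p) (tapes K x 0 ?s) t (tapes K x 0 (run x p ?s))"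
      using e flat by (intro exec_compile[of p e e]) (auto simp: K_def r'_def)
    then obtain t where t: "t \<le> cost p ?b"
      "exec (compile K e p) (tapes K x 0 ?s) t (tapes K x 0 (run x p ?s))" by blast
    have "(word_content x, 0) # replicate K (mark, 0) @ replicate (Suc K - K) (\<lambda>_. 0, 0) =
        tapes K x 0 ?s"
      by (simp add: tapes_def map_replicate_const) (simp add: word_content_def fun_eq_iff)
    then have "exec (init_marks K) ((word_content x, 0) # replicate (Suc K) (\<lambda>_. 0, 0)) (2 * K)
        (tapes K x 0 ?s)"
      using exec_init_marks[of K K x] by simp
    from exec_Seq[OF this t(2)]
    have "exec c ((word_content x, 0) # replicate (K + 2 - 1) (\<lambda>_. 0, 0)) (2 * K + 1 + t)
        (tapes K x 0 (run x p ?s))"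
      by (simp add: c_def)
    then have "outputs_in (machine (K + 2) c) x (f x) (2 * K + 1 + t)"
      by (rule exec_outputs_in[OF _ wf]) (simp_all add: tapes_def out)
    moreover have "2 * K + 1 + t \<le> poly ([:2 * K + 1:] + pcompose q r') (length x)"
      using t(1) q by (simp add: poly_pcompose)
    ultimately show ?thesis by blast
  qed
  moreover have "turing_machine (machine (K + 2) c)"
    using wf by (intro turing_machine_machine) simp_all
  ultimately show ?thesis
    unfolding polytime_computable_def using deterministic_machine by blast
qed

section \<open>Edit distance of edge-labeled paths\<close>

definition simple_graph :: "lgraph \<Rightarrow> bool" where
  "simple_graph G \<longleftrightarrow> finite (verts G) \<and> (\<forall>e \<in> edges G. e \<subseteq> verts G \<and> card e = 2)"

section \<open>Lower bound on the edit distance\<close>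

lemma finite_edges:
  assumes "simple_graph G"
  shows "finite (edges G)"
proof (rule finite_subset)
  show "edges G \<subseteq> Pow (verts G)" using assms by (auto simp: simple_graph_def)
  show "finite (Pow (verts G))" using assms by (simp add: simple_graph_def)
qed

lemma simple_graph_apply_op: "simple_graph G \<Longrightarrow> applicable G x \<Longrightarrow> simple_graph (apply_op G x)"
  by (cases x) (auto simp: simple_graph_def)

lemma simple_graph_foldl:
  "simple_graph G \<Longrightarrow> all_applicable G ops \<Longrightarrow> simple_graph (foldl apply_op G ops)"
  by (induction ops arbitrary: G) (auto simp: simple_graph_apply_op)

definition kept :: "lgraph \<Rightarrow> lgraph \<Rightarrow> nat set set" where
  "kept G F = {e \<in> edges G \<inter> edges F. elab G e = elab F e}"

lemma card_kept_le:
  assumes "finite (edges G)" and "kept G F - A \<subseteq> kept G F'" and "finite A"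
  shows "card (kept G F) \<le> card (kept G F') + card A"
proof -
  have fin: "finite (kept G F')"
    using assms(1) by (auto simp: kept_def)
  then have "finite (kept G F' \<union> A)" using assms(3) by simp
  moreover have "kept G F \<subseteq> kept G F' \<union> A" using assms(2) by auto
  ultimately have "card (kept G F) \<le> card (kept G F' \<union> A)" by (simp add: card_mono)
  also have "\<dots> \<le> card (kept G F') + card A" by (rule card_Un_le)
  finally show ?thesis .
qed

text \<open>An operation of cost \<open>c\<close> raises the potential |edges F| - 2 |kept G F| by
  at most \<open>c\<close>: an insertion adds an edge, a deletion removes an edge and possibly a
  kept one, and a proper relabeling costs 2 and loses at most one kept edge. The inequality is
  written without subtraction. Finite cost excludes giving a vertex a different label.\<close>

lemma op_cost_potential:
  assumes "simple_graph G" and "simple_graph F" and "applicable F x" and "op_cost C_E F x \<noteq> \<infinity>"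
  shows "\<exists>c. op_cost C_E F x = of_nat c \<and>
    card (edges (apply_op F x)) + 2 * card (kept G F) \<le>
    2 * card (kept G (apply_op F x)) + card (edges F) + c"
proof -
  note fin = finite_edges[OF assms(1)] finite_edges[OF assms(2)]
  have one: "card (kept G F) \<le> card (kept G (apply_op F x)) + 1"
    if "kept G F - {e} \<subseteq> kept G (apply_op F x)" for e
    using card_kept_le[OF fin(1) that] by simp
  have zero: "card (kept G F) \<le> card (kept G (apply_op F x))"
    if "kept G F \<subseteq> kept G (apply_op F x)"
    using card_kept_le[OF fin(1), of F "{}" "apply_op F x"] that by simp
  show ?thesis
  proof (cases x)
    case (VIns v l)
    then show ?thesis by (intro exI[of _ 0]) (simp add: kept_def C_E_def)
  next
    case (VDel v)
    then show ?thesis by (intro exI[of _ 0]) (simp add: kept_def C_E_def)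
  next
    case (VRel v l)
    then show ?thesis using assms(4)
      by (intro exI[of _ 0]) (simp add: kept_def C_E_def split: if_splits)
  next
    case (EIns e l)
    have "card (kept G F) \<le> card (kept G (apply_op F x))"
      using assms(3) EIns by (intro zero) (auto simp: kept_def)
    moreover have "card (edges (apply_op F x)) = card (edges F) + 1"
      using assms(3) EIns fin(2) by simp
    ultimately show ?thesis using EIns by (intro exI[of _ 1]) (simp add: C_E_def)
  next
    case (EDel e)
    have "card (kept G F) \<le> card (kept G (apply_op F x)) + 1"
      using EDel by (intro one[of e]) (auto simp: kept_def)
    moreover have "card (edges F) = card (edges (apply_op F x)) + 1"
      using assms(3) EDel card_Suc_Diff1[OF fin(2), of e] by simp
    ultimately show ?thesis using EDel by (intro exI[of _ 1]) (simp add: C_E_def)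
  next
    case (ERel e l)
    show ?thesis
    proof (cases "elab F e = l")
      case True
      have "card (kept G F) \<le> card (kept G (apply_op F x))"
        using True ERel by (intro zero) (auto simp: kept_def)
      then show ?thesis using ERel True by (intro exI[of _ 0]) simp
    next
      case False
      have "card (kept G F) \<le> card (kept G (apply_op F x)) + 1"
        using ERel by (intro one[of e]) (auto simp: kept_def)
      then show ?thesis using ERel False by (intro exI[of _ 2]) (simp add: C_E_def)
    qed
  qed
qed

lemma ennreal_add_less_of_nat:
  fixes r :: ennreal
  assumes "of_nat c + r < of_nat m"
  shows "c < m \<and> r < of_nat (m - c)"
proof -
  have "of_nat c \<le> of_nat c + r" by simp
  then have "of_nat c < (of_nat m :: ennreal)" using assms by (rule le_less_trans)
  then have c: "c < m" by simp
  then have "of_nat m = (of_nat c + of_nat (m - c) :: ennreal)"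
    by (simp flip: of_nat_add)
  then have "of_nat c + r < of_nat c + (of_nat (m - c) :: ennreal)" using assms by simp
  then show ?thesis using c by (simp add: ennreal_add_left_cancel_less)
qed

text \<open>The strict bound keeps the induction in the natural numbers although costs may be
  infinite, and it is the kind of bound that an infimum provides.\<close>

lemma edit_cost_potential:
  assumes "simple_graph G" and "simple_graph F" and "all_applicable F ops"
    and "edit_cost C_E F ops < of_nat m"
  shows "card (edges (foldl apply_op F ops)) + 2 * card (kept G F) <
    2 * card (kept G (foldl apply_op F ops)) + card (edges F) + m"
  using assms(2-)
proof (induction ops arbitrary: F m)
  case Nil
  then show ?case by (cases m) auto
next
  case (Cons x ops)
  let ?F = "apply_op F x"
  have app: "applicable F x" "all_applicable ?F ops"
    and cost: "op_cost C_E F x + edit_cost C_E ?F ops < of_nat m"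
    using Cons.prems by auto
  have "op_cost C_E F x \<noteq> \<infinity>"
    using cost by auto
  then obtain c where c: "op_cost C_E F x = of_nat c"
    "card (edges ?F) + 2 * card (kept G F) \<le> 2 * card (kept G ?F) + card (edges F) + c"
    using op_cost_potential[OF assms(1) Cons.prems(1) app(1)] by blast
  have m: "c < m" "edit_cost C_E ?F ops < of_nat (m - c)"
    using ennreal_add_less_of_nat cost unfolding c(1) by blast+
  have "card (edges (foldl apply_op ?F ops)) + 2 * card (kept G ?F) <
      2 * card (kept G (foldl apply_op ?F ops)) + card (edges ?F) + (m - c)"
    by (intro Cons.IH simple_graph_apply_op Cons.prems(1) app m(2))
  then show ?case using c(2) m(1) by simp
qed

lemma image_of_pair:
  assumes "simple_graph G" and "e \<in> edges G"
  obtains u v where "e = {u, v}" "u \<in> verts G" "v \<in> verts G" "u \<noteq> v"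
proof -
  obtain u v where "e = {u, v}" "u \<noteq> v"
    using assms card_2_iff[of e] by (auto simp: simple_graph_def)
  then show ?thesis using that assms by (auto simp: simple_graph_def)
qed

text \<open>The potential starts at -|edges G| and ends at |edges H| - 2 |K|, where \<open>K\<close>
  consists of the kept edges, carried to \<open>H\<close> by the isomorphism. The inverse
  \<open>g\<close> of the isomorphism may leave the vertices of \<open>G\<close>, but not on an edge
  of \<open>K\<close>.\<close>

theorem GED_le_imp_common_edges:
  assumes G: "simple_graph G" and H: "simple_graph H" and "GED C_E G H \<le> of_nat k"
  obtains g K where "inj_on g (verts H)" "K \<subseteq> edges H"
    "card (edges G) + card (edges H) \<le> 2 * card K + k"
    "\<And>e. e \<in> K \<Longrightarrow> g ` e \<in> edges G \<and> elab G (g ` e) = elab H e"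
proof -
  \<comment> \<open>The infimum is not known to be attained, so an edit path of cost below
    \<open>Suc k\<close> is taken. The potential is an integer and gives back the bound
    \<open>k\<close>.\<close>
  have "of_nat k < (of_nat (Suc k) :: ennreal)"
    unfolding of_nat_less_iff by simp
  then have "GED C_E G H < of_nat (Suc k)"
    using assms(3) by (rule le_less_trans[rotated])
  then obtain ops where ops: "restricted_edit_path G H ops" "edit_cost C_E G ops < of_nat (Suc k)"
    unfolding GED_def INF_less_iff by blast
  define F where "F = foldl apply_op G ops"
  have app: "all_applicable G ops" and iso: "lgraph_iso F H"
    using ops(1) by (auto simp: restricted_edit_path_def F_def)
  have F: "simple_graph F"
    unfolding F_def using G app by (rule simple_graph_foldl)
  have "kept G G = edges G" by (auto simp: kept_def)
  then have pot: "card (edges F) + card (edges G) \<le> 2 * card (kept G F) + k"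
    using edit_cost_potential[OF G G app ops(2)] unfolding F_def by simp
  obtain f where f: "bij_betw f (verts F) (verts H)"
    and f_edges: "\<And>u v. u \<in> verts F \<Longrightarrow> v \<in> verts F \<Longrightarrow> {u, v} \<in> edges F \<longleftrightarrow> {f u, f v} \<in> edges H"
    and f_elab: "\<And>e. e \<in> edges F \<Longrightarrow> elab H (f ` e) = elab F e"
    using iso unfolding lgraph_iso_def by blast
  define g where "g = inv_into (verts F) f"
  have gf: "g (f v) = v" if "v \<in> verts F" for v
    unfolding g_def using f that by (rule bij_betw_inv_into_left)
  have g: "bij_betw g (verts H) (verts F)"
    unfolding g_def using f by (rule bij_betw_inv_into)
  have sub: "e \<subseteq> verts F" if "e \<in> edges F" for e
    using F that by (auto simp: simple_graph_def)
  have gf_image: "g ` f ` e = e" if "e \<in> edges F" for e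
  proof -
    have "(\<lambda>v. g (f v)) ` e = (\<lambda>v. v) ` e"
      using sub[OF that] by (intro image_cong) (simp_all add: gf subset_iff)
    then show ?thesis by (simp add: image_image)
  qed
  have inj: "inj_on (\<lambda>e. f ` e) (edges F)"
    by (rule inj_on_inverseI) (rule gf_image)
  have "(\<lambda>e. f ` e) ` edges F = edges H"
  proof (intro equalityI subsetI)
    fix e assume "e \<in> (\<lambda>e. f ` e) ` edges F"
    then obtain e' where e': "e = f ` e'" "e' \<in> edges F" by auto
    from F e'(2) obtain u v where "e' = {u, v}" "u \<in> verts F" "v \<in> verts F"
      by (rule image_of_pair)
    then show "e \<in> edges H"
      using f_edges[of u v] e' by simp
  next
    fix e assume e: "e \<in> edges H"
    from H e obtain a b where ab: "e = {a, b}" "a \<in> verts H" "b \<in> verts H"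
      by (rule image_of_pair)
    then obtain u v where uv: "u \<in> verts F" "v \<in> verts F" "a = f u" "b = f v"
      using bij_betw_imp_surj_on[OF f] by blast
    then have "{u, v} \<in> edges F" using f_edges ab e by simp
    then show "e \<in> (\<lambda>e. f ` e) ` edges F"
      using ab uv by (intro image_eqI[of _ _ "{u, v}"]) auto
  qed
  then have card: "card (edges F) = card (edges H)"
    using card_image[OF inj] by simp
  have K_F: "kept G F \<subseteq> edges F" by (auto simp: kept_def)
  show ?thesis
  proof
    show "inj_on g (verts H)" using g by (simp add: bij_betw_def)
    show "(\<lambda>e. f ` e) ` kept G F \<subseteq> edges H"
      using K_F \<open>(\<lambda>e. f ` e) ` edges F = edges H\<close> by blast
    have "card ((\<lambda>e. f ` e) ` kept G F) = card (kept G F)"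
      using inj K_F by (intro card_image) (rule inj_on_subset)
    then show "card (edges G) + card (edges H) \<le> 2 * card ((\<lambda>e. f ` e) ` kept G F) + k"
      using pot card by simp
    fix e assume "e \<in> (\<lambda>e. f ` e) ` kept G F"
    then obtain e' where e': "e = f ` e'" "e' \<in> edges G" "e' \<in> edges F" "elab G e' = elab F e'"
      by (auto simp: kept_def)
    then show "g ` e \<in> edges G \<and> elab G (g ` e) = elab H e"
      using gf_image f_elab by simp
  qed
qed

section \<open>An edit path that realises given common edges\<close>

lemma all_applicable_append:
  "all_applicable G (xs @ ys) \<longleftrightarrow> all_applicable G xs \<and> all_applicable (foldl apply_op G xs) ys"
  by (induction xs arbitrary: G) auto

lemma edit_cost_append:
  "edit_cost C G (xs @ ys) = edit_cost C G xs + edit_cost C (foldl apply_op G xs) ys"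
  by (induction xs arbitrary: G) (auto simp: add.assoc)

lemma delete_edges:
  assumes "distinct es" and "set es \<subseteq> edges G"
  shows "all_applicable G (map EDel es) \<and> edit_cost C_E G (map EDel es) = of_nat (length es) \<and>
    foldl apply_op G (map EDel es) = G\<lparr>edges := edges G - set es\<rparr>"
  using assms
proof (induction es arbitrary: G)
  case (Cons e es)
  have "set es \<subseteq> edges (apply_op G (EDel e))" using Cons.prems by auto
  moreover have "edges G - {e} - set es = edges G - set (e # es)" by auto
  ultimately show ?case
    using Cons.prems Cons.IH[of "apply_op G (EDel e)"] by (simp add: C_E_def)
qed simp

lemma delete_verts:
  assumes "distinct vs" and "set vs \<subseteq> verts G" and "\<And>e. e \<in> edges G \<Longrightarrow> e \<inter> set vs = {}"
  shows "all_applicable G (map VDel vs) \<and> edit_cost C_E G (map VDel vs) = 0 \<and>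
    foldl apply_op G (map VDel vs) = G\<lparr>verts := verts G - set vs\<rparr>"
  using assms
proof (induction vs arbitrary: G)
  case (Cons v vs)
  have "set vs \<subseteq> verts (apply_op G (VDel v))" using Cons.prems by auto
  moreover have "e \<inter> set vs = {}" if "e \<in> edges (apply_op G (VDel v))" for e
    using Cons.prems(3)[of e] that by auto
  ultimately have IH: "all_applicable (apply_op G (VDel v)) (map VDel vs) \<and>
      edit_cost C_E (apply_op G (VDel v)) (map VDel vs) = 0 \<and>
      foldl apply_op (apply_op G (VDel v)) (map VDel vs) =
        apply_op G (VDel v)\<lparr>verts := verts (apply_op G (VDel v)) - set vs\<rparr>"
    using Cons.prems(1) by (intro Cons.IH) auto
  have "\<forall>e \<in> edges G. v \<notin> e" using Cons.prems(3) by auto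
  then show ?case
    using IH Cons.prems by (simp add: C_E_def Diff_insert[symmetric]) (simp add: Diff_insert2[symmetric])
qed simp

lemma relabel_edges:
  assumes "distinct es" and "set es \<subseteq> edges G"
  shows "all_applicable G (map (\<lambda>e. ERel e (l e)) es) \<and>
    edit_cost C_E G (map (\<lambda>e. ERel e (l e)) es) \<le> of_nat (2 * length es) \<and>
    foldl apply_op G (map (\<lambda>e. ERel e (l e)) es) =
      G\<lparr>elab := (\<lambda>e. if e \<in> set es then l e else elab G e)\<rparr>"
  using assms
proof (induction es arbitrary: G)
  case (Cons e es)
  let ?G = "apply_op G (ERel e (l e))"
  have IH: "all_applicable ?G (map (\<lambda>e. ERel e (l e)) es)"
    "edit_cost C_E ?G (map (\<lambda>e. ERel e (l e)) es) \<le> of_nat (2 * length es)"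
    "foldl apply_op ?G (map (\<lambda>e. ERel e (l e)) es) =
      ?G\<lparr>elab := (\<lambda>e. if e \<in> set es then l e else elab ?G e)\<rparr>"
    using Cons.IH[of ?G] Cons.prems by auto
  have "op_cost C_E G (ERel e (l e)) \<le> 2" by (simp add: C_E_def)
  then have "op_cost C_E G (ERel e (l e)) + edit_cost C_E ?G (map (\<lambda>e. ERel e (l e)) es)
      \<le> 2 + of_nat (2 * length es)"
    using IH(2) by (rule add_mono)
  moreover have "2 * length (e # es) = 2 + 2 * length es" by simp
  then have "of_nat (2 * length (e # es)) = (2 + of_nat (2 * length es) :: ennreal)"
    by (simp only: of_nat_add of_nat_numeral)
  ultimately have "edit_cost C_E G (map (\<lambda>e. ERel e (l e)) (e # es)) \<le> of_nat (2 * length (e # es))"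
    by (simp only: list.map edit_cost.simps)
  moreover have "foldl apply_op G (map (\<lambda>e. ERel e (l e)) (e # es)) =
      G\<lparr>elab := (\<lambda>e'. if e' \<in> set (e # es) then l e' else elab G e')\<rparr>"
    using IH(3) by (simp add: fun_upd_def) (rule arg_cong[where f = "\<lambda>h. G\<lparr>elab := h\<rparr>"], auto)
  ultimately show ?case using IH(1) Cons.prems by simp
qed simp

lemma insert_edges:
  assumes "distinct es" and "set es \<inter> edges G = {}"
    and "\<And>e. e \<in> set es \<Longrightarrow> e \<subseteq> verts G \<and> card e = 2"
  shows "all_applicable G (map (\<lambda>e. EIns e (l e)) es) \<and>
    edit_cost C_E G (map (\<lambda>e. EIns e (l e)) es) = of_nat (length es) \<and>
    foldl apply_op G (map (\<lambda>e. EIns e (l e)) es) =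
      G\<lparr>edges := edges G \<union> set es, elab := (\<lambda>e. if e \<in> set es then l e else elab G e)\<rparr>"
  using assms
proof (induction es arbitrary: G)
  case (Cons e es)
  let ?G = "apply_op G (EIns e (l e))"
  have IH: "all_applicable ?G (map (\<lambda>e. EIns e (l e)) es)"
    "edit_cost C_E ?G (map (\<lambda>e. EIns e (l e)) es) = of_nat (length es)"
    "foldl apply_op ?G (map (\<lambda>e. EIns e (l e)) es) =
      ?G\<lparr>edges := edges ?G \<union> set es, elab := (\<lambda>e'. if e' \<in> set es then l e' else elab ?G e')\<rparr>"
    using Cons.IH[of ?G] Cons.prems by auto
  have elab: "(\<lambda>e'. if e' \<in> set es then l e' else elab ?G e') =
      (\<lambda>e'. if e' \<in> set (e # es) then l e' else elab G e')"
    by auto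
  have "foldl apply_op G (map (\<lambda>e. EIns e (l e)) (e # es)) =
      G\<lparr>edges := edges G \<union> set (e # es),
        elab := (\<lambda>e'. if e' \<in> set (e # es) then l e' else elab G e')\<rparr>"
    using IH(3) unfolding elab by simp
  moreover have "edit_cost C_E G (map (\<lambda>e. EIns e (l e)) (e # es)) = of_nat (length (e # es))"
    using IH(2) by (simp add: C_E_def)
  ultimately show ?case using IH(1) Cons.prems by simp
qed simp


lemma inj_on_image_image:
  assumes "inj_on g A" and "\<And>e. e \<in> X \<Longrightarrow> e \<subseteq> A"
  shows "inj_on (\<lambda>e. g ` e) X"
  using assms by (intro inj_onI) (simp add: inj_on_image_eq_iff)

lemma distinct_list_of_set:
  assumes "finite A"
  obtains xs where "distinct xs" "set xs = A" "length xs = card A"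
  using finite_distinct_list[OF assms] distinct_card by metis

text \<open>No vertex has to be inserted or relabeled, since \<open>g\<close> is defined on all of
  \<open>H\<close> and respects labels; deleting the vertices outside its image is free. With
  \<open>S\<close> the set of matching edges, deletions, relabelings at cost 2 and insertions add up
  to |edges G| + |edges H| - 2 |S|.\<close>

theorem GED_le_if_common_edges:
  assumes G: "simple_graph G" and H: "simple_graph H"
    and g: "inj_on g (verts H)" "g ` verts H \<subseteq> verts G"
    and vlab: "\<And>v. v \<in> verts H \<Longrightarrow> vlab G (g v) = vlab H v"
    and K: "K \<subseteq> edges H" "\<And>e. e \<in> K \<Longrightarrow> g ` e \<in> edges G \<and> elab G (g ` e) = elab H e"
    and card: "card (edges G) + card (edges H) \<le> 2 * card K + k"
  shows "GED C_E G H \<le> of_nat k"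
proof -
  define f where "f = inv_into (verts H) g"
  define E where "E = (\<lambda>e. g ` e) ` edges H"
  define l where "l = (\<lambda>e. elab H (f ` e))"
  have fg: "f (g v) = v" if "v \<in> verts H" for v
    unfolding f_def using g(1) that by (rule inv_into_f_f)
  have sub: "e \<subseteq> verts H" "card e = 2" if "e \<in> edges H" for e
    using H that by (auto simp: simple_graph_def)
  have fg_image: "f ` g ` e = e" if "e \<in> edges H" for e
  proof -
    have "(\<lambda>v. f (g v)) ` e = (\<lambda>v. v) ` e"
      using sub[OF that] by (intro image_cong) (simp_all add: fg subset_iff)
    then show ?thesis by (simp add: image_image)
  qed
  have inj: "inj_on (\<lambda>e. g ` e) (edges H)"
    using g(1) sub(1) by (rule inj_on_image_image)
  note fin = finite_edges[OF G] finite_edges[OF H]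
  have finE: "finite E" and cardE: "card E = card (edges H)"
    using fin(2) card_image[OF inj] by (simp_all add: E_def)
  have E_sub: "e \<subseteq> g ` verts H \<and> card e = 2" if e: "e \<in> E" for e
  proof -
    obtain e' where e': "e' \<in> edges H" "e = g ` e'" using e by (auto simp: E_def)
    have "inj_on g e'" using g(1) sub(1)[OF e'(1)] by (rule inj_on_subset)
    then show ?thesis using sub[OF e'(1)] e'(2) by (auto simp: card_image)
  qed
  \<comment> \<open>An edge with the wrong label is relabeled rather than deleted and inserted
    again, which would edit the same target twice. The cost is 2 either way.\<close>
  define R where "R = {e \<in> edges G \<inter> E. elab G e \<noteq> l e}"
  obtain ds where ds: "distinct ds" "set ds = edges G - E" "length ds = card (edges G - E)"
    using distinct_list_of_set[of "edges G - E"] fin by auto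
  obtain vs where vs: "distinct vs" "set vs = verts G - g ` verts H"
    using finite_distinct_list[of "verts G - g ` verts H"] G by (auto simp: simple_graph_def)
  obtain rs where rs: "distinct rs" "set rs = R" "length rs = card R"
    using distinct_list_of_set[of R] fin by (auto simp: R_def)
  obtain js where js: "distinct js" "set js = E - edges G" "length js = card (E - edges G)"
    using distinct_list_of_set[of "E - edges G"] finE by auto
  define G1 where "G1 = G\<lparr>edges := edges G - set ds\<rparr>"
  define G2 where "G2 = G1\<lparr>verts := verts G1 - set vs\<rparr>"
  define G3 where "G3 = G2\<lparr>elab := (\<lambda>e. if e \<in> set rs then l e else elab G2 e)\<rparr>"
  define F where "F = G3\<lparr>edges := edges G3 \<union> set js, elab := (\<lambda>e. if e \<in> set js then l e else elab G3 e)\<rparr>"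
  \<comment> \<open>Edges are deleted before vertices, so that the latter are isolated by
    then.\<close>
  define ops where "ops = map EDel ds @ map VDel vs @ map (\<lambda>e. ERel e (l e)) rs @
    map (\<lambda>e. EIns e (l e)) js"
  have edges: "edges G1 = edges G \<inter> E" "edges G2 = edges G \<inter> E" "edges G3 = edges G \<inter> E"
    "edges F = E"
    using ds(2) js(2) by (auto simp: G1_def G2_def G3_def F_def)
  have verts: "verts G1 = verts G" "verts G2 = g ` verts H" "verts G3 = g ` verts H"
    "verts F = g ` verts H"
    using vs(2) g(2) by (auto simp: G1_def G2_def G3_def F_def)
  have 1: "all_applicable G (map EDel ds) \<and> edit_cost C_E G (map EDel ds) = of_nat (length ds) \<and>
      foldl apply_op G (map EDel ds) = G1"
    unfolding G1_def using ds by (intro delete_edges) auto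
  have 2: "all_applicable G1 (map VDel vs) \<and> edit_cost C_E G1 (map VDel vs) = 0 \<and>
      foldl apply_op G1 (map VDel vs) = G2"
    unfolding G2_def
  proof (intro delete_verts)
    fix e assume "e \<in> edges G1"
    then have "e \<subseteq> g ` verts H" using E_sub edges(1) by auto
    then show "e \<inter> set vs = {}" using vs(2) by auto
  qed (use vs verts in auto)
  have 3: "all_applicable G2 (map (\<lambda>e. ERel e (l e)) rs) \<and>
      edit_cost C_E G2 (map (\<lambda>e. ERel e (l e)) rs) \<le> of_nat (2 * length rs) \<and>
      foldl apply_op G2 (map (\<lambda>e. ERel e (l e)) rs) = G3"
    unfolding G3_def using rs edges(2) by (intro relabel_edges) (auto simp: R_def)
  have 4: "all_applicable G3 (map (\<lambda>e. EIns e (l e)) js) \<and>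
      edit_cost C_E G3 (map (\<lambda>e. EIns e (l e)) js) = of_nat (length js) \<and>
      foldl apply_op G3 (map (\<lambda>e. EIns e (l e)) js) = F"
    unfolding F_def using js edges(3) E_sub verts(3) by (intro insert_edges) auto
  have app: "all_applicable G ops" and F: "foldl apply_op G ops = F"
    using 1 2 3 4 by (simp_all add: ops_def all_applicable_append)
  have "edit_cost C_E G ops = of_nat (length ds) + edit_cost C_E G2 (map (\<lambda>e. ERel e (l e)) rs) +
      of_nat (length js)"
    using 1 2 3 4 by (simp add: ops_def edit_cost_append add.assoc)
  also have "\<dots> \<le> of_nat (length ds) + of_nat (2 * length rs) + of_nat (length js)"
    using 3 by (intro add_mono) auto
  finally have cost: "edit_cost C_E G ops \<le> of_nat (length ds + 2 * length rs + length js)"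
    by (simp only: of_nat_add)
  have elab_F: "elab F e = l e" if "e \<in> E" for e
    using that js(2) rs(2) by (auto simp: F_def G3_def G2_def G1_def R_def)
  have "vlab F = vlab G" by (simp add: F_def G3_def G2_def G1_def)
  have "lgraph_iso F H"
    unfolding lgraph_iso_def
  proof (intro exI[of _ f] conjI ballI)
    have "bij_betw g (verts H) (g ` verts H)" using g(1) by (simp add: bij_betw_def)
    then show "bij_betw f (verts F) (verts H)"
      unfolding f_def verts by (rule bij_betw_inv_into)
    fix v assume "v \<in> verts F"
    then obtain a where a: "a \<in> verts H" "v = g a" by (auto simp: verts)
    then show "vlab H (f v) = vlab F v"
      using vlab fg \<open>vlab F = vlab G\<close> by simp
  next
    fix u v assume "u \<in> verts F" "v \<in> verts F"
    then obtain a b where ab: "a \<in> verts H" "b \<in> verts H" "u = g a" "v = g b"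
      by (auto simp: verts)
    have "{g a, g b} \<in> E \<longleftrightarrow> {a, b} \<in> edges H"
    proof
      assume "{g a, g b} \<in> E"
      then obtain e where e: "e \<in> edges H" "g ` {a, b} = g ` e" by (auto simp: E_def)
      then have "{a, b} = e"
        using inj_on_image_eq_iff[OF g(1), of "{a, b}" e] ab sub(1)[OF e(1)] by simp
      then show "{a, b} \<in> edges H" using e by simp
    next
      assume "{a, b} \<in> edges H"
      then have "g ` {a, b} \<in> E" unfolding E_def by (rule imageI)
      then show "{g a, g b} \<in> E" by simp
    qed
    then show "{u, v} \<in> edges F \<longleftrightarrow> {f u, f v} \<in> edges H"
      using ab fg edges by simp
  next
    fix e assume "e \<in> edges F"
    then show "elab H (f ` e) = elab F e"
      using elab_F edges by (simp add: l_def)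
  qed
  moreover have "distinct (map op_target ops)"
  proof -
    have "distinct (map op_target (map EDel ds))" "distinct (map op_target (map VDel vs))"
      "distinct (map op_target (map (\<lambda>e. ERel e (l e)) rs))"
      "distinct (map op_target (map (\<lambda>e. EIns e (l e)) js))"
      using ds vs rs js by (auto simp: distinct_map inj_on_def)
    moreover have "set ds \<inter> set rs = {}" "set ds \<inter> set js = {}" "set rs \<inter> set js = {}"
      using ds rs js by (auto simp: R_def)
    ultimately show ?thesis
      unfolding ops_def map_append distinct_append set_append by auto
  qed
  ultimately have "restricted_edit_path G H ops"
    using app F by (simp add: restricted_edit_path_def)
  then have "GED C_E G H \<le> edit_cost C_E G ops"
    unfolding GED_def by (intro INF_lower) simp
  moreover have "length ds + 2 * length rs + length js \<le> k"
  proof -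
    let ?S = "{e \<in> edges G \<inter> E. elab G e = l e}"
    have "(\<lambda>e. g ` e) ` K \<subseteq> ?S"
    proof
      fix e' assume "e' \<in> (\<lambda>e. g ` e) ` K"
      then obtain e where e: "e \<in> K" "e' = g ` e" by auto
      have "e \<in> edges H" using e K by auto
      then have "l e' = elab H e" using e fg_image by (simp add: l_def)
      then show "e' \<in> ?S" using e K(2)[of e] \<open>e \<in> edges H\<close> by (auto simp: E_def)
    qed
    then have "card ((\<lambda>e. g ` e) ` K) \<le> card ?S" using fin by (intro card_mono) auto
    moreover have "card ((\<lambda>e. g ` e) ` K) = card K"
      using inj K(1) by (intro card_image) (rule inj_on_subset)
    moreover have "card (edges G \<inter> E) = card R + card ?S"
      unfolding R_def using fin by (subst card_Un_disjoint[symmetric]) (auto intro: arg_cong[where f = card])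
    moreover have "card (edges G) = card (edges G - E) + card (edges G \<inter> E)"
      using fin by (subst card_Un_disjoint[symmetric]) (auto intro: arg_cong[where f = card])
    moreover have "card E = card (E - edges G) + card (edges G \<inter> E)"
      using finE by (subst card_Un_disjoint[symmetric]) (auto intro: arg_cong[where f = card])
    ultimately show ?thesis
      using card cardE ds(3) rs(3) js(3) by linarith
  qed
  then have "of_nat (length ds + 2 * length rs + length js) \<le> (of_nat k :: ennreal)"
    by (rule of_nat_mono)
  ultimately show ?thesis using cost by (meson order_trans)
qed

section \<open>Words as paths, and their runs of zeros\<close>

text \<open>Edge \<open>i\<close> joins \<open>i\<close> and \<open>Suc i\<close>, so
  \<open>Min e\<close> recovers its position in the word.\<close>

definition path_of :: "nat list \<Rightarrow> lgraph" where
  "path_of w = \<lparr>verts = {..length w}, edges = (\<lambda>i. {i, Suc i}) ` {..<length w},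
     vlab = (\<lambda>_. 0), elab = (\<lambda>e. w ! Min e)\<rparr>"

lemma path_of_simps [simp]:
  "verts (path_of w) = {..length w}" "edges (path_of w) = (\<lambda>i. {i, Suc i}) ` {..<length w}"
  "vlab (path_of w) v = 0" "elab (path_of w) {i, Suc i} = w ! i"
  by (simp_all add: path_of_def)

lemma inj_edge: "inj_on (\<lambda>i. {i, Suc i}) A"
  by (auto simp: inj_on_def doubleton_eq_iff)

lemma card_edges_path_of: "card (edges (path_of w)) = length w"
  by (simp add: card_image[OF inj_edge])

lemma simple_graph_path_of: "simple_graph (path_of w)"
  by (auto simp: simple_graph_def)

lemma edge_labeled_path_path_of:
  assumes "set w \<subseteq> \<Sigma>" and "0 \<in> \<Sigma>"
  shows "edge_labeled_path \<Sigma> 0 (path_of w)"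
proof -
  define vs where "vs = [0..<Suc (length w)]"
  have "vs ! i = i" if "i \<le> length w" for i
    using that by (simp add: vs_def del: upt_Suc)
  then have "{vs ! i, vs ! Suc i} = {i, Suc i}" if "Suc i < length vs" for i
    using that by (simp add: vs_def)
  moreover have "Suc i < length vs \<longleftrightarrow> i < length w" for i
    by (simp add: vs_def)
  ultimately have "edges (path_of w) = {{vs ! i, vs ! Suc i} | i. Suc i < length vs}"
    by auto
  moreover have "vs \<noteq> []" "distinct vs" "verts (path_of w) = set vs"
    by (auto simp: vs_def)
  ultimately have "path_graph (path_of w)"
    unfolding path_graph_def by blast
  moreover have "labeled_graph \<Sigma> (path_of w)"
    using assms nth_mem[of _ w] by (auto simp: labeled_graph_def)
  ultimately show ?thesis by (simp add: edge_labeled_path_def)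
qed


text \<open>Every run is closed by a separator, the last one included. Hence a run of s edges owns
  exactly s + 1 vertices, and one vertex is left over at the end of the path.\<close>

definition seg :: "nat \<Rightarrow> nat list \<Rightarrow> nat list" where
  "seg c ss = concat (map (\<lambda>s. replicate s 0 @ [c]) ss)"

text \<open>Read both as a vertex and as the edge that leaves it to the right:
  \<open>r = ss ! i\<close> is the last vertex of run \<open>i\<close> and also its separator
  edge.\<close>

definition pos :: "nat list \<Rightarrow> nat \<Rightarrow> nat \<Rightarrow> nat" where
  "pos ss i r = (\<Sum>j<i. Suc (ss ! j)) + r"

lemma pos_simps [simp]: "pos ss 0 r = r" "pos (s # ss) (Suc i) r = Suc s + pos ss i r"
  by (simp_all add: pos_def sum.lessThan_Suc_shift del: sum.lessThan_Suc)

lemma pos_Suc: "pos ss i (Suc r) = Suc (pos ss i r)"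
  by (simp add: pos_def)

lemma nth_seg:
  "i < length ss \<Longrightarrow> r \<le> ss ! i \<Longrightarrow>
     pos ss i r < length (seg c ss) \<and> seg c ss ! pos ss i r = (if r < ss ! i then 0 else c)"
proof (induction ss arbitrary: i)
  case (Cons s ss)
  have seg: "seg c (s # ss) = (replicate s 0 @ [c]) @ seg c ss" by (simp add: seg_def)
  show ?case
  proof (cases i)
    case 0
    then show ?thesis using Cons.prems by (auto simp: seg nth_append)
  next
    case (Suc j)
    then have "pos ss j r < length (seg c ss) \<and>
        seg c ss ! pos ss j r = (if r < ss ! j then 0 else c)"
      using Cons.prems by (intro Cons.IH) auto
    then show ?thesis using Suc by (simp add: seg nth_append)
  qed
qed simp

lemma pos_exists:
  "p < length (seg c ss) \<Longrightarrow> \<exists>i r. i < length ss \<and> r \<le> ss ! i \<and> p = pos ss i r"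
proof (induction ss arbitrary: p)
  case (Cons s ss)
  show ?case
  proof (cases "p \<le> s")
    case True
    then show ?thesis by (intro exI[of _ 0] exI[of _ p]) simp
  next
    case False
    then have "p - Suc s < length (seg c ss)"
      using Cons.prems by (simp add: seg_def)
    then obtain i r where "i < length ss" "r \<le> ss ! i" "p - Suc s = pos ss i r"
      using Cons.IH by blast
    then show ?thesis using False by (intro exI[of _ "Suc i"] exI[of _ r]) simp
  qed
qed (simp add: seg_def)

lemma pos_less:
  assumes "i < i'" and "r \<le> ss ! i"
  shows "pos ss i r < pos ss i' r'"
proof -
  have "pos ss i r < (\<Sum>j<Suc i. Suc (ss ! j))" using assms(2) by (simp add: pos_def)
  also have "\<dots> \<le> (\<Sum>j<i'. Suc (ss ! j))" using assms(1) by (intro sum_mono2) auto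
  finally show ?thesis by (simp add: pos_def)
qed

lemma pos_inject:
  assumes "r \<le> ss ! i" and "r' \<le> ss ! i'" and "pos ss i r = pos ss i' r'"
  shows "i = i' \<and> r = r'"
proof -
  have "i = i'"
    using pos_less[of i i' r ss r'] pos_less[of i' i r' ss r] assms by (cases i i' rule: linorder_cases) auto
  then show ?thesis using assms(3) by (simp add: pos_def)
qed

lemma card_zeros_seg:
  assumes "c \<noteq> 0"
  shows "card {p. p < length (seg c ss) \<and> seg c ss ! p = 0} = sum_list ss"
proof -
  have "length (filter (\<lambda>l. l = 0) (seg c ss)) = sum_list ss"
    using assms by (induction ss) (auto simp: seg_def)
  then show ?thesis by (simp add: length_filter_conv_card)
qed

lemma set_seg: "set (seg c ss) \<subseteq> {0, c}"
  by (auto simp: seg_def split: if_splits)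

section \<open>Packing the runs of one path into those of another\<close>

text \<open>The lists give numbers of edges, whereas a run occupies space according to its vertices.\<close>

definition packable :: "nat list \<Rightarrow> nat list \<Rightarrow> bool" where
  "packable Bs Is \<longleftrightarrow> (\<exists>a. (\<forall>i < length Is. a i < length Bs) \<and>
     (\<forall>j < length Bs. (\<Sum>i | i < length Is \<and> a i = j. Suc (Is ! i)) \<le> Suc (Bs ! j)))"

text \<open>\<open>k\<close> leaves no choice but to match all 0-edges. Consecutive ones share a
  vertex, so a run is mapped into a single run. Items must be positive because an item of one vertex
  has no edge that ties it to a run. \<open>G\<close> and \<open>H\<close> are compared with paths
  on their edges only, since this is what a code of a graph determines.\<close>

lemma packable_if_GED_le:
  assumes G: "simple_graph G" "verts G = verts (path_of (seg 1 Bs))"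
      "edges G = edges (path_of (seg 1 Bs))"
      "\<And>e. e \<in> edges G \<Longrightarrow> elab G e = elab (path_of (seg 1 Bs)) e"
    and H: "simple_graph H" "verts H = verts (path_of (seg 2 Is))"
      "edges H = edges (path_of (seg 2 Is))"
      "\<And>e. e \<in> edges H \<Longrightarrow> elab H e = elab (path_of (seg 2 Is)) e"
    and k: "k + 2 * sum_list Is = length (seg 1 Bs) + length (seg 2 Is)"
    and pos_Is: "\<And>s. s \<in> set Is \<Longrightarrow> s > 0"
    and GED: "GED C_E G H \<le> of_nat k"
  shows "packable Bs Is"
proof -
  let ?G = "seg 1 Bs" and ?H = "seg 2 Is"
  obtain g K where g: "inj_on g {..length ?H}" and K: "K \<subseteq> edges H"
    "card (edges G) + card (edges H) \<le> 2 * card K + k"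
    "\<And>e. e \<in> K \<Longrightarrow> g ` e \<in> edges G \<and> elab G (g ` e) = elab H e"
    using GED_le_imp_common_edges[OF G(1) H(1) GED] H(2) by (metis path_of_simps(1))
  define Z where "Z = {p. p < length ?H \<and> ?H ! p = 0}"
  have K_edge: "\<exists>q < length ?G. g ` {p, Suc p} = {q, Suc q} \<and> ?G ! q = ?H ! p \<and> p < length ?H"
    if p: "{p, Suc p} \<in> K" for p
  proof -
    have "{p, Suc p} \<in> edges H" using p K(1) by blast
    then have pH: "p < length ?H" "elab H {p, Suc p} = ?H ! p"
      using H(3,4) by (auto simp: doubleton_eq_iff)
    obtain q where q: "q < length ?G" "g ` {p, Suc p} = {q, Suc q}"
      using K(3)[OF p] G(3) by auto
    have "{q, Suc q} \<in> edges G" using q(1) G(3) by auto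
    then have "elab G {q, Suc q} = ?G ! q" using G(4) by simp
    then show ?thesis using K(3)[OF p] pH q by auto
  qed
  have K_Z: "K \<subseteq> (\<lambda>p. {p, Suc p}) ` Z"
  proof
    fix e assume e: "e \<in> K"
    then obtain p where p: "e = {p, Suc p}" using K(1) H(3) by auto
    then obtain q where q: "q < length ?G" "?G ! q = ?H ! p" "p < length ?H"
      using K_edge e by blast
    have "?G ! q \<in> {0, 1}" "?H ! p \<in> {0, 2}"
      using set_seg[of 1 Bs] set_seg[of 2 Is] nth_mem[OF q(1)] nth_mem[OF q(3)] by blast+
    then have "?H ! p = 0" using q(2) by auto
    then show "e \<in> (\<lambda>p. {p, Suc p}) ` Z" using p q(3) by (auto simp: Z_def)
  qed
  have "card Z = sum_list Is" unfolding Z_def by (rule card_zeros_seg) simp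
  then have "card ((\<lambda>p. {p, Suc p}) ` Z) \<le> card K"
    using K(2) k G(3) H(3) by (simp add: card_image[OF inj_edge])
  \<comment> \<open>Both words have only the label 0 in common, and the threshold requires as many
    matches as there are 0-edges.\<close>
  then have "K = (\<lambda>p. {p, Suc p}) ` Z"
    using K_Z by (intro card_seteq) (auto simp: Z_def)
  then have Z_edge: "\<exists>q < length ?G. g ` {p, Suc p} = {q, Suc q} \<and> ?G ! q = 0" if "p \<in> Z" for p
    using K_edge[of p] that by (auto simp: Z_def)
  have "\<forall>q. \<exists>i r. q < length ?G \<longrightarrow> i < length Bs \<and> r \<le> Bs ! i \<and> q = pos Bs i r"
    using pos_exists by blast
  then obtain \<beta> \<rho> where \<beta>: "\<And>q. q < length ?G \<Longrightarrow>
      \<beta> q < length Bs \<and> \<rho> q \<le> Bs ! \<beta> q \<and> q = pos Bs (\<beta> q) (\<rho> q)"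
    by metis
  have same: "g p < length ?G \<and> g (Suc p) < length ?G \<and> \<beta> (g p) = \<beta> (g (Suc p))" if p: "p \<in> Z" for p
  proof -
    obtain q where q: "q < length ?G" "g ` {p, Suc p} = {q, Suc q}" "?G ! q = 0"
      using Z_edge[OF p] by blast
    have \<rho>: "\<rho> q < Bs ! \<beta> q"
      using nth_seg[of "\<beta> q" Bs "\<rho> q" 1] \<beta>[OF q(1)] q(3) by (auto split: if_splits)
    have Suc: "Suc q = pos Bs (\<beta> q) (Suc (\<rho> q))"
      using \<beta>[OF q(1)] by (simp add: pos_Suc)
    then have len: "Suc q < length ?G"
      using nth_seg[of "\<beta> q" Bs "Suc (\<rho> q)" 1] \<beta>[OF q(1)] \<rho> by simp
    have "\<beta> (Suc q) = \<beta> q"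
      using pos_inject[of "\<rho> (Suc q)" Bs "\<beta> (Suc q)" "Suc (\<rho> q)" "\<beta> q"] \<beta>[OF len] Suc \<rho> by simp
    moreover have "g p \<in> {q, Suc q}" "g (Suc p) \<in> {q, Suc q}" using q(2) by auto
    ultimately show ?thesis using q(1) len by auto
  qed
  \<comment> \<open>An item is assigned to the run that receives its first vertex; the others follow
    along the 0-edges.\<close>
  define a where "a = (\<lambda>i. \<beta> (g (pos Is i 0)))"
  have item: "g (pos Is i r) < length ?G \<and> \<beta> (g (pos Is i r)) = a i"
    if i: "i < length Is" and r: "r \<le> Is ! i" for i r
  proof -
    have Z: "pos Is i r \<in> Z" if "r < Is ! i" for r
      using nth_seg[OF i, of r 2] that by (simp add: Z_def)
    show ?thesis
      using r
    proof (induction r)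
      case 0
      have "Is ! i > 0" using pos_Is i by simp
      then show ?case using same[OF Z] by (simp add: a_def)
    next
      case (Suc r)
      then have "r < Is ! i" "\<beta> (g (pos Is i r)) = a i" by simp_all
      then show ?case using same[OF Z[of r]] by (simp add: pos_Suc)
    qed
  qed
  show ?thesis
    unfolding packable_def
  proof (intro exI[of _ a] conjI allI impI)
    fix i assume i: "i < length Is"
    show "a i < length Bs" using item[OF i, of 0] \<beta> by (metis le0)
  next
    fix j assume j: "j < length Bs"
    let ?I = "{i. i < length Is \<and> a i = j}"
    let ?X = "Sigma ?I (\<lambda>i. {..Is ! i})"
    \<comment> \<open>The vertices of all items in bin \<open>j\<close> are mapped injectively to
      the \<open>Suc (Bs ! j)\<close> offsets inside run \<open>j\<close>.\<close>
    have "inj_on (\<lambda>(i, r). \<rho> (g (pos Is i r))) ?X"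
    proof (rule inj_onI)
      fix x y
      assume "x \<in> ?X" "y \<in> ?X"
        and "(\<lambda>(i, r). \<rho> (g (pos Is i r))) x = (\<lambda>(i, r). \<rho> (g (pos Is i r))) y"
      then obtain i r i' r' where xy: "x = (i, r)" "y = (i', r')"
        and i: "i < length Is" "r \<in> {..Is ! i}" and i': "i' < length Is" "r' \<in> {..Is ! i'}"
        and a: "a i = a i'" and eq: "\<rho> (g (pos Is i r)) = \<rho> (g (pos Is i' r'))"
        by auto
      have "g (pos Is i r) = g (pos Is i' r')"
        using item[OF i(1), of r] item[OF i'(1), of r'] i(2) i'(2) a eq \<beta> by (metis atMost_iff)
      moreover have "pos Is i r < length ?H" "pos Is i' r' < length ?H"
        using nth_seg[OF i(1), of r 2] nth_seg[OF i'(1), of r' 2] i(2) i'(2) by auto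
      ultimately have "pos Is i r = pos Is i' r'"
        using g by (auto dest: inj_onD)
      then have "i = i' \<and> r = r'"
        using i(2) i'(2) by (intro pos_inject) auto
      then show "x = y" using xy by simp
    qed
    moreover have "(\<lambda>(i, r). \<rho> (g (pos Is i r))) ` ?X \<subseteq> {..Bs ! j}"
      using item \<beta> by fastforce
    ultimately have "card ?X \<le> card {..Bs ! j}"
      by (intro card_inj_on_le) auto
    moreover have "card ?X = (\<Sum>i \<in> ?I. Suc (Is ! i))"
      by (subst card_SigmaI) auto
    ultimately show "(\<Sum>i | i < length Is \<and> a i = j. Suc (Is ! i)) \<le> Suc (Bs ! j)" by simp
  qed
qed

text \<open>The items of a bin are laid side by side: \<open>off i\<close> counts the vertices of
  the earlier items in the same bin. Separator edges of the second path may be torn apart, as only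
  0-edges have to be preserved.\<close>

lemma GED_le_if_packable:
  assumes "packable Bs Is"
    and k: "k + 2 * sum_list Is = length (seg 1 Bs) + length (seg 2 Is)"
  shows "GED C_E (path_of (seg 1 Bs)) (path_of (seg 2 Is)) \<le> of_nat k"
proof -
  let ?G = "seg 1 Bs" and ?H = "seg 2 Is"
  obtain a where a: "\<And>i. i < length Is \<Longrightarrow> a i < length Bs"
    and cap: "\<And>j. j < length Bs \<Longrightarrow> (\<Sum>i | i < length Is \<and> a i = j. Suc (Is ! i)) \<le> Suc (Bs ! j)"
    using assms(1) by (auto simp: packable_def)
  define off where "off = (\<lambda>i. \<Sum>i' | i' < i \<and> a i' = a i. Suc (Is ! i'))"
  have off_step: "off i + Suc (Is ! i) \<le> (\<Sum>i' | i' < m \<and> a i' = a i. Suc (Is ! i'))"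
    if "i < m" for i m
  proof -
    have "off i + Suc (Is ! i) = (\<Sum>i' \<in> insert i {i'. i' < i \<and> a i' = a i}. Suc (Is ! i'))"
      by (simp add: off_def)
    also have "\<dots> \<le> (\<Sum>i' | i' < m \<and> a i' = a i. Suc (Is ! i'))"
      using that by (intro sum_mono2) auto
    finally show ?thesis .
  qed
  have off_bound: "off i + r \<le> Bs ! a i" if "i < length Is" "r \<le> Is ! i" for i r
    using off_step[OF that(1)] cap[OF a[OF that(1)]] that(2) by simp
  have off_inject: "i = i' \<and> r = r'"
    if "r \<le> Is ! i" "r' \<le> Is ! i'" "a i = a i'" "off i + r = off i' + r'" for i i' r r'
  proof -
    have "\<not> i < i'"
      using off_step[of i i'] that by (auto simp: off_def)
    moreover have "\<not> i' < i"
      using off_step[of i' i] that by (auto simp: off_def)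
    ultimately show ?thesis using that by simp
  qed
  have "\<forall>p. \<exists>i r. p < length ?H \<longrightarrow> i < length Is \<and> r \<le> Is ! i \<and> p = pos Is i r"
    using pos_exists by blast
  then obtain \<iota> \<rho> where \<iota>: "\<And>p. p < length ?H \<Longrightarrow>
      \<iota> p < length Is \<and> \<rho> p \<le> Is ! \<iota> p \<and> p = pos Is (\<iota> p) (\<rho> p)"
    by metis
  \<comment> \<open>The last vertex of the second path lies behind the final separator and in no
    run. It goes to the corresponding vertex of the first path.\<close>
  define g where "g = (\<lambda>p. if p < length ?H then pos Bs (a (\<iota> p)) (off (\<iota> p) + \<rho> p) else length ?G)"
  have g_less: "g p < length ?G" if "p < length ?H" for p
    using nth_seg[of "a (\<iota> p)" Bs "off (\<iota> p) + \<rho> p" 1] off_bound \<iota>[OF that] a that by (simp add: g_def)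
  have g_inj: "p = q" if p: "p < length ?H" and q: "q < length ?H" and eq: "g p = g q" for p q
  proof -
    have "a (\<iota> p) = a (\<iota> q) \<and> off (\<iota> p) + \<rho> p = off (\<iota> q) + \<rho> q"
      using eq off_bound \<iota>[OF p] \<iota>[OF q] p q by (intro pos_inject) (auto simp: g_def)
    then have "\<iota> p = \<iota> q \<and> \<rho> p = \<rho> q"
      using \<iota>[OF p] \<iota>[OF q] by (intro off_inject) auto
    then show ?thesis using \<iota>[OF p] \<iota>[OF q] by metis
  qed
  have edge: "g (Suc p) = Suc (g p) \<and> ?G ! g p = 0" if p: "p < length ?H" "?H ! p = 0" for p
  proof -
    have \<rho>: "\<rho> p < Is ! \<iota> p"
      using nth_seg[of "\<iota> p" Is "\<rho> p" 2] \<iota>[OF p(1)] p(2) by (auto split: if_splits)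
    have Suc: "Suc p = pos Is (\<iota> p) (Suc (\<rho> p))"
      using \<iota>[OF p(1)] by (simp add: pos_Suc)
    then have len: "Suc p < length ?H"
      using nth_seg[of "\<iota> p" Is "Suc (\<rho> p)" 2] \<iota>[OF p(1)] \<rho> by simp
    have "\<iota> (Suc p) = \<iota> p \<and> \<rho> (Suc p) = Suc (\<rho> p)"
      using \<iota>[OF len] Suc \<rho> by (intro pos_inject[of _ Is]) auto
    then have "g (Suc p) = Suc (g p)"
      using p(1) len by (simp add: g_def pos_Suc)
    moreover have "off (\<iota> p) + \<rho> p < Bs ! a (\<iota> p)"
      using off_bound[of "\<iota> p" "Suc (\<rho> p)"] \<iota>[OF p(1)] \<rho> by simp
    then have "?G ! g p = 0"
      using nth_seg[of "a (\<iota> p)" Bs "off (\<iota> p) + \<rho> p" 1] a \<iota>[OF p(1)] p(1) by (simp add: g_def)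
    ultimately show ?thesis by simp
  qed
  define Z where "Z = {p. p < length ?H \<and> ?H ! p = 0}"
  have "card Z = sum_list Is" unfolding Z_def by (rule card_zeros_seg) simp
  show ?thesis
  proof (rule GED_le_if_common_edges[of _ _ g "(\<lambda>p. {p, Suc p}) ` Z"])
    show "inj_on g (verts (path_of ?H))"
    proof (rule inj_onI)
      fix p q assume "p \<in> verts (path_of ?H)" "q \<in> verts (path_of ?H)" and eq: "g p = g q"
      then have "p \<le> length ?H" "q \<le> length ?H" by simp_all
      moreover have "g p = length ?G \<longleftrightarrow> \<not> p < length ?H" for p
        using g_less[of p] by (auto simp: g_def)
      ultimately show "p = q" using eq g_inj[of p q] by (metis le_neq_implies_less)
    qed
    show "g ` verts (path_of ?H) \<subseteq> verts (path_of ?G)"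
    proof clarify
      fix p
      show "g p \<in> verts (path_of ?G)" using g_less[of p] by (cases "p < length ?H") (auto simp: g_def)
    qed
    fix e assume "e \<in> (\<lambda>p. {p, Suc p}) ` Z"
    then obtain p where p: "e = {p, Suc p}" "p < length ?H" "?H ! p = 0" by (auto simp: Z_def)
    then have "g ` e = {g p, Suc (g p)}" using edge[of p] by simp
    then show "g ` e \<in> edges (path_of ?G) \<and> elab (path_of ?G) (g ` e) = elab (path_of ?H) e"
      using edge[of p] g_less[of p] p by auto
  next
    show "card (edges (path_of ?G)) + card (edges (path_of ?H)) \<le> 2 * card ((\<lambda>p. {p, Suc p}) ` Z) + k"
      using k \<open>card Z = sum_list Is\<close> unfolding card_edges_path_of by (simp add: card_image[OF inj_edge])
  qed (auto simp: simple_graph_path_of Z_def)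
qed

section \<open>Tilings as packing problems\<close>

text \<open>Positions in the lists are replaced by names of bins and items, which is possible
  because the names are distinct.\<close>

lemma packable_map_iff:
  assumes "distinct bl" and "distinct il"
  shows "packable (map S bl) (map s il) \<longleftrightarrow>
    (\<exists>a. (\<forall>i \<in> set il. a i \<in> set bl) \<and>
      (\<forall>b \<in> set bl. (\<Sum>i | i \<in> set il \<and> a i = b. Suc (s i)) \<le> Suc (S b)))"
    (is "?L \<longleftrightarrow> ?R")
proof -
  have sums: "(\<Sum>n | n < length il \<and> a n = j. Suc (map s il ! n)) =
      (\<Sum>i | i \<in> set il \<and> a' i = b. Suc (s i))"
    if "\<And>n. n < length il \<Longrightarrow> a n = j \<longleftrightarrow> a' (il ! n) = b" for a a' j b
  proof -
    have "bij_betw ((!) il) {n. n < length il \<and> a n = j} {i. i \<in> set il \<and> a' i = b}"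
      using assms(2) that
      by (auto simp: bij_betw_def inj_on_def nth_eq_iff_index_eq in_set_conv_nth image_iff)
    from sum.reindex_bij_betw[OF this, of "\<lambda>i. Suc (s i)"] show ?thesis
      by simp
  qed
  obtain ix where ix: "\<And>n. n < length il \<Longrightarrow> ix (il ! n) = n"
    using inv_into_f_f[OF inj_on_nth[OF assms(2), of "{..<length il}"]] by auto
  obtain bx where bx: "\<And>n. n < length bl \<Longrightarrow> bx (bl ! n) = n"
    using inv_into_f_f[OF inj_on_nth[OF assms(1), of "{..<length bl}"]] by auto
  show ?thesis
  proof
    assume ?L
    then obtain a where a: "\<And>n. n < length il \<Longrightarrow> a n < length bl"
      "\<And>j. j < length bl \<Longrightarrow> (\<Sum>n | n < length il \<and> a n = j. Suc (map s il ! n)) \<le> Suc (map S bl ! j)"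
      by (auto simp: packable_def)
    show ?R
    proof (intro exI[of _ "\<lambda>i. bl ! a (ix i)"] conjI ballI)
      fix i assume "i \<in> set il"
      then obtain n where "n < length il" "i = il ! n" by (auto simp: in_set_conv_nth)
      then show "bl ! a (ix i) \<in> set bl" using a(1)[of n] ix[of n] by simp
    next
      fix b assume "b \<in> set bl"
      then obtain j where j: "j < length bl" "b = bl ! j" by (auto simp: in_set_conv_nth)
      have "(\<Sum>n | n < length il \<and> a n = j. Suc (map s il ! n)) =
          (\<Sum>i | i \<in> set il \<and> bl ! a (ix i) = b. Suc (s i))"
        using ix a(1) j assms(1) by (intro sums) (auto simp: nth_eq_iff_index_eq)
      then show "(\<Sum>i | i \<in> set il \<and> bl ! a (ix i) = b. Suc (s i)) \<le> Suc (S b)"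
        using a(2)[OF j(1)] j by simp
    qed
  next
    assume ?R
    then obtain a where a: "\<And>i. i \<in> set il \<Longrightarrow> a i \<in> set bl"
      "\<And>b. b \<in> set bl \<Longrightarrow> (\<Sum>i | i \<in> set il \<and> a i = b. Suc (s i)) \<le> Suc (S b)"
      by blast
    have a_nth: "\<exists>j < length bl. a (il ! n) = bl ! j" if "n < length il" for n
      using a(1)[OF nth_mem[OF that]] by (metis in_set_conv_nth)
    show ?L
      unfolding packable_def
    proof (intro exI[of _ "\<lambda>n. bx (a (il ! n))"] conjI allI impI)
      fix n assume "n < length (map s il)"
      then show "bx (a (il ! n)) < length (map S bl)" using a_nth[of n] bx by auto
    next
      fix j assume j: "j < length (map S bl)"
      have "(\<Sum>n | n < length il \<and> bx (a (il ! n)) = j. Suc (map s il ! n)) =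
          (\<Sum>i | i \<in> set il \<and> a i = bl ! j. Suc (s i))"
      proof (rule sums)
        fix n assume "n < length il"
        then show "bx (a (il ! n)) = j \<longleftrightarrow> a (il ! n) = bl ! j"
          using a_nth[of n] bx j nth_eq_iff_index_eq[OF assms(1)] by auto
      qed
      then show "(\<Sum>n | n < length (map s il) \<and> bx (a (il ! n)) = j. Suc (map s il ! n))
          \<le> Suc (map S bl ! j)"
        using a(2)[of "bl ! j"] j by simp
    qed
  qed
qed

section \<open>Recovering numbers from digits and power sums\<close>

lemma digits_unique:
  fixes u v :: "nat \<Rightarrow> nat"
  assumes "(\<Sum>i<n. u i * b ^ i) = (\<Sum>i<n. v i * b ^ i)"
    and "\<And>i. i < n \<Longrightarrow> u i < b" and "\<And>i. i < n \<Longrightarrow> v i < b" and "i < n"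
  shows "u i = v i"
  using assms
proof (induction n arbitrary: u v i)
  case (Suc n)
  have split: "(\<Sum>i<Suc n. w i * b ^ i) = w 0 + b * (\<Sum>i<n. w (Suc i) * b ^ i)" for w
    by (simp add: sum.lessThan_Suc_shift sum_distrib_left mult_ac del: sum.lessThan_Suc)
  have "x = x' \<and> r = r'" if "x + b * r = x' + b * r'" "x < b" "x' < b" for x x' r r' :: nat
  proof -
    have "x = x'"
      using arg_cong[OF that(1), of "\<lambda>y. y mod b"] that(2,3) by simp
    then show ?thesis using that by simp
  qed
  from this[OF Suc.prems(1)[unfolded split] Suc.prems(2)[of 0] Suc.prems(3)[of 0]]
  have "u 0 = v 0" "(\<Sum>i<n. u (Suc i) * b ^ i) = (\<Sum>i<n. v (Suc i) * b ^ i)"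
    by simp_all
  then show ?case
    using Suc.IH[of "\<lambda>i. u (Suc i)" "\<lambda>i. v (Suc i)" "i - 1"] Suc.prems by (cases i) auto
qed simp

lemma three_digits_unique:
  fixes b :: nat
  assumes "u0 + u1 * b + u2 * b\<^sup>2 = v0 + v1 * b + v2 * b\<^sup>2"
    and "u0 < b" "u1 < b" "u2 < b" "v0 < b" "v1 < b" "v2 < b"
  shows "u0 = v0 \<and> u1 = v1 \<and> u2 = v2"
proof -
  have eq: "(\<Sum>i<3. [u0, u1, u2] ! i * b ^ i) = (\<Sum>i<3. [v0, v1, v2] ! i * b ^ i)"
    using assms(1) by (simp add: eval_nat_numeral)
  have less: "[u0, u1, u2] ! i < b" "[v0, v1, v2] ! i < b" if "i < 3" for i
    using that assms by (auto simp: less_Suc_eq numeral_3_eq_3)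
  have "[u0, u1, u2] ! i = [v0, v1, v2] ! i" if "i < 3" for i
    using digits_unique[OF eq less that] by simp
  from this[of 0] this[of 1] this[of 2] show ?thesis by simp
qed

text \<open>Eliminating \<open>y\<close> leaves (x - a)(x - b) = 0. This identifies two tokens of
  one conflict in the same bin, which occur when the tile is both source and target of the
  conflict.\<close>

lemma pair_of_sums:
  fixes x y a b :: nat
  assumes "x + y = a + b" and "x\<^sup>2 + y\<^sup>2 = a\<^sup>2 + b\<^sup>2"
  shows "x = a \<and> y = b \<or> x = b \<and> y = a"
proof -
  have y: "int y = int a + int b - int x" using assms(1) by linarith
  have "(int x)\<^sup>2 + (int y)\<^sup>2 = (int a)\<^sup>2 + (int b)\<^sup>2"
    using arg_cong[OF assms(2), of int] by simp
  then have "2 * ((int x - int a) * (int x - int b)) = 0"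
    unfolding y by (simp add: power2_eq_square algebra_simps)
  then have "x = a \<or> x = b" by simp
  then show ?thesis using assms(1) by auto
qed

section \<open>The packing instance of a choice problem\<close>

text \<open>
  \<open>Cell c 0\<close> is the real token of cell \<open>c\<close>. The tokens \<open>Conf \<theta> x b\<close> belong to the conflict \<open>\<theta>\<close>
  between the cells \<open>x - \<delta> \<theta>\<close> and \<open>x\<close>, where \<open>b\<close> marks the real token. If one of these cells is
  out of range, then there is only the real token.
\<close>

datatype item = Cell nat nat | Conf nat nat bool

text \<open>Each of \<open>N\<close> cells is to be given one of \<open>D\<close> tiles; conflict
  \<open>\<theta>\<close> forbids \<open>src \<theta>\<close> at \<open>c\<close> together with
  \<open>tgt \<theta>\<close> at \<open>c + \<delta> \<theta>\<close>. There are
  \<open>N * D + 2 * N * T\<close> tokens with identifiers up to \<open>2 * N\<close>, so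
  \<open>B\<close> exceeds all sums of their powers up to the square. The summand 2 covers the two
  terms that a digit of a capacity may have.\<close>

locale choice_packing =
  fixes N D T B :: nat and src tgt \<delta> :: "nat \<Rightarrow> nat" and ok :: "nat \<Rightarrow> nat \<Rightarrow> bool"
  assumes src: "\<And>\<theta>. \<theta> < T \<Longrightarrow> src \<theta> < D" and tgt: "\<And>\<theta>. \<theta> < T \<Longrightarrow> tgt \<theta> < D"
    and \<delta>: "\<And>\<theta>. \<theta> < T \<Longrightarrow> 0 < \<delta> \<theta> \<and> \<delta> \<theta> \<le> N" and D: "0 < D"
    and B: "(N * D + 2 * N * T + 2) * (2 * N + 1)\<^sup>2 < B"
begin

definition good_choice :: "(nat \<Rightarrow> nat) \<Rightarrow> bool" where
  "good_choice f \<longleftrightarrow> (\<forall>c < N. f c < D \<and> ok c (f c)) \<and>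
     (\<forall>\<theta> < T. \<forall>c. c + \<delta> \<theta> < N \<longrightarrow> \<not> (f c = src \<theta> \<and> f (c + \<delta> \<theta>) = tgt \<theta>))"

definition ilist :: "item list" where
  "ilist = concat (map (\<lambda>c. map (Cell c) [0..<D]) [0..<N]) @
     concat (map (\<lambda>\<theta>. map (\<lambda>x. Conf \<theta> x True) [0..<N + \<delta> \<theta>] @
       map (\<lambda>x. Conf \<theta> x False) [\<delta> \<theta>..<N]) [0..<T])"

definition blist :: "(nat \<times> nat) list" where
  "blist = concat (map (\<lambda>c. map (Pair c) [0..<D]) [0..<N])"

text \<open>Three digits in base \<open>B\<close>. Summed over tokens they give the number, the sum
  and the sum of squares of the identifiers.\<close>

definition q :: "nat \<Rightarrow> nat" where
  "q x = 1 + x * B + x\<^sup>2 * B\<^sup>2"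

fun kind :: "item \<Rightarrow> nat" where
  "kind (Cell c j) = T"
| "kind (Conf \<theta> x b) = \<theta>"

fun ident :: "item \<Rightarrow> nat" where
  "ident (Cell c j) = c"
| "ident (Conf \<theta> x b) = x"

text \<open>A bin holds at most two tokens of each conflict, so \<open>M\<close> has room for all
  its dummies as long as the real cell token is elsewhere. That token weighs \<open>M + 1\<close>
  and uses up the room completely.\<close>

definition M :: nat where
  "M = 2 * T + 1"

fun low :: "item \<Rightarrow> nat" where
  "low (Cell c j) = (if j = 0 then M + 1 else 0)"
| "low (Conf \<theta> x b) = (if b then 0 else 1)"

definition high :: "item \<Rightarrow> nat" where
  "high i = q (ident i) * (B ^ 3) ^ kind i"

text \<open>The tokens that belong to a bin: one for its cell, at digit \<open>T\<close>, and for
  each conflict one per role of the tile. As a target the bin is addressed by its own cell, as a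
  source by the cell at distance \<open>\<delta> \<theta>\<close>.\<close>

definition block :: "nat \<times> nat \<Rightarrow> nat \<Rightarrow> nat" where
  "block b \<theta> = (if \<theta> = T then q (fst b) else
     (if tgt \<theta> = snd b then q (fst b) else 0) + (if src \<theta> = snd b then q (fst b + \<delta> \<theta>) else 0))"

definition slots :: "nat \<Rightarrow> nat \<Rightarrow> nat" where
  "slots d \<theta> = (if tgt \<theta> = d then 1 else 0) + (if src \<theta> = d then 1 else 0)"

definition High :: "nat \<times> nat \<Rightarrow> nat" where
  "High b = (\<Sum>\<theta><Suc T. block b \<theta> * (B ^ 3) ^ \<theta>)"

text \<open>Each token occupies \<open>Suc (low i)\<close> units at the lowest digit. The slots pay
  for the units of the conflict tokens, which leaves \<open>M\<close> for low weights, and one more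
  if the tile is allowed.\<close>

definition Low :: "nat \<times> nat \<Rightarrow> nat" where
  "Low b = (\<Sum>\<theta><T. slots (snd b) \<theta>) + M + (if ok (fst b) (snd b) then 1 else 0)"

text \<open>\<open>Suc (Low b)\<close> is at most \<open>4 * T + 3\<close>: up to
  \<open>2 * T\<close> for slots, \<open>M\<close>, and 1 each for \<open>ok\<close> and
  \<open>Suc\<close>. Hence the lowest digit never carries.\<close>

definition L :: nat where
  "L = 4 * T + 4"

definition item_size :: "item \<Rightarrow> nat" where
  "item_size i = high i * L + low i"

definition capacity :: "nat \<times> nat \<Rightarrow> nat" where
  "capacity b = High b * L + Low b"

lemma set_blist: "set blist = {..<N} \<times> {..<D}"
  by (auto simp: blist_def)

lemma distinct_concat_map:
  assumes "distinct xs" and "\<And>x. x \<in> set xs \<Longrightarrow> distinct (f x)"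
    and "\<And>x y. x \<in> set xs \<Longrightarrow> y \<in> set xs \<Longrightarrow> x \<noteq> y \<Longrightarrow> set (f x) \<inter> set (f y) = {}"
  shows "distinct (concat (map f xs))"
  using assms by (induction xs) auto

lemma distinct_blist: "distinct blist"
  unfolding blist_def by (intro distinct_concat_map) (auto simp: distinct_map inj_on_def)

lemma distinct_ilist: "distinct ilist"
proof -
  have "distinct (concat (map (\<lambda>c. map (Cell c) [0..<D]) [0..<N]))"
    by (intro distinct_concat_map) (auto simp: distinct_map inj_on_def)
  moreover have "distinct (concat (map (\<lambda>\<theta>. map (\<lambda>x. Conf \<theta> x True) [0..<N + \<delta> \<theta>] @
       map (\<lambda>x. Conf \<theta> x False) [\<delta> \<theta>..<N]) [0..<T]))"
    by (intro distinct_concat_map) (auto simp: distinct_map inj_on_def)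
  ultimately show ?thesis by (auto simp: ilist_def)
qed

lemma set_ilist: "set ilist = {Cell c j | c j. c < N \<and> j < D} \<union>
    {Conf \<theta> x True | \<theta> x. \<theta> < T \<and> x < N + \<delta> \<theta>} \<union> {Conf \<theta> x False | \<theta> x. \<theta> < T \<and> \<delta> \<theta> \<le> x \<and> x < N}"
  by (auto simp: ilist_def)

lemma sum_list_concat_map: "sum_list (map F (concat (map f xs))) = sum_list (map (\<lambda>x. sum_list (map F (f x))) xs)"
  for F :: "'a \<Rightarrow> nat"
  by (induction xs) auto

lemma sum_list_upt: "sum_list (map F [a..<b]) = (\<Sum>x\<in>{a..<b}. F x)" for F :: "nat \<Rightarrow> nat"
  by (simp add: interv_sum_list_conv_sum_set_nat)

lemma sum_ilist:
  "sum_list (map F ilist) = (\<Sum>c<N. \<Sum>j<D. F (Cell c j)) +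
     (\<Sum>\<theta><T. (\<Sum>x<N + \<delta> \<theta>. F (Conf \<theta> x True)) + (\<Sum>x\<in>{\<delta> \<theta>..<N}. F (Conf \<theta> x False)))"
  for F :: "item \<Rightarrow> nat"
  by (simp add: ilist_def sum_list_concat_map comp_def sum_list_upt lessThan_atLeast0)

lemma sum_blist: "sum_list (map F blist) = (\<Sum>c<N. \<Sum>d<D. F (c, d))" for F :: "nat \<times> nat \<Rightarrow> nat"
  by (simp add: blist_def sum_list_concat_map comp_def sum_list_upt lessThan_atLeast0)

text \<open>For one conflict, the identifiers of its tokens are collected on the left, and those
  prescribed by the slots of all cells, as target and as source, on the right.\<close>

lemma sum_shifted:
  fixes h :: "nat \<Rightarrow> nat"
  assumes "d \<le> N"
  shows "(\<Sum>x<N + d. h x) + (\<Sum>x\<in>{d..<N}. h x) = (\<Sum>c<N. h c + h (c + d))"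
proof -
  have "(\<Sum>x<N + d. h x) = (\<Sum>x<d. h x) + (\<Sum>x\<in>{d..<N + d}. h x)"
    using assms by (simp add: lessThan_atLeast0 sum.atLeastLessThan_concat)
  moreover have "(\<Sum>x\<in>{d..<N + d}. h x) = (\<Sum>c<N. h (c + d))"
    using sum.shift_bounds_nat_ivl[of h 0 d N] by (simp add: lessThan_atLeast0)
  moreover have "(\<Sum>x<d. h x) + (\<Sum>x\<in>{d..<N}. h x) = (\<Sum>c<N. h c)"
    using assms by (simp add: lessThan_atLeast0 sum.atLeastLessThan_concat)
  ultimately show ?thesis by (simp add: sum.distrib)
qed

text \<open>The totals agree exactly, which will leave no slack in any single bin.\<close>

lemma sum_High_eq: "(\<Sum>c<N. \<Sum>d<D. High (c, d)) = sum_list (map high ilist)"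
proof -
  let ?E = "B ^ 3"
  have "(\<Sum>d<D. High (c, d)) = D * (q c * ?E ^ T) + (\<Sum>\<theta><T. (q c + q (c + \<delta> \<theta>)) * ?E ^ \<theta>)" for c
  proof -
    have "(\<Sum>d<D. \<Sum>\<theta><T. block (c, d) \<theta> * ?E ^ \<theta>) = (\<Sum>\<theta><T. \<Sum>d<D. block (c, d) \<theta> * ?E ^ \<theta>)"
      by (rule sum.swap)
    also have "\<dots> = (\<Sum>\<theta><T. (q c + q (c + \<delta> \<theta>)) * ?E ^ \<theta>)"
      by (intro sum.cong refl)
        (simp add: block_def sum.distrib src tgt flip: sum_distrib_right)
    finally show ?thesis
      by (simp add: High_def sum.distrib block_def[of _ T])
  qed
  then have "(\<Sum>c<N. \<Sum>d<D. High (c, d)) =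
      (\<Sum>c<N. D * (q c * ?E ^ T)) + (\<Sum>\<theta><T. \<Sum>c<N. (q c + q (c + \<delta> \<theta>)) * ?E ^ \<theta>)"
    by (simp add: sum.distrib) (rule sum.swap)
  also have "(\<Sum>\<theta><T. \<Sum>c<N. (q c + q (c + \<delta> \<theta>)) * ?E ^ \<theta>) =
      (\<Sum>\<theta><T. (\<Sum>x<N + \<delta> \<theta>. high (Conf \<theta> x True)) + (\<Sum>x\<in>{\<delta> \<theta>..<N}. high (Conf \<theta> x False)))"
  proof (intro sum.cong refl)
    fix \<theta> assume "\<theta> \<in> {..<T}"
    then have "\<delta> \<theta> \<le> N" using \<delta>[of \<theta>] by simp
    from sum_shifted[OF this, of q]
    show "(\<Sum>c<N. (q c + q (c + \<delta> \<theta>)) * ?E ^ \<theta>) =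
        (\<Sum>x<N + \<delta> \<theta>. high (Conf \<theta> x True)) + (\<Sum>x\<in>{\<delta> \<theta>..<N}. high (Conf \<theta> x False))"
      by (simp add: high_def flip: sum_distrib_right distrib_right)
  qed
  finally show ?thesis
    by (simp add: sum_ilist high_def)
qed

lemma length_ilist: "length ilist = N * D + 2 * N * T"
proof -
  have "length xs = sum_list (map (\<lambda>_. 1) xs)" for xs :: "item list"
    by (induction xs) auto
  then have "length ilist = sum_list (map (\<lambda>_. 1) ilist)" .
  also have "\<dots> = N * D + (\<Sum>\<theta><T. N + \<delta> \<theta> + (N - \<delta> \<theta>))"
    by (subst sum_ilist) simp
  also have "(\<Sum>\<theta><T. N + \<delta> \<theta> + (N - \<delta> \<theta>)) = (\<Sum>\<theta><T. 2 * N)"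
    using \<delta> by (intro sum.cong) auto
  finally show ?thesis by simp
qed

text \<open>The first three summands form the threshold. By \<open>sum_High_eq\<close> the large
  parts of sizes and capacities cancel, so it does not involve \<open>B\<close>.\<close>

lemma total_size:
  "N * ((D - 1) * M + 3 * T + 2 * D - 1) + (\<Sum>\<theta><T. \<delta> \<theta>) + (\<Sum>c<N. \<Sum>d<D. if ok c d then 1 else 0) +
     2 * sum_list (map item_size ilist) =
   sum_list (map (\<lambda>b. Suc (capacity b)) blist) + sum_list (map (\<lambda>i. Suc (item_size i)) ilist)"
proof -
  let ?ok = "\<Sum>c<N. \<Sum>d<D. if ok c d then 1 else (0 :: nat)"
  let ?H = "sum_list (map high ilist)" and ?l = "sum_list (map low ilist)"
  have Suc_sum: "sum_list (map (\<lambda>i. Suc (F i)) xs) = length xs + sum_list (map F xs)" for F :: "'b \<Rightarrow> nat" and xs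
    by (induction xs) auto
  have size: "sum_list (map item_size xs) = sum_list (map high xs) * L + sum_list (map low xs)" for xs
    by (induction xs) (auto simp: item_size_def algebra_simps)
  have low: "?l + (\<Sum>\<theta><T. 0 + \<delta> \<theta>) = N * (M + 1) + N * T"
  proof -
    have "(\<Sum>j<D. low (Cell c j)) = M + 1" for c
      using D by (simp add: sum.delta)
    then have "?l = N * (M + 1) + (\<Sum>\<theta><T. N - \<delta> \<theta>)"
      unfolding sum_ilist by simp
    moreover have "(\<Sum>\<theta><T. N - \<delta> \<theta>) + (\<Sum>\<theta><T. \<delta> \<theta>) = (\<Sum>\<theta><T. N)"
      unfolding sum.distrib[symmetric] using \<delta> by (intro sum.cong) auto
    ultimately show ?thesis by (simp add: mult.commute)
  qed
  have slots: "(\<Sum>d<D. \<Sum>\<theta><T. slots d \<theta>) = 2 * T"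
  proof -
    have "(\<Sum>\<theta><T. \<Sum>d<D. slots d \<theta>) = (\<Sum>\<theta><T. 2)"
      by (intro sum.cong refl) (simp add: slots_def sum.distrib src tgt)
    then show ?thesis by (subst sum.swap) simp
  qed
  have "(\<Sum>d<D. Low (c, d)) = 2 * T + D * M + (\<Sum>d<D. if ok c d then 1 else 0)" for c
    by (simp add: Low_def sum.distrib slots)
  then have "(\<Sum>c<N. \<Sum>d<D. Low (c, d)) = N * (2 * T + D * M) + ?ok"
    by (simp add: sum.distrib)
  then have cap: "(\<Sum>c<N. \<Sum>d<D. capacity (c, d)) = ?H * L + (N * (2 * T + D * M) + ?ok)"
    by (simp add: capacity_def sum.distrib flip: sum_High_eq sum_distrib_right)
  have "length blist = N * D"
    by (simp add: blist_def length_concat comp_def sum_list_triv)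
  then have "sum_list (map (\<lambda>b. Suc (capacity b)) blist) = N * D + (?H * L + (N * (2 * T + D * M) + ?ok))"
    using cap by (simp add: Suc_sum sum_blist)
  moreover have "sum_list (map (\<lambda>i. Suc (item_size i)) ilist) = N * D + 2 * N * T + ?H * L + ?l"
    by (simp add: Suc_sum size length_ilist)
  moreover have "N * ((D - 1) * M + 3 * T + 2 * D - 1) + N * (M + 1) + N * T =
      N * D + N * (2 * T + D * M) + N * D + 2 * N * T"
  proof -
    obtain D' where "D = Suc D'" using D gr0_implies_Suc by blast
    then show ?thesis by (simp add: algebra_simps)
  qed
  ultimately show ?thesis
    using low size[of ilist] by simp
qed


section \<open>From a choice to a packing\<close>

definition fits :: "(item \<Rightarrow> nat \<times> nat) \<Rightarrow> bool" where
  "fits a \<longleftrightarrow> (\<forall>i \<in> set ilist. a i \<in> set blist) \<and>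
     (\<forall>b \<in> set blist. (\<Sum>i | i \<in> set ilist \<and> a i = b. Suc (item_size i)) \<le> Suc (capacity b))"

lemma packable_iff_fits:
  "packable (map capacity blist) (map item_size ilist) \<longleftrightarrow> (\<exists>a. fits a)"
  using packable_map_iff[OF distinct_blist distinct_ilist] by (simp add: fits_def)

lemma sum_set_le_sum_list: "sum F (set xs) \<le> sum_list (map F xs)" for F :: "'a \<Rightarrow> nat"
  by (induction xs) (auto simp: sum.insert_if)

text \<open>The real cell token goes to the chosen tile and the dummies fill the other bins of the
  cell in order. The real token of a conflict goes to the target bin if that is chosen, and to the
  source bin otherwise. The two bins are not both chosen, so the dummy on the other side never meets
  a real cell token.\<close>

lemma fits_if_good_choice:
  assumes "good_choice f"
  shows "\<exists>a. fits a"
proof -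
  have f: "f c < D" "ok c (f c)" if "c < N" for c
    using assms that by (auto simp: good_choice_def)
  have free: "f (c + \<delta> \<theta>) \<noteq> tgt \<theta>" if "\<theta> < T" "c + \<delta> \<theta> < N" "f c = src \<theta>" for \<theta> c
    using assms that by (auto simp: good_choice_def)
  \<comment> \<open>Below \<open>\<delta> \<theta>\<close> there is no source cell and from
    \<open>N\<close> on no target cell. In between, real token and dummy take opposite
    sides.\<close>
  define at_tgt where "at_tgt = (\<lambda>\<theta> x b. x < \<delta> \<theta> \<or> x < N \<and> (f x = tgt \<theta>) = b)"
  define a where "a = (\<lambda>i. case i of
      Cell c j \<Rightarrow> (c, if j = 0 then f c else if j \<le> f c then j - 1 else j)
    | Conf \<theta> x b \<Rightarrow> if at_tgt \<theta> x b then (x, tgt \<theta>) else (x - \<delta> \<theta>, src \<theta>))"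
  have "fits a"
    unfolding fits_def
  proof (intro conjI ballI)
    fix i assume i: "i \<in> set ilist"
    show "a i \<in> set blist"
    proof (cases i)
      case (Cell c j)
      then show ?thesis using i f(1)[of c] by (auto simp: set_ilist set_blist a_def)
    next
      case (Conf \<theta> x b)
      then have "\<theta> < T" "x < N + \<delta> \<theta>" using i by (auto simp: set_ilist)
      then show ?thesis
        using src[of \<theta>] tgt[of \<theta>] \<delta>[of \<theta>] Conf by (auto simp: set_blist a_def at_tgt_def)
    qed
  next
    fix b assume "b \<in> set blist"
    then obtain c d where b: "b = (c, d)" "c < N" "d < D" by (auto simp: set_blist)
    define cell where "cell = Cell c (if d = f c then 0 else if d < f c then Suc d else d)"
    define tg where "tg = (\<lambda>\<theta>. if tgt \<theta> = d then [Conf \<theta> c (c < \<delta> \<theta> \<or> f c = d)] else [])"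
    define sr where "sr = (\<lambda>\<theta>. if src \<theta> = d
      then [Conf \<theta> (c + \<delta> \<theta>) (\<not> (c + \<delta> \<theta> < N \<and> f (c + \<delta> \<theta>) = tgt \<theta>))] else [])"
    \<comment> \<open>All tokens that the bin can receive; a list suffices for an upper bound on
      their sizes.\<close>
    define S where "S = cell # concat (map (\<lambda>\<theta>. tg \<theta> @ sr \<theta>) [0..<T])"
    have "{i. i \<in> set ilist \<and> a i = b} \<subseteq> set S"
    proof
      fix i assume "i \<in> {i. i \<in> set ilist \<and> a i = b}"
      then have i: "i \<in> set ilist" "a i = b" by auto
      show "i \<in> set S"
      proof (cases i)
        case (Cell c' j)
        then have "c' = c" "d = (if j = 0 then f c else if j \<le> f c then j - 1 else j)"
          using i(2) b by (auto simp: a_def)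
        then have "i = cell" using Cell by (auto simp: cell_def split: if_splits)
        then show ?thesis by (simp add: S_def)
      next
        case (Conf \<theta> x y)
        have \<theta>: "\<theta> < T" and x: "(y \<and> x < N + \<delta> \<theta>) \<or> (\<not> y \<and> \<delta> \<theta> \<le> x \<and> x < N)"
          using i(1) Conf by (auto simp: set_ilist)
        have "i \<in> set (tg \<theta> @ sr \<theta>)"
        proof (cases "at_tgt \<theta> x y")
          case True
          then have "x = c" "tgt \<theta> = d" using i(2) b Conf by (auto simp: a_def)
          then have "i \<in> set (tg \<theta>)"
            using True x Conf by (auto simp: tg_def at_tgt_def)
          then show ?thesis by simp
        next
          case False
          then have "x - \<delta> \<theta> = c" "src \<theta> = d" "\<delta> \<theta> \<le> x"
            using i(2) b Conf by (auto simp: a_def at_tgt_def)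
          then have "i \<in> set (sr \<theta>)"
            using False x Conf by (auto simp: sr_def at_tgt_def)
          then show ?thesis by simp
        qed
        then show ?thesis using \<theta> by (auto simp: S_def)
      qed
    qed
    then have "(\<Sum>i | i \<in> set ilist \<and> a i = b. Suc (item_size i)) \<le> (\<Sum>i\<in>set S. Suc (item_size i))"
      by (intro sum_mono2) auto
    also have "\<dots> \<le> sum_list (map (\<lambda>i. Suc (item_size i)) S)"
      by (rule sum_set_le_sum_list)
    also have "\<dots> = Suc (item_size cell) + (\<Sum>\<theta><T. sum_list (map (\<lambda>i. Suc (item_size i)) (tg \<theta> @ sr \<theta>)))"
      by (simp add: S_def sum_list_concat_map comp_def sum_list_upt lessThan_atLeast0)
    also have "\<dots> = (high cell * L + (\<Sum>\<theta><T. block b \<theta> * (B ^ 3) ^ \<theta> * L)) +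
        (Suc (low cell) + (\<Sum>\<theta><T. sum_list (map (\<lambda>i. Suc (low i)) (tg \<theta> @ sr \<theta>))))"
    proof -
      have "sum_list (map (\<lambda>i. Suc (item_size i)) (tg \<theta> @ sr \<theta>)) =
          block b \<theta> * (B ^ 3) ^ \<theta> * L + sum_list (map (\<lambda>i. Suc (low i)) (tg \<theta> @ sr \<theta>))"
        if "\<theta> < T" for \<theta>
        using that by (auto simp: block_def b tg_def sr_def item_size_def high_def algebra_simps)
      then show ?thesis by (simp add: item_size_def sum.distrib)
    qed
    also have "high cell * L + (\<Sum>\<theta><T. block b \<theta> * (B ^ 3) ^ \<theta> * L) = High b * L"
      by (simp add: High_def high_def cell_def block_def[of _ T] b distrib_right sum_distrib_right)
    \<comment> \<open>The chosen bin contains no dummies and uses the unit that \<open>ok\<close>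
      grants. Any other bin has at most two dummies per conflict, which \<open>M\<close>
      covers.\<close>
    also have "Suc (low cell) + (\<Sum>\<theta><T. sum_list (map (\<lambda>i. Suc (low i)) (tg \<theta> @ sr \<theta>))) \<le> Suc (Low b)"
    proof (cases "d = f c")
      case True
      have "sum_list (map (\<lambda>i. Suc (low i)) (tg \<theta> @ sr \<theta>)) = slots d \<theta>" if "\<theta> < T" for \<theta>
        using free[OF that, of c] True by (auto simp: tg_def sr_def slots_def)
      then show ?thesis
        using True f(2)[OF b(2)] by (simp add: Low_def b cell_def)
    next
      case False
      have "sum_list (map (\<lambda>i. Suc (low i)) (tg \<theta> @ sr \<theta>)) \<le> slots d \<theta> + 2" for \<theta>
        by (auto simp: tg_def sr_def slots_def)
      then have "(\<Sum>\<theta><T. sum_list (map (\<lambda>i. Suc (low i)) (tg \<theta> @ sr \<theta>))) \<le> (\<Sum>\<theta><T. slots d \<theta> + 2)"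
        by (intro sum_mono)
      also have "\<dots> = (\<Sum>\<theta><T. slots d \<theta>) + 2 * T" by (simp only: sum.distrib) simp
      finally show ?thesis
        using False by (simp add: Low_def b cell_def M_def)
    qed
    finally show "(\<Sum>i | i \<in> set ilist \<and> a i = b. Suc (item_size i)) \<le> Suc (capacity b)"
      by (simp add: capacity_def)
  qed
  then show ?thesis by blast
qed


section \<open>From a packing to a choice\<close>

text \<open>The prescribed sum of the \<open>k\<close>-th powers of the identifiers of kind
  \<open>\<theta>\<close> in bin \<open>b\<close>, for \<open>k\<close> up to 2.\<close>

definition digit :: "nat \<Rightarrow> nat \<times> nat \<Rightarrow> nat \<Rightarrow> nat" where
  "digit k b \<theta> = (if \<theta> = T then fst b ^ k else
     (if tgt \<theta> = snd b then fst b ^ k else 0) + (if src \<theta> = snd b then (fst b + \<delta> \<theta>) ^ k else 0))"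

lemma block_digits: "block b \<theta> = digit 0 b \<theta> + digit 1 b \<theta> * B + digit 2 b \<theta> * B\<^sup>2"
  by (auto simp: block_def digit_def q_def algebra_simps)

lemma power_le_square: "x \<le> 2 * N \<Longrightarrow> k \<le> 2 \<Longrightarrow> x ^ k \<le> (2 * N + 1)\<^sup>2" for x :: nat
proof -
  assume "x \<le> 2 * N" "k \<le> 2"
  then have "x ^ k \<le> (2 * N + 1) ^ k" by (intro power_mono) auto
  also have "\<dots> \<le> (2 * N + 1)\<^sup>2" using \<open>k \<le> 2\<close> by (intro power_increasing) auto
  finally show ?thesis .
qed

lemma digit_less:
  assumes "c < N" and "\<theta> \<le> T" and "k \<le> 2"
  shows "digit k (c, d) \<theta> < B"
proof -
  let ?X = "(2 * N + 1)\<^sup>2"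
  have "c ^ k \<le> ?X" using assms by (intro power_le_square) auto
  moreover have "(c + \<delta> \<theta>) ^ k \<le> ?X" if "\<theta> < T"
    using assms \<delta>[OF that] by (intro power_le_square) auto
  ultimately have "digit k (c, d) \<theta> \<le> ?X + ?X"
    using assms(2) by (auto simp: digit_def intro: add_mono trans_le_add1)
  also have "\<dots> \<le> (N * D + 2 * N * T + 2) * ?X" by (simp add: algebra_simps)
  finally show ?thesis using B by simp
qed

lemma three_digits_less:
  fixes b :: nat
  assumes "x < b" "y < b" "z < b"
  shows "x + y * b + z * b\<^sup>2 < b ^ 3"
proof -
  have "z * b\<^sup>2 + b\<^sup>2 \<le> b * b\<^sup>2" using assms(3) mult_le_mono1[of "Suc z" b "b\<^sup>2"] by simp
  moreover have "y * b + b \<le> b * b" using assms(2) mult_le_mono1[of "Suc y" b b] by simp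
  ultimately show ?thesis using assms(1) by (simp add: power2_eq_square power3_eq_cube algebra_simps)
qed

lemma kind_ident_le:
  assumes "i \<in> set ilist"
  shows "kind i \<le> T" "ident i \<le> 2 * N"
proof -
  show "kind i \<le> T" using assms by (auto simp: set_ilist)
  show "ident i \<le> 2 * N"
    using assms \<delta>[of "kind i"] by (auto simp: set_ilist)
qed

lemma sum_ident_less:
  assumes "S \<subseteq> set ilist" and "k \<le> 2"
  shows "(\<Sum>i\<in>S. ident i ^ k) < B"
proof -
  have "(\<Sum>i\<in>S. ident i ^ k) \<le> (\<Sum>i\<in>set ilist. ident i ^ k)"
    using assms(1) by (intro sum_mono2) auto
  also have "\<dots> \<le> (\<Sum>i\<in>set ilist. (2 * N + 1)\<^sup>2)"
    using kind_ident_le assms(2) by (intro sum_mono power_le_square) auto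
  also have "\<dots> = (N * D + 2 * N * T) * (2 * N + 1)\<^sup>2"
    using distinct_card[OF distinct_ilist] by (simp add: length_ilist)
  also have "\<dots> \<le> (N * D + 2 * N * T + 2) * (2 * N + 1)\<^sup>2"
    by (intro mult_le_mono1) simp
  finally show ?thesis using B by simp
qed

context
  fixes a assumes fits: "fits a"
begin

definition content :: "nat \<times> nat \<Rightarrow> item set" where
  "content b = {i. i \<in> set ilist \<and> a i = b}"

lemma content_bound: "b \<in> set blist \<Longrightarrow>
    (\<Sum>i\<in>content b. high i) * L + (\<Sum>i\<in>content b. Suc (low i)) \<le> Suc (High b * L + Low b)"
proof -
  assume "b \<in> set blist"
  then have "(\<Sum>i\<in>content b. Suc (item_size i)) \<le> Suc (capacity b)"
    using fits by (auto simp: fits_def content_def)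
  moreover have "(\<Sum>i\<in>content b. Suc (item_size i)) =
      (\<Sum>i\<in>content b. high i) * L + (\<Sum>i\<in>content b. Suc (low i))"
    unfolding sum_distrib_right sum.distrib[symmetric] by (simp add: item_size_def)
  ultimately show ?thesis by (simp add: capacity_def)
qed

lemma slots_le: "slots d \<theta> \<le> 2"
  by (simp add: slots_def)

lemma Low_less: "Suc (Low b) < L"
proof -
  have "(\<Sum>\<theta><T. slots (snd b) \<theta>) \<le> (\<Sum>\<theta><T. 2)" by (intro sum_mono slots_le)
  then show ?thesis by (simp add: Low_def L_def M_def)
qed

text \<open>As \<open>Suc (Low b)\<close> is less than \<open>L\<close>, no bin can exceed its high
  capacity. The totals are equal, so every bin attains it.\<close>

lemma content_high:
  assumes "b \<in> set blist"
  shows "(\<Sum>i\<in>content b. high i) = High b"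
proof (rule sum_mono_inv[OF _ _ assms])
  fix b assume "b \<in> set blist"
  then have "(\<Sum>i\<in>content b. high i) * L \<le> Suc (High b * L + Low b)"
    using content_bound[of b] by simp
  also have "\<dots> < Suc (High b) * L" using Low_less[of b] by simp
  finally show "(\<Sum>i\<in>content b. high i) \<le> High b"
    by (metis less_Suc_eq_le mult_less_cancel2)
next
  have "(\<Sum>b\<in>set blist. \<Sum>i\<in>content b. high i) = (\<Sum>i\<in>set ilist. high i)"
    unfolding content_def using fits by (intro sum.group) (auto simp: fits_def)
  also have "\<dots> = sum_list (map high ilist)"
    using distinct_ilist by (simp add: sum_list_distinct_conv_sum_set)
  also have "\<dots> = (\<Sum>b\<in>set blist. High b)"
    using distinct_blist by (simp add: sum_list_distinct_conv_sum_set flip: sum_High_eq sum_blist)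
  finally show "(\<Sum>b\<in>set blist. \<Sum>i\<in>content b. high i) = (\<Sum>b\<in>set blist. High b)" .
qed simp

lemma content_low:
  assumes "b \<in> set blist"
  shows "(\<Sum>i\<in>content b. Suc (low i)) \<le> Suc (Low b)"
  using content_bound[OF assms] content_high[OF assms] by simp

text \<open>Two layers of digits: base \<open>B ^ 3\<close> separates the kinds, and base
  \<open>B\<close> inside a block separates the power sums.\<close>

lemma content_digits:
  assumes c: "c < N" and d: "d < D" and "\<theta> \<le> T"
  defines "S \<equiv> {i \<in> content (c, d). kind i = \<theta>}"
  shows "card S = digit 0 (c, d) \<theta>" "(\<Sum>i\<in>S. ident i) = digit 1 (c, d) \<theta>"
    "(\<Sum>i\<in>S. (ident i)\<^sup>2) = digit 2 (c, d) \<theta>"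
proof -
  let ?S = "\<lambda>\<theta>. {i \<in> content (c, d). kind i = \<theta>}"
  have b: "(c, d) \<in> set blist" using c d by (simp add: set_blist)
  have sub: "?S \<theta> \<subseteq> set ilist" for \<theta> by (auto simp: content_def)
  have expand: "(\<Sum>i\<in>?S \<theta>. q (ident i)) =
      (\<Sum>i\<in>?S \<theta>. ident i ^ 0) + (\<Sum>i\<in>?S \<theta>. ident i ^ 1) * B + (\<Sum>i\<in>?S \<theta>. ident i ^ 2) * B\<^sup>2" for \<theta>
    unfolding q_def sum.distrib sum_distrib_right by simp
  have "(\<Sum>i\<in>content (c, d). high i) = (\<Sum>\<theta><Suc T. \<Sum>i\<in>?S \<theta>. high i)"
    using kind_ident_le(1)
    by (intro sum.group[symmetric]) (auto simp: content_def less_Suc_eq_le)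
  also have "\<dots> = (\<Sum>\<theta><Suc T. (\<Sum>i\<in>?S \<theta>. q (ident i)) * (B ^ 3) ^ \<theta>)"
    by (intro sum.cong refl) (simp add: high_def sum_distrib_right)
  finally have "(\<Sum>\<theta><Suc T. (\<Sum>i\<in>?S \<theta>. q (ident i)) * (B ^ 3) ^ \<theta>) =
      (\<Sum>\<theta><Suc T. block (c, d) \<theta> * (B ^ 3) ^ \<theta>)"
    using content_high[OF b] by (simp only: High_def)
  then have "(\<Sum>i\<in>?S \<theta>. q (ident i)) = block (c, d) \<theta>"
  proof (rule digits_unique)
    fix \<theta>
    show "(\<Sum>i\<in>?S \<theta>. q (ident i)) < B ^ 3"
      unfolding expand by (intro three_digits_less sum_ident_less[OF sub]) auto
  next
    fix \<theta> assume "\<theta> < Suc T"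
    then show "block (c, d) \<theta> < B ^ 3"
      unfolding block_digits using c by (intro three_digits_less digit_less) auto
  qed (use \<open>\<theta> \<le> T\<close> in simp)
  then have "(\<Sum>i\<in>S. ident i ^ 0) = digit 0 (c, d) \<theta> \<and> (\<Sum>i\<in>S. ident i ^ 1) = digit 1 (c, d) \<theta> \<and>
      (\<Sum>i\<in>S. ident i ^ 2) = digit 2 (c, d) \<theta>"
    unfolding expand block_digits S_def using c \<open>\<theta> \<le> T\<close>
    by (intro three_digits_unique[of _ _ B] sum_ident_less[OF sub] digit_less) simp_all
  then show "card S = digit 0 (c, d) \<theta>" "(\<Sum>i\<in>S. ident i) = digit 1 (c, d) \<theta>"
    "(\<Sum>i\<in>S. (ident i)\<^sup>2) = digit 2 (c, d) \<theta>"
    by simp_all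
qed

text \<open>The bin has exactly one token of kind \<open>T\<close>, so the prescribed sum of
  identifiers is the identifier of that token.\<close>

lemma content_cell:
  assumes "c < N" and "d < D" and "Cell c' j \<in> content (c, d)"
  shows "c' = c"
proof -
  let ?S = "{i \<in> content (c, d). kind i = T}"
  have "card ?S = 1" "(\<Sum>i\<in>?S. ident i) = c"
    using content_digits(1,2)[OF assms(1,2), of T] by (simp_all add: digit_def)
  moreover have "Cell c' j \<in> ?S" using assms(3) by simp
  ultimately have "?S = {Cell c' j}" by (metis card_1_singletonE singletonD)
  with \<open>(\<Sum>i\<in>?S. ident i) = c\<close> show ?thesis by simp
qed

text \<open>There is one token per role of \<open>d\<close> in the conflict. If \<open>d\<close> has
  both roles, \<open>pair_of_sums\<close> tells the two tokens apart.\<close>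

lemma content_conf:
  assumes c: "c < N" and d: "d < D" and \<theta>: "\<theta> < T"
  shows "tgt \<theta> = d \<Longrightarrow> \<exists>y. Conf \<theta> c y \<in> content (c, d)"
    and "src \<theta> = d \<Longrightarrow> \<exists>y. Conf \<theta> (c + \<delta> \<theta>) y \<in> content (c, d)"
proof -
  let ?S = "{i \<in> content (c, d). kind i = \<theta>}"
  have \<theta>_le: "\<theta> \<le> T" "\<theta> \<noteq> T" using \<theta> by simp_all
  note S = content_digits[OF c d \<theta>_le(1)]
  have conf: "\<exists>y. Conf \<theta> x y \<in> content (c, d)" if "i \<in> ?S" "ident i = x" for i x
  proof (cases i)
    case (Conf \<theta>' x' y)
    then show ?thesis using that by auto
  qed (use that \<theta> in simp)
  have "(tgt \<theta> = d \<longrightarrow> (\<exists>i \<in> ?S. ident i = c)) \<and> (src \<theta> = d \<longrightarrow> (\<exists>i \<in> ?S. ident i = c + \<delta> \<theta>))"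
  proof (cases "tgt \<theta> = d \<and> src \<theta> = d")
    case True
    then have "card ?S = 2" using S(1) \<theta>_le(2) by (simp add: digit_def)
    then obtain i i' where i: "?S = {i, i'}" "i \<noteq> i'" by (auto simp: card_2_iff)
    have "ident i + ident i' = c + (c + \<delta> \<theta>)" "(ident i)\<^sup>2 + (ident i')\<^sup>2 = c\<^sup>2 + (c + \<delta> \<theta>)\<^sup>2"
      using S(2,3) i True \<theta>_le(2) by (simp_all add: digit_def)
    moreover have "i \<in> ?S" "i' \<in> ?S" unfolding i(1) by simp_all
    ultimately show ?thesis using pair_of_sums by blast
  next
    case False
    show ?thesis
    proof (cases "tgt \<theta> = d \<or> src \<theta> = d")
      case True
      with False have "card ?S = 1"
        unfolding S(1) using \<theta>_le(2) by (elim disjE) (simp_all add: digit_def)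
      then obtain i where i: "?S = {i}" by (rule card_1_singletonE)
      then have "i \<in> ?S" by simp
      moreover have "ident i = digit 1 (c, d) \<theta>" using S(2) unfolding i by simp
      then have "ident i = (if tgt \<theta> = d then c else c + \<delta> \<theta>)"
        using True False \<theta>_le(2) by (elim disjE) (simp_all add: digit_def)
      ultimately show ?thesis using True False by (metis (no_types, lifting))
    qed simp
  qed
  then show "tgt \<theta> = d \<Longrightarrow> \<exists>y. Conf \<theta> c y \<in> content (c, d)"
    and "src \<theta> = d \<Longrightarrow> \<exists>y. Conf \<theta> (c + \<delta> \<theta>) y \<in> content (c, d)"
    using conf by blast+
qed

lemma card_content:
  assumes "c < N" and "d < D"
  shows "card (content (c, d)) = 1 + (\<Sum>\<theta><T. slots d \<theta>)"
proof -
  have "card (content (c, d)) = (\<Sum>i\<in>content (c, d). 1)" by simp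
  also have "\<dots> = (\<Sum>\<theta><Suc T. \<Sum>i\<in>{i \<in> content (c, d). kind i = \<theta>}. 1)"
    using kind_ident_le(1)
    by (intro sum.group[symmetric]) (auto simp: content_def less_Suc_eq_le)
  also have "\<dots> = (\<Sum>\<theta><Suc T. digit 0 (c, d) \<theta>)"
    using content_digits(1)[OF assms] by (intro sum.cong refl) auto
  also have "\<dots> = (\<Sum>\<theta><T. slots d \<theta>) + 1"
  proof -
    have "digit 0 (c, d) \<theta> = slots d \<theta>" if "\<theta> < T" for \<theta>
      using that by (simp add: digit_def slots_def)
    then show ?thesis by (simp add: digit_def)
  qed
  finally show ?thesis by simp
qed

text \<open>The number of tokens uses up the slots, so the low weights in the bin sum up to at most
  \<open>M\<close>, or \<open>M + 1\<close> if \<open>ok c d\<close>. The real cell token alone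
  weighs \<open>M + 1\<close>.\<close>

lemma content_chosen:
  assumes c: "c < N" and d: "d < D" and cell: "Cell c 0 \<in> content (c, d)"
  shows "ok c d" "Conf \<theta> x y \<in> content (c, d) \<Longrightarrow> y"
proof -
  let ?S = "content (c, d)"
  have fin: "finite ?S" by (simp add: content_def)
  have "(\<Sum>i\<in>?S. Suc (low i)) = card ?S + (\<Sum>i\<in>?S. low i)"
    using sum.distrib[of "\<lambda>_. 1" low ?S] by simp
  then have "(\<Sum>i\<in>?S. low i) \<le> M + (if ok c d then 1 else 0)"
    using content_low[of "(c, d)"] card_content[OF c d] c d by (simp add: set_blist Low_def)
  moreover have "(\<Sum>i\<in>?S. low i) = M + 1 + (\<Sum>i\<in>?S - {Cell c 0}. low i)"
    using fin cell by (simp add: sum.remove)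
  ultimately have "ok c d" "(\<Sum>i\<in>?S - {Cell c 0}. low i) = 0" by (auto split: if_splits)
  then show "ok c d" by simp
  assume "Conf \<theta> x y \<in> ?S"
  then have "low (Conf \<theta> x y) = 0"
    using \<open>(\<Sum>i\<in>?S - {Cell c 0}. low i) = 0\<close> fin by (simp add: sum_eq_0_iff del: low.simps)
  then show y by (simp split: if_splits)
qed

text \<open>If both bins of a conflict were chosen, each would contain a token with identifier
  \<open>c + \<delta> \<theta>\<close>, which would have to be the real one. There is only one such
  token.\<close>

lemma good_choice_of_fits: "good_choice (\<lambda>c. snd (a (Cell c 0)))"
proof -
  let ?f = "\<lambda>c. snd (a (Cell c 0))"
  have cell: "?f c < D \<and> Cell c 0 \<in> content (c, ?f c)" if c: "c < N" for c
  proof -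
    obtain c' d where a: "a (Cell c 0) = (c', d)" by (cases "a (Cell c 0)")
    have i: "Cell c 0 \<in> set ilist" using c D by (auto simp: set_ilist)
    then have "a (Cell c 0) \<in> set blist" using fits by (simp add: fits_def)
    then have "(c', d) \<in> set blist" unfolding a .
    then have bin: "c' < N" "d < D" by (auto simp: set_blist)
    have "Cell c 0 \<in> content (c', d)" using a i by (simp add: content_def)
    moreover from this have "c = c'" using content_cell[OF bin] by simp
    ultimately show ?thesis unfolding a using bin by simp
  qed
  show ?thesis
    unfolding good_choice_def
  proof (intro conjI allI impI notI)
    fix c assume "c < N"
    note f = cell[OF this]
    show "?f c < D" using f by (rule conjunct1)
    show "ok c (?f c)" by (rule content_chosen(1)[OF \<open>c < N\<close> conjunct1[OF f] conjunct2[OF f]])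
  next
    fix \<theta> c assume \<theta>: "\<theta> < T" and c: "c + \<delta> \<theta> < N"
      and f: "?f c = src \<theta> \<and> ?f (c + \<delta> \<theta>) = tgt \<theta>"
    let ?c = "c + \<delta> \<theta>"
    have "c < N" using c by simp
    note bins = conjunct1[OF cell[OF \<open>c < N\<close>]] conjunct1[OF cell[OF c]]
    note cells = conjunct2[OF cell[OF \<open>c < N\<close>]] conjunct2[OF cell[OF c]]
    obtain y where y: "Conf \<theta> ?c y \<in> content (c, ?f c)"
      using content_conf(2)[OF \<open>c < N\<close> bins(1) \<theta> conjunct1[OF f, symmetric]] by (rule exE)
    obtain y' where y': "Conf \<theta> ?c y' \<in> content (?c, ?f ?c)"
      using content_conf(1)[OF c bins(2) \<theta> conjunct2[OF f, symmetric]] by (rule exE)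
    have y
      by (rule content_chosen(2)[OF \<open>c < N\<close> bins(1) cells(1) y])
    moreover have y'
      by (rule content_chosen(2)[OF c bins(2) cells(2) y'])
    ultimately have "y = y'" by simp
    moreover have "a (Conf \<theta> ?c y) = (c, ?f c)" "a (Conf \<theta> ?c y') = (?c, ?f ?c)"
      using y y' by (simp_all only: content_def mem_Collect_eq)
    ultimately have "(c, ?f c) = (?c, ?f ?c)" by (simp only:)
    then have "c = ?c" by (rule Pair_inject)
    then show False using \<delta>[OF \<theta>] by simp
  qed
qed

end

theorem packable_iff_good_choice:
  "packable (map capacity blist) (map item_size ilist) \<longleftrightarrow> (\<exists>f. good_choice f)"
  using packable_iff_fits fits_if_good_choice good_choice_of_fits by blast

end

section \<open>Tableaux of nondeterministic computations\<close>

text \<open>The label of a row is the transition that led to it; \<open>Start\<close> belongs to row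
  0 and \<open>Halt\<close> to the idle rows after acceptance.\<close>

datatype label = Start | Halt | Trans transition

text \<open>The Boolean marks the head column and is handed down from row 0. The lists have one
  symbol per tape, in the order left, own and right column.\<close>

datatype tile = Border label | Inner bool label "nat list" "nat list" "nat list"

text \<open>What is prescribed for a cell of the tableau: the last cell is \<open>Final\<close>, the
  remaining cells below row 0 are \<open>Free\<close>, and the other zones make up row 0.\<close>

datatype zone = Free | Edge | Blank | Head | Bit bool | Final

text \<open>Rows of the tableau are configurations in coordinates relative to the heads. Row 0 shows the
  initial tapes shifted by one cell, such that the head column is blank for every input. An inner
  tile carries the transition that leads to its row, and the symbols after writing in its column
  and in the two neighbouring ones.\<close>

definition zones :: "nat \<Rightarrow> bool list \<Rightarrow> zone list" where
  "zones R x = [Edge] @ replicate R Blank @ [Head] @ map Bit x @ replicate R Blank @ [Edge] @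
     replicate ((R - 2) * (2 * R + length x + 3) + (2 * R + length x + 2)) Free @ [Final]"

text \<open>The rows of width \<open>W\<close> are concatenated, so \<open>P\<close> also relates
  the end of a row to the beginning of the next one. There \<open>horizontal\<close> meets two
  border tiles, which it always accepts.\<close>

definition is_tiling :: "nat \<Rightarrow> zone list \<Rightarrow> 'a set \<Rightarrow> ('a \<Rightarrow> 'a \<Rightarrow> bool) \<Rightarrow> ('a \<Rightarrow> 'a \<Rightarrow> bool) \<Rightarrow>
    (zone \<Rightarrow> 'a \<Rightarrow> bool) \<Rightarrow> (nat \<Rightarrow> 'a) \<Rightarrow> bool" where
  "is_tiling W zs A P Q ok f \<longleftrightarrow>
     (\<forall>c < length zs. f c \<in> A \<and> ok (zs ! c) (f c)) \<and>
     (\<forall>c. c + 1 < length zs \<longrightarrow> P (f c) (f (c + 1))) \<and>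
     (\<forall>c. c + W < length zs \<longrightarrow> Q (f c) (f (c + W)))"

lemma length_zones:
  assumes "2 \<le> R"
  shows "length (zones R x) = R * (2 * R + length x + 3)"
proof -
  obtain R' where "R = R' + 2" using assms by (metis le_add_diff_inverse2)
  then show ?thesis by (simp add: zones_def algebra_simps)
qed

lemma nth_zones:
  fixes R x
  defines "W \<equiv> 2 * R + length x + 3"
  assumes "2 \<le> R" and "c < R * W"
  shows "zones R x ! c =
    (if c = 0 \<or> c = W - 1 then Edge
     else if c = R + 1 then Head
     else if R + 2 \<le> c \<and> c < R + 2 + length x then Bit (x ! (c - R - 2))
     else if c < W then Blank
     else if c = R * W - 1 then Final else Free)"
proof -
  obtain R' where R': "R = R' + 2" using assms(2) by (metis le_add_diff_inverse2)
  define row where "row = [Edge] @ replicate R Blank @ [Head] @ map Bit x @ replicate R Blank @ [Edge]"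
  have zones: "zones R x = row @ replicate (R' * W + (W - 1)) Free @ [Final]"
  proof -
    have "(R - 2) * (2 * R + length x + 3) + (2 * R + length x + 2) = R' * W + (W - 1)"
      by (simp add: W_def R')
    then show ?thesis by (simp only: zones_def row_def append_assoc)
  qed
  have len: "length row = W" by (simp add: row_def W_def)
  have RW: "R * W = W + (R' * W + (W - 1)) + 1" by (simp add: R' W_def algebra_simps)
  show ?thesis
  proof (cases "c < W")
    case True
    then have "zones R x ! c = row ! c" by (simp add: zones nth_append len)
    also have "\<dots> = (if c = 0 \<or> c = W - 1 then Edge
     else if c = R + 1 then Head
     else if R + 2 \<le> c \<and> c < R + 2 + length x then Bit (x ! (c - R - 2)) else Blank)"
    proof (cases c)
      case 0
      then show ?thesis by (simp add: row_def)
    next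
      case (Suc c')
      have "row ! c = (replicate R Blank @ [Head] @ map Bit x @ replicate R Blank @ [Edge]) ! c'"
        by (simp add: row_def Suc)
      also have "\<dots> = (if c' < R then Blank else if c' = R then Head
          else if c' - R - 1 < length x then Bit (x ! (c' - R - 1))
          else if c' - R - 1 - length x < R then Blank else Edge)"
        using True Suc by (simp add: nth_append nth_Cons' W_def)
      finally show ?thesis using True Suc by (auto simp: W_def)
    qed
    finally show ?thesis using True by simp
  next
    case False
    then have "zones R x ! c = (replicate (R' * W + (W - 1)) Free @ [Final]) ! (c - W)"
      by (simp add: zones nth_append len)
    also have "\<dots> = (if c - W < R' * W + (W - 1) then Free else Final)"
      using False assms(3) RW by (auto simp: nth_append)
    also have "\<dots> = (if c = R * W - 1 then Final else Free)"
      using False assms(3) RW by auto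
    finally show ?thesis using False by (simp add: W_def)
  qed
qed

lemma nth_zones_ge:
  fixes R x
  defines "W \<equiv> 2 * R + length x + 3"
  assumes "2 \<le> R" and "c < R * W" and "W \<le> c"
  shows "zones R x ! c = (if c = R * W - 1 then Final else Free)"
proof -
  have "c \<noteq> 0" "c \<noteq> W - 1" "c \<noteq> R + 1" "\<not> c < R + 2 + length x" "\<not> c < W"
    using assms(4) by (simp_all add: W_def)
  then show ?thesis
    using nth_zones[OF assms(2), of c x] assms(3) unfolding W_def by simp
qed

section \<open>Configurations in head coordinates\<close>

text \<open>If the head of tape \<open>\<tau>\<close> moves right, the tape moves left in head
  coordinates, so the new symbol comes from the right neighbour \<open>c\<close>.\<close>

definition select :: "nat \<Rightarrow> (nat \<Rightarrow> int) \<Rightarrow> nat list \<Rightarrow> nat list \<Rightarrow> nat list \<Rightarrow> nat list" where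
  "select k mv a b c = map (\<lambda>\<tau>. (if mv \<tau> = 1 then c else if mv \<tau> = -1 then a else b) ! \<tau>) [0..<k]"

definition rel :: "config \<Rightarrow> int \<Rightarrow> nat list" where
  "rel c i = map (\<lambda>A. fst A (snd A + i)) (snd c)"

text \<open>The tapes after writing but before moving, still in the coordinates of the old
  heads.\<close>

definition written :: "config \<Rightarrow> (nat \<times> int) list \<Rightarrow> int \<Rightarrow> nat list" where
  "written c as i = (if i = 0 then map fst as else rel c i)"

text \<open>\<open>Start\<close> acts as a move of all heads to the right, which undoes the shift of
  row 0.\<close>

fun move :: "label \<Rightarrow> nat \<Rightarrow> int" where
  "move Start \<tau> = 1"
| "move Halt \<tau> = 0"
| "move (Trans (q, rs, q', as)) \<tau> = snd (as ! \<tau>)"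

locale tableau_encoding =
  fixes M :: turing_machine
  assumes M: "turing_machine M"
begin

definition k :: nat where "k = tm_tapes M"

definition blank :: "nat list" where "blank = replicate k 0"

fun next_state :: "label \<Rightarrow> nat" where
  "next_state Start = tm_start M"
| "next_state Halt = tm_final M"
| "next_state (Trans (q, rs, q', as)) = q'"

fun follows :: "label \<Rightarrow> label \<Rightarrow> bool" where
  "follows l Start \<longleftrightarrow> False"
| "follows l Halt \<longleftrightarrow> next_state l = tm_final M"
| "follows l (Trans (q, rs, q', as)) \<longleftrightarrow> next_state l = q"

text \<open>\<open>pre\<close> are the symbols of the column before writing, already in the
  coordinates of the new row. Rows labeled \<open>Halt\<close> may contain anything, since
  acceptance is settled by then.\<close>

fun writes :: "bool \<Rightarrow> label \<Rightarrow> nat list \<Rightarrow> nat list \<Rightarrow> bool" where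
  "writes h (Trans (q, rs, q', as)) pre b \<longleftrightarrow> (if h then pre = rs \<and> b = map fst as else b = pre)"
| "writes h _ pre b \<longleftrightarrow> True"

fun horizontal :: "tile \<Rightarrow> tile \<Rightarrow> bool" where
  "horizontal (Border l) (Border l') \<longleftrightarrow> True"
| "horizontal (Border l) (Inner h' l' a' b' c') \<longleftrightarrow> l = l' \<and> a' = blank"
| "horizontal (Inner h l a b c) (Border l') \<longleftrightarrow> l = l' \<and> c = blank"
| "horizontal (Inner h l a b c) (Inner h' l' a' b' c') \<longleftrightarrow> l = l' \<and> b = a' \<and> c = b'"

fun vertical :: "tile \<Rightarrow> tile \<Rightarrow> bool" where
  "vertical (Border l) (Border l') \<longleftrightarrow> follows l l'"
| "vertical (Inner h l a b c) (Inner h' l' a' b' c') \<longleftrightarrow>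
     h' = h \<and> follows l l' \<and> writes h l' (select k (move l) a b c) b'"
| "vertical _ _ \<longleftrightarrow> False"

fun zone_ok :: "zone \<Rightarrow> tile \<Rightarrow> bool" where
  "zone_ok Free t \<longleftrightarrow> True"
| "zone_ok Edge t \<longleftrightarrow> t = Border Start"
| "zone_ok Final t \<longleftrightarrow> t = Border Halt"
| "zone_ok Blank t \<longleftrightarrow> (\<exists>a c. t = Inner False Start a blank c)"
| "zone_ok Head t \<longleftrightarrow> (\<exists>a c. t = Inner True Start a blank c)"
| "zone_ok (Bit y) t \<longleftrightarrow> (\<exists>a c. t = Inner False Start a ((if y then 2 else 1) # replicate (k - 1) 0) c)"

definition labels :: "label set" where
  "labels = {Start, Halt} \<union> Trans ` tm_trans M"

definition columns :: "nat list set" where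
  "columns = {s. set s \<subseteq> tm_symbols M \<and> length s = k}"

definition tiles :: "tile set" where
  "tiles = Border ` labels \<union>
     (\<lambda>(h, l, a, b, c). Inner h l a b c) ` (UNIV \<times> labels \<times> columns \<times> columns \<times> columns)"

lemma trans_wf:
  assumes "(q, rs, q', as) \<in> tm_trans M"
  shows "length rs = k" "length as = k" "set as \<subseteq> tm_symbols M \<times> {-1, 0, 1}" "set rs \<subseteq> tm_symbols M"
    "q \<in> tm_states M" "q' \<in> tm_states M"
  using M assms by (auto simp: turing_machine_def k_def split: prod.splits)

lemma k_pos: "0 < k"
  using M by (simp add: turing_machine_def k_def)

lemma finite_columns: "finite columns"
  using finite_lists_length_eq[of "tm_symbols M" k] M by (simp add: columns_def turing_machine_def)

lemma finite_trans: "finite (tm_trans M)"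
proof (rule finite_subset)
  let ?A = "{s. set s \<subseteq> tm_symbols M \<times> {-1, 0, 1 :: int} \<and> length s = k}"
  show "tm_trans M \<subseteq> tm_states M \<times> columns \<times> tm_states M \<times> ?A"
  proof
    fix tr assume tr: "tr \<in> tm_trans M"
    obtain q rs q' as where "tr = (q, rs, q', as)" by (cases tr)
    then show "tr \<in> tm_states M \<times> columns \<times> tm_states M \<times> ?A"
      using trans_wf[of q rs q' as] tr by (simp add: columns_def)
  qed
  have "finite ?A"
    using M by (intro finite_lists_length_eq) (simp add: turing_machine_def)
  then show "finite (tm_states M \<times> columns \<times> tm_states M \<times> ?A)"
    using M finite_columns by (simp add: turing_machine_def)
qed

lemma finite_tiles: "finite tiles"
  by (simp add: tiles_def labels_def finite_columns finite_trans)

lemma tm_step_cases: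
  assumes "tm_step M c c'"
  obtains q' as where "(fst c, rel c 0, q', as) \<in> tm_trans M" "c' = (q', map2 tape_act as (snd c))"
proof -
  have "map tape_read (snd c) = rel c 0" by (simp add: rel_def tape_read_def)
  then show ?thesis using assms that by (auto simp: tm_step_def)
qed

lemma tm_step_intro:
  assumes "(fst c, rel c 0, q', as) \<in> tm_trans M"
  shows "tm_step M c (q', map2 tape_act as (snd c))"
proof -
  have "map tape_read (snd c) = rel c 0" by (simp add: rel_def tape_read_def)
  then show ?thesis using assms by (auto simp: tm_step_def)
qed

text \<open>Writing affects column 0 only, and each tape is then shifted against its head by at most
  one column. This is the local rule that \<open>vertical\<close> checks.\<close>

lemma rel_step:
  assumes len: "length (snd c) = k" and tr: "(q, rs, q', as) \<in> tm_trans M"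
  shows "rel (q', map2 tape_act as (snd c)) i =
    select k (move (Trans (q, rs, q', as)))
      (written c as (i - 1)) (written c as i) (written c as (i + 1))"
proof (rule nth_equalityI)
  note wf = trans_wf[OF tr]
  show "length (rel (q', map2 tape_act as (snd c)) i) =
    length (select k (move (Trans (q, rs, q', as))) (written c as (i - 1)) (written c as i)
      (written c as (i + 1)))"
    using len wf by (simp add: rel_def select_def)
  fix \<tau> assume "\<tau> < length (rel (q', map2 tape_act as (snd c)) i)"
  then have \<tau>: "\<tau> < k" using len wf by (simp add: rel_def)
  let ?A = "snd c ! \<tau>" and ?m = "snd (as ! \<tau>)"
  have m: "?m \<in> {-1, 0, 1}"
  proof -
    have "as ! \<tau> \<in> tm_symbols M \<times> {-1, 0, 1}"
      using wf(2) \<tau> by (intro subsetD[OF wf(3)] nth_mem) simp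
    then show ?thesis by (auto simp: mem_Times_iff)
  qed
  have w: "written c as j ! \<tau> = (if j = 0 then fst (as ! \<tau>) else fst ?A (snd ?A + j))" for j
    using \<tau> len wf by (simp add: written_def rel_def)
  have "rel (q', map2 tape_act as (snd c)) i ! \<tau> =
      (if ?m + i = 0 then fst (as ! \<tau>) else fst ?A (snd ?A + (?m + i)))"
    using \<tau> len wf by (simp add: rel_def tape_act_def add.assoc)
  also have "\<dots> = written c as (?m + i) ! \<tau>" by (simp add: w)
  also have "\<dots> = select k (move (Trans (q, rs, q', as)))
      (written c as (i - 1)) (written c as i) (written c as (i + 1)) ! \<tau>"
    using m \<tau> by (auto simp: select_def add.commute)
  finally show "rel (q', map2 tape_act as (snd c)) i ! \<tau> =
      select k (move (Trans (q, rs, q', as)))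
        (written c as (i - 1)) (written c as i) (written c as (i + 1)) ! \<tau>" .
qed

lemma rel_init: "rel (tm_init M x) i = word_content x i # replicate (k - 1) 0"
  by (simp add: rel_def tm_init_def k_def)

lemma select_blank: "select k mv blank blank blank = blank"
  by (rule nth_equalityI) (auto simp: select_def blank_def)

lemma select_columns:
  assumes "a \<in> columns" "b \<in> columns" "c \<in> columns"
  shows "select k mv a b c \<in> columns"
proof -
  have "s ! \<tau> \<in> tm_symbols M" if "s \<in> columns" "\<tau> < k" for s \<tau>
    using that nth_mem[of \<tau> s] by (auto simp: columns_def)
  then show ?thesis using assms by (auto simp: select_def columns_def)
qed

lemma blank_columns: "blank \<in> columns"
  using M by (auto simp: columns_def blank_def turing_machine_def)

lemma rel_init_columns: "rel (tm_init M x) i \<in> columns"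
  using M k_pos by (auto simp: rel_init columns_def turing_machine_def word_content_def)

lemma rel_init_blank: "i < 0 \<or> int (length x) \<le> i \<Longrightarrow> rel (tm_init M x) i = blank"
  using k_pos by (cases k) (auto simp: rel_init blank_def word_content_def)

lemma written_columns:
  assumes "(q, rs, q', as) \<in> tm_trans M" and "rel c i \<in> columns"
  shows "written c as i \<in> columns"
  using trans_wf[OF assms(1)] assms(2) by (auto simp: written_def columns_def)

text \<open>A light cone: after \<open>t\<close> steps a head has moved by at most \<open>t\<close>,
  so relative to it everything further than \<open>t\<close> from the word is blank. This justifies
  the blank borders of a tableau.\<close>

lemma reachable:
  assumes "(tm_step M ^^ t) (tm_init M x) c"
  shows "length (snd c) = k \<and> (\<forall>i. rel c i \<in> columns) \<and>
    (\<forall>i. i < - int t \<or> int (length x) + int t < i \<longrightarrow> rel c i = blank)"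
  using assms
proof (induction t arbitrary: c)
  case 0
  then show ?case
    using rel_init_columns rel_init_blank k_pos by (auto simp: tm_init_def k_def)
next
  case (Suc t)
  then obtain c0 where c0: "(tm_step M ^^ t) (tm_init M x) c0" "tm_step M c0 c"
    by (auto elim: relpowp_Suc_E)
  note IH = Suc.IH[OF c0(1)]
  from c0(2) obtain q' as where tr: "(fst c0, rel c0 0, q', as) \<in> tm_trans M"
    and c: "c = (q', map2 tape_act as (snd c0))"
    by (rule tm_step_cases)
  have len: "length (snd c0) = k" using IH by simp
  note step = rel_step[OF len tr]
  have "length (snd c) = k" using c IH trans_wf[OF tr] by simp
  moreover have "rel c i \<in> columns" for i
    unfolding c step using IH by (intro select_columns written_columns[OF tr]) auto
  moreover have "rel c i = blank" if "i < - int (Suc t) \<or> int (length x) + int (Suc t) < i" for i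
  proof -
    have "written c0 as j = blank" if "j \<in> {i - 1, i, i + 1}" for j
    proof -
      have "j < - int t \<or> int (length x) + int t < j"
        using that \<open>i < - int (Suc t) \<or> int (length x) + int (Suc t) < i\<close> by auto
      moreover from this have "j \<noteq> 0" by auto
      ultimately show ?thesis using IH by (auto simp: written_def)
    qed
    then show ?thesis unfolding c step by (simp add: select_blank)
  qed
  ultimately show ?case by blast
qed

lemma reachable_blank:
  assumes "(tm_step M ^^ t) (tm_init M x) c" and "i < - int t \<or> int (length x) + int t < i"
  shows "rel c i = blank"
  using reachable[OF assms(1)] assms(2) by blast

section \<open>Tableaux and accepting runs\<close>

text \<open>\<open>l r\<close> is the label of row \<open>r\<close>, and \<open>z r i\<close> are the symbols in column \<open>i\<close> after writing.\<close>

definition is_tableau :: "nat \<Rightarrow> bool list \<Rightarrow> (nat \<Rightarrow> label) \<Rightarrow> (nat \<Rightarrow> nat \<Rightarrow> nat list) \<Rightarrow> bool" where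
  "is_tableau R x l z \<longleftrightarrow> (let W = 2 * R + length x + 3 in
     l 0 = Start \<and> l (R - 1) = Halt \<and>
     (\<forall>r < R. l r \<in> labels \<and> z r 0 = blank \<and> z r (W - 1) = blank) \<and>
     (\<forall>r < R. \<forall>i < W. z r i \<in> columns) \<and>
     (\<forall>i. 0 < i \<and> i < W - 1 \<longrightarrow> z 0 i = rel (tm_init M x) (int i - int R - 2)) \<and>
     (\<forall>r. Suc r < R \<longrightarrow> follows (l r) (l (Suc r))) \<and>
     (\<forall>r i. Suc r < R \<and> 0 < i \<and> i < W - 1 \<longrightarrow>
        writes (i = R + 1) (l (Suc r)) (select k (move (l r)) (z r (i - 1)) (z r i) (z r (Suc i)))
          (z (Suc r) i)))"

text \<open>Unless the machine accepts, row \<open>r\<close>, once shifted, shows the configuration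
  after \<open>r\<close> steps and is not labeled \<open>Halt\<close>. The label of the last row
  leaves only acceptance.\<close>

lemma accepts_if_tableau:
  assumes R: "2 \<le> R" and tab: "is_tableau R x l z"
  shows "\<exists>t. accepts_in M x t"
proof -
  define W where "W = 2 * R + length x + 3"
  have l0: "l 0 = Start" "l (R - 1) = Halt"
    and lab: "\<And>r. r < R \<Longrightarrow> l r \<in> labels"
    and edge: "\<And>r. r < R \<Longrightarrow> z r 0 = blank \<and> z r (W - 1) = blank"
    and row0: "\<And>i. 0 < i \<Longrightarrow> i < W - 1 \<Longrightarrow> z 0 i = rel (tm_init M x) (int i - int R - 2)"
    and fol: "\<And>r. Suc r < R \<Longrightarrow> follows (l r) (l (Suc r))"
    and wr: "\<And>r i. Suc r < R \<Longrightarrow> 0 < i \<Longrightarrow> i < W - 1 \<Longrightarrow>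
        writes (i = R + 1) (l (Suc r)) (select k (move (l r)) (z r (i - 1)) (z r i) (z r (Suc i)))
          (z (Suc r) i)"
    using tab unfolding is_tableau_def Let_def W_def[symmetric] by blast+
  define pre where "pre = (\<lambda>r i. select k (move (l r)) (z r (i - 1)) (z r i) (z r (Suc i)))"
  have "(\<exists>t. accepts_in M x t) \<or> (l r \<noteq> Halt \<and> (\<exists>c. (tm_step M ^^ r) (tm_init M x) c \<and>
      next_state (l r) = fst c \<and> (\<forall>i. 0 < i \<and> i < W - 1 \<longrightarrow> pre r i = rel c (int i - int R - 1))))"
    if "r < R" for r
    using that
  proof (induction r)
    case 0
    have "pre 0 i = rel (tm_init M x) (int i - int R - 1)" if i: "0 < i" "i < W - 1" for i
    proof -
      have "z 0 (Suc i) = rel (tm_init M x) (int i - int R - 1)"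
      proof (cases "Suc i < W - 1")
        case True
        then show ?thesis using row0[of "Suc i"] by (simp add: algebra_simps)
      next
        case False
        then have "Suc i = W - 1" using i by simp
        then have "z 0 (Suc i) = blank" using edge[of 0] R by simp
        moreover have "rel (tm_init M x) (int i - int R - 1) = blank"
          using \<open>Suc i = W - 1\<close> by (intro rel_init_blank) (auto simp: W_def)
        ultimately show ?thesis by simp
      qed
      then have "pre 0 i = map (\<lambda>\<tau>. rel (tm_init M x) (int i - int R - 1) ! \<tau>) [0..<k]"
        by (simp add: pre_def select_def l0)
      also have "\<dots> = rel (tm_init M x) (int i - int R - 1)"
        using rel_init_columns[of x "int i - int R - 1"] map_nth[of "rel (tm_init M x) (int i - int R - 1)"]
        by (simp add: columns_def)
      finally show ?thesis .
    qed
    then show ?case using l0 by (intro disjI2) (auto simp: tm_init_def)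
  next
    case (Suc r)
    show ?case
    proof (cases "\<exists>t. accepts_in M x t")
      case False
      then obtain c where c: "(tm_step M ^^ r) (tm_init M x) c" "next_state (l r) = fst c"
        and pre: "\<And>i. 0 < i \<Longrightarrow> i < W - 1 \<Longrightarrow> pre r i = rel c (int i - int R - 1)"
        using Suc.IH Suc_lessD[OF Suc.prems] by blast
      have not_final: "fst c \<noteq> tm_final M"
        using False c(1) unfolding accepts_in_def by blast
      have "follows (l r) (l (Suc r))" using fol Suc.prems by simp
      \<comment> \<open>The state is not final, so \<open>follows\<close> excludes
        \<open>Halt\<close>; \<open>Start\<close> never follows anything.\<close>
      then obtain q rs q' as where l: "l (Suc r) = Trans (q, rs, q', as)" "q = fst c"
        using c(2) not_final by (cases "l (Suc r)") auto
      have tr: "(q, rs, q', as) \<in> tm_trans M"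
        using lab[OF Suc.prems] l by (auto simp: labels_def)
      note reach = reachable[OF c(1)]
      have w: "writes (i = R + 1) (Trans (q, rs, q', as)) (rel c (int i - int R - 1)) (z (Suc r) i)"
        if "0 < i" "i < W - 1" for i
        using wr[OF Suc.prems that] unfolding l(1) pre[OF that, unfolded pre_def] .
      from w[of "R + 1"] have "rs = rel c 0" by (simp add: W_def)
      then have tr': "(fst c, rel c 0, q', as) \<in> tm_trans M" using tr l by simp
      define c' where "c' = (q', map2 tape_act as (snd c))"
      have z: "z (Suc r) i = written c as (int i - int R - 1)" if i: "i \<le> W - 1" for i
      proof (cases "0 < i \<and> i < W - 1")
        case True
        then show ?thesis
          using w[of i] by (cases "i = R + 1") (auto simp: written_def)
      next
        case False
        then have "i = 0 \<or> i = W - 1" using i by linarith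
        then have "z (Suc r) i = blank" using edge[OF Suc.prems] by blast
        \<comment> \<open>The border columns lie outside the light cone, as \<open>r\<close> is less
          than \<open>R\<close>.\<close>
        moreover have "int i - int R - 1 < - int r \<or> int (length x) + int r < int i - int R - 1"
          using \<open>i = 0 \<or> i = W - 1\<close> Suc.prems by (auto simp: W_def)
        moreover from this have "int i - int R - 1 \<noteq> 0" by auto
        ultimately show ?thesis using reachable_blank[OF c(1)] by (simp add: written_def)
      qed
      have "pre (Suc r) i = rel c' (int i - int R - 1)" if i: "0 < i" "i < W - 1" for i
      proof -
        have "int (i - 1) = int i - 1" using i by simp
        then have "z (Suc r) (i - 1) = written c as (int i - int R - 1 - 1)"
          "z (Suc r) i = written c as (int i - int R - 1)"
          "z (Suc r) (Suc i) = written c as (int i - int R - 1 + 1)"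
          using i z[of "i - 1"] z[of i] z[of "Suc i"] by (simp_all add: algebra_simps)
        then show ?thesis
          unfolding pre_def l(1) c'_def using rel_step[OF _ tr] reach by simp
      qed
      moreover have "(tm_step M ^^ Suc r) (tm_init M x) c'"
        unfolding c'_def using c(1) tm_step_intro[OF tr'] by (rule relpowp_Suc_I)
      moreover have "next_state (l (Suc r)) = fst c'" by (simp add: l c'_def)
      ultimately show ?thesis unfolding l(1) by blast
    qed simp
  qed
  from this[of "R - 1"] show ?thesis using R l0 by simp
qed

text \<open>The \<open>t + 2\<close> rows are the start, the \<open>t\<close> transitions and at
  least one row labeled \<open>Halt\<close>; all further rows are idle.\<close>

lemma tableau_if_accepts:
  assumes acc: "accepts_in M x t" and t: "t + 2 \<le> R"
  shows "\<exists>l z. is_tableau R x l z"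
proof -
  define W where "W = 2 * R + length x + 3"
  obtain c where "(tm_step M ^^ t) (tm_init M x) c" "fst c = tm_final M"
    using acc by (auto simp: accepts_in_def)
  then obtain cf where cf: "cf 0 = tm_init M x" "\<And>i. i < t \<Longrightarrow> tm_step M (cf i) (cf (Suc i))"
    and final: "fst (cf t) = tm_final M"
    unfolding relpowp_fun_conv by auto
  have reach: "i \<le> t \<Longrightarrow> (tm_step M ^^ i) (tm_init M x) (cf i)" for i
  proof (induction i)
    case (Suc i)
    then show ?case using cf(2)[of i] by (auto intro: relpowp_Suc_I)
  qed (simp add: cf)
  have "\<exists>q' as. i < t \<longrightarrow> (fst (cf i), rel (cf i) 0, q', as) \<in> tm_trans M \<and>
      cf (Suc i) = (q', map2 tape_act as (snd (cf i)))" for i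
  proof (cases "i < t")
    case True
    from cf(2)[OF this] obtain q' as where "(fst (cf i), rel (cf i) 0, q', as) \<in> tm_trans M"
      "cf (Suc i) = (q', map2 tape_act as (snd (cf i)))"
      by (rule tm_step_cases)
    then show ?thesis by blast
  qed simp
  then obtain q as where tr: "\<And>i. i < t \<Longrightarrow> (fst (cf i), rel (cf i) 0, q i, as i) \<in> tm_trans M"
    and next_cf: "\<And>i. i < t \<Longrightarrow> cf (Suc i) = (q i, map2 tape_act (as i) (snd (cf i)))"
    by metis
  define tr_of where "tr_of = (\<lambda>i. (fst (cf i), rel (cf i) 0, q i, as i))"
  define l where "l = (\<lambda>r. if r = 0 then Start else if r \<le> t then Trans (tr_of (r - 1)) else Halt)"
  define z where "z = (\<lambda>r i. if r = 0 then rel (tm_init M x) (int i - int R - 2)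
     else if r \<le> t then written (cf (r - 1)) (as (r - 1)) (int i - int R - 1) else blank)"
  have z_columns: "z r i \<in> columns" for r i
  proof -
    have "r = 0 \<or> (\<exists>r'. r = Suc r' \<and> r' < t) \<or> r > t" by (cases r) auto
    then consider "r = 0" | r' where "r = Suc r'" "r' < t" | "r > t" by blast
    then show ?thesis
    proof cases
      case (2 r')
      then have "rel (cf r') (int i - int R - 1) \<in> columns"
        using reachable[OF reach[of r']] by simp
      then show ?thesis using 2 written_columns[OF tr[of r']] by (simp add: z_def)
    qed (auto simp: z_def rel_init_columns blank_columns)
  qed
  have z_edge: "z r i = blank" if i: "i = 0 \<or> i = W - 1" for r i
  proof -
    have "r = 0 \<or> (\<exists>r'. r = Suc r' \<and> r' < t) \<or> r > t" by (cases r) auto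
    then consider "r = 0" | r' where "r = Suc r'" "r' < t" | "r > t" by blast
    then show ?thesis
    proof cases
      case 1
      then show ?thesis using i by (auto simp: z_def W_def intro!: rel_init_blank)
    next
      case (2 r')
      have "int i - int R - 1 < - int r' \<or> int (length x) + int r' < int i - int R - 1"
        using i 2 t by (auto simp: W_def)
      moreover from this have "int i - int R - 1 \<noteq> 0" by auto
      ultimately show ?thesis
        using 2 reachable_blank[OF reach[of r']] by (simp add: z_def written_def)
    qed (simp add: z_def)
  qed
  have pre: "select k (move (l r)) (z r (i - 1)) (z r i) (z r (Suc i)) = rel (cf r) (int i - int R - 1)"
    if i: "0 < i" and r: "r \<le> t" for r i
  proof (cases r)
    case 0
    have "select k (move Start) a b (rel (tm_init M x) j) = rel (tm_init M x) j" for a b j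
      using rel_init_columns[of x j] by (auto simp: select_def columns_def intro: nth_equalityI)
    then show ?thesis using 0 by (simp add: l_def z_def cf)
  next
    case (Suc r')
    have "int (i - 1) - int R - 1 = int i - int R - 1 - 1"
      "int (Suc i) - int R - 1 = int i - int R - 1 + 1" using i by simp_all
    then show ?thesis
      using Suc r rel_step[OF _ tr[of r']] reachable[OF reach[of r']] next_cf[of r']
      by (simp add: l_def z_def tr_of_def)
  qed
  have "is_tableau R x l z"
    unfolding is_tableau_def Let_def W_def[symmetric]
  proof (intro conjI allI impI)
    show "l 0 = Start" by (simp add: l_def)
    show "l (R - 1) = Halt" using t by (simp add: l_def)
    show "l r \<in> labels" for r
      using tr[of "r - 1"] by (auto simp: l_def labels_def tr_of_def)
    show "z 0 i = rel (tm_init M x) (int i - int R - 2)" for i by (simp add: z_def)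
    fix r
    have state: "next_state (l r) = fst (cf r)" if "r \<le> t"
      using that next_cf[of "r - 1"] by (cases r) (auto simp: l_def tr_of_def tm_init_def cf)
    show "follows (l r) (l (Suc r))"
    proof (cases "Suc r \<le> t")
      case True
      then show ?thesis using state by (simp add: l_def tr_of_def)
    next
      case False
      have "next_state (l r) = tm_final M"
        using state final False by (cases "r = t") (auto simp: l_def)
      then show ?thesis using False by (simp add: l_def)
    qed
    fix i assume "Suc r < R \<and> 0 < i \<and> i < W - 1"
    then have i: "0 < i" by simp
    show "writes (i = R + 1) (l (Suc r)) (select k (move (l r)) (z r (i - 1)) (z r i) (z r (Suc i)))
        (z (Suc r) i)"
    proof (cases "Suc r \<le> t")
      case True
      then have r: "r \<le> t" by simp
      show ?thesis unfolding pre[OF i r] using True by (simp add: l_def z_def tr_of_def written_def)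
    next
      case False
      then show ?thesis by (simp add: l_def)
    qed
  qed (auto simp: z_columns z_edge)
  then show ?thesis by blast
qed


section \<open>Tableaux as tilings\<close>

definition width :: "nat \<Rightarrow> bool list \<Rightarrow> nat" where
  "width R x = 2 * R + length x + 3"

text \<open>Each inner tile carries copies of the symbols in the neighbouring columns, which reduces
  the three-column rule to a condition on two vertically adjacent tiles.\<close>

lemma tiling_if_tableau:
  assumes R: "2 \<le> R" and tab: "is_tableau R x l z"
  shows "\<exists>f. is_tiling (width R x) (zones R x) tiles horizontal vertical zone_ok f"
proof -
  define W where "W = 2 * R + length x + 3"
  have W: "width R x = W" by (simp add: width_def W_def)
  note tab' = tab[unfolded is_tableau_def Let_def, folded W_def]
  have l0: "l 0 = Start" "l (R - 1) = Halt"
    and lab: "\<And>r. r < R \<Longrightarrow> l r \<in> labels"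
    and edge: "\<And>r. r < R \<Longrightarrow> z r 0 = blank \<and> z r (W - 1) = blank"
    and cols: "\<And>r i. r < R \<Longrightarrow> i < W \<Longrightarrow> z r i \<in> columns"
    and row0: "\<And>i. 0 < i \<Longrightarrow> i < W - 1 \<Longrightarrow> z 0 i = rel (tm_init M x) (int i - int R - 2)"
    and fol: "\<And>r. Suc r < R \<Longrightarrow> follows (l r) (l (Suc r))"
    and wr: "\<And>r i. Suc r < R \<Longrightarrow> 0 < i \<Longrightarrow> i < W - 1 \<Longrightarrow>
        writes (i = R + 1) (l (Suc r)) (select k (move (l r)) (z r (i - 1)) (z r i) (z r (Suc i)))
          (z (Suc r) i)"
    using tab' by blast+
  define g where "g = (\<lambda>r i. if 0 < i \<and> i < W - 1
    then Inner (i = R + 1) (l r) (z r (i - 1)) (z r i) (z r (Suc i)) else Border (l r))"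
  define f where "f = (\<lambda>c. g (c div W) (c mod W))"
  have W_pos: "3 \<le> W" by (simp add: W_def)
  have len: "length (zones R x) = R * W" using length_zones[OF R] by (simp add: W_def)
  have split: "c div W < R \<and> c mod W < W" if "c < R * W" for c
    using that W_pos by (simp add: less_mult_imp_div_less)
  have "is_tiling W (zones R x) tiles horizontal vertical zone_ok f"
    unfolding is_tiling_def len
  proof (intro conjI allI impI)
    fix c assume c: "c < R * W"
    let ?r = "c div W" and ?i = "c mod W"
    have r: "?r < R" and i: "?i < W" using split[OF c] by simp_all
    show "f c \<in> tiles"
    proof (cases "0 < ?i \<and> ?i < W - 1")
      case True
      then have "z ?r (?i - 1) \<in> columns" "z ?r ?i \<in> columns" "z ?r (Suc ?i) \<in> columns"
        using cols[OF r] by auto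
      then show ?thesis using True lab[OF r] by (auto simp: f_def g_def tiles_def image_iff)
    next
      case False
      then show ?thesis using lab[OF r] by (auto simp: f_def g_def tiles_def)
    qed
    show "zone_ok (zones R x ! c) (f c)"
    proof (cases "c < W")
      case True
      then have f: "f c = g 0 c" by (simp add: f_def)
      show ?thesis
      proof (cases "0 < c \<and> c < W - 1")
        case False
        then have "c = 0 \<or> c = W - 1" using True by auto
        then show ?thesis
          using nth_zones[OF R, of c x] c f W_pos by (auto simp: W_def[symmetric] g_def l0)
      next
        case inner: True
        have init: "z 0 c = rel (tm_init M x) (int c - int R - 2)"
          using row0 inner by simp
        show ?thesis
        proof (cases "R + 2 \<le> c \<and> c < R + 2 + length x")
          case True
          then have "nat (int c - int R - 2) = c - R - 2" by simp
          then have "z 0 c = (if x ! (c - R - 2) then 2 else 1) # replicate (k - 1) 0"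
            using init True by (simp add: rel_init word_content_def)
          then show ?thesis
            using nth_zones[OF R, of c x] c f inner True by (auto simp: W_def[symmetric] g_def l0)
        next
          case False
          then have "z 0 c = blank"
            unfolding init by (intro rel_init_blank) auto
          then show ?thesis
            using nth_zones[OF R, of c x] c f inner False \<open>c < W\<close>
            by (auto simp: W_def[symmetric] g_def l0)
        qed
      qed
    next
      case False
      show ?thesis
      proof (cases "c = R * W - 1")
        case True
        obtain R' where R': "R = Suc R'" using R by (cases R) auto
        then have "c = W - 1 + R' * W" using True W_pos by simp
        then have "c div W = R'" "c mod W = W - 1"
          using W_pos div_mult_self1[of W "W - 1" R'] mod_mult_self1[of "W - 1" R' W] by simp_all
        then have "f c = Border Halt" using l0 R' by (simp add: f_def g_def)
        moreover have "zones R x ! c = Final"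
          using nth_zones_ge[OF R, of c x] c False True unfolding W_def[symmetric] by simp
        ultimately show ?thesis by simp
      next
        case last: False
        then have "zones R x ! c = Free"
          using nth_zones_ge[OF R, of c x] c False unfolding W_def[symmetric] by simp
        then show ?thesis by simp
      qed
    qed
  next
    fix c assume c: "c + 1 < R * W"
    let ?r = "c div W" and ?i = "c mod W"
    have r: "?r < R" and i: "?i < W" using split[of c] c by simp_all
    show "horizontal (f c) (f (c + 1))"
    proof (cases "Suc ?i = W")
      case True
      then have "(c + 1) mod W = 0" by (simp add: mod_Suc)
      then show ?thesis using True by (auto simp: f_def g_def)
    next
      case False
      then have "(c + 1) div W = ?r" "(c + 1) mod W = Suc ?i"
        using W_pos by (simp_all add: div_Suc mod_Suc)
      then have "f c = g ?r ?i" "f (c + 1) = g ?r (Suc ?i)" by (simp_all add: f_def)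
      moreover have "horizontal (g ?r ?i) (g ?r (Suc ?i))"
      proof -
        have "Suc ?i = W - 1 \<or> Suc ?i < W - 1" using False i by linarith
        then show ?thesis using edge[OF r] W_pos by (elim disjE) (auto simp: g_def)
      qed
      ultimately show ?thesis by simp
    qed
  next
    fix c assume c: "c + W < R * W"
    let ?r = "c div W" and ?i = "c mod W"
    have eq: "(c + W) div W = Suc ?r" "(c + W) mod W = ?i" using W_pos by simp_all
    have r: "Suc ?r < R" using split[OF c] unfolding eq by blast
    have f: "f c = g ?r ?i" "f (c + W) = g (Suc ?r) ?i"
      unfolding f_def eq by (rule refl)+
    show "vertical (f c) (f (c + W))"
      unfolding f using fol[OF r] wr[OF r, of ?i] by (simp add: g_def)
  qed
  then show ?thesis unfolding W by blast
qed

text \<open>The zones fix the shape of row 0, that is, which tiles are borders and where the head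
  column is; \<open>vertical\<close> hands it down. Horizontal compatibility equates the labels
  within a row and the copies of neighbouring symbols with the originals.\<close>

lemma tableau_if_tiling:
  assumes R: "2 \<le> R" and tiling: "is_tiling (width R x) (zones R x) tiles horizontal vertical zone_ok f"
  shows "\<exists>l z. is_tableau R x l z"
proof -
  define W where "W = 2 * R + length x + 3"
  have W: "width R x = W" by (simp add: width_def W_def)
  have W_pos: "3 \<le> W" by (simp add: W_def)
  have len: "length (zones R x) = R * W" using length_zones[OF R] by (simp add: W_def)
  have less: "r * W + i < R * W" if "r < R" "i < W" for r i
  proof -
    have "r * W + i < Suc r * W" using that by simp
    also have "\<dots> \<le> R * W" using that by (intro mult_le_mono1) simp
    finally show ?thesis .
  qed
  define g where "g = (\<lambda>r i. f (r * W + i))"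
  have tile: "g r i \<in> tiles" "zone_ok (zones R x ! (r * W + i)) (g r i)" if "r < R" "i < W" for r i
    using tiling less[OF that] unfolding is_tiling_def len W g_def by blast+
  have hor: "horizontal (g r i) (g r (Suc i))" if "r < R" "Suc i < W" for r i
    using tiling less[OF that] unfolding is_tiling_def len W g_def by simp
  have ver: "vertical (g r i) (g (Suc r) i)" if "Suc r < R" "i < W" for r i
  proof -
    have "r * W + i + W < R * W" using less[OF that] by (simp add: add_ac)
    then have "vertical (f (r * W + i)) (f (r * W + i + W))"
      using tiling unfolding is_tiling_def len W by blast
    moreover have "r * W + i + W = Suc r * W + i" by simp
    ultimately show ?thesis unfolding g_def by metis
  qed
  define inner where "inner = (\<lambda>i. 0 < i \<and> i < W - 1)"
  have zone0: "zones R x ! i = (if i = 0 \<or> i = W - 1 then Edge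
     else if i = R + 1 then Head
     else if R + 2 \<le> i \<and> i < R + 2 + length x then Bit (x ! (i - R - 2)) else Blank)" if "i < W" for i
    using nth_zones[OF R, of i x] that less[of 0 i] R by (simp add: W_def[symmetric])
  have init: "\<exists>a c. g 0 i = Inner (i = R + 1) Start a (rel (tm_init M x) (int i - int R - 2)) c"
    if i: "inner i" for i
  proof -
    have iW: "i < W" using i unfolding inner_def by linarith
    have ok: "zone_ok (zones R x ! i) (g 0 i)" using tile(2)[of 0 i] iW R by simp
    show ?thesis
    proof (cases "R + 2 \<le> i \<and> i < R + 2 + length x")
      case True
      then have "nat (int i - int R - 2) = i - R - 2" by simp
      then have "rel (tm_init M x) (int i - int R - 2) =
          (if x ! (i - R - 2) then 2 else 1) # replicate (k - 1) 0"
        using True by (simp add: rel_init word_content_def)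
      moreover have "zones R x ! i = Bit (x ! (i - R - 2))"
        using zone0[OF iW] i True by (auto simp: inner_def)
      ultimately show ?thesis using ok True by (simp split: if_splits)
    next
      case False
      then have "rel (tm_init M x) (int i - int R - 2) = blank"
        by (intro rel_init_blank) auto
      moreover have "zones R x ! i = (if i = R + 1 then Head else Blank)"
        using zone0[OF iW] i False by (auto simp: inner_def)
      ultimately show ?thesis using ok by (simp split: if_splits)
    qed
  qed
  have shape: "(inner i \<longrightarrow> (\<exists>l a b c. g r i = Inner (i = R + 1) l a b c)) \<and>
      (\<not> inner i \<longrightarrow> (\<exists>l. g r i = Border l))" if "r < R" "i < W" for r i
    using that
  proof (induction r)
    case 0
    have "g 0 i = Border Start" if "\<not> inner i"
    proof -
      have "i = 0 \<or> i = W - 1" using that 0 by (auto simp: inner_def)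
      then show ?thesis using tile(2)[of 0 i] zone0[of i] 0 by auto
    qed
    then show ?case using init by blast
  next
    case (Suc r)
    then have IH: "(inner i \<longrightarrow> (\<exists>l a b c. g r i = Inner (i = R + 1) l a b c)) \<and>
      (\<not> inner i \<longrightarrow> (\<exists>l. g r i = Border l))" and v: "vertical (g r i) (g (Suc r) i)"
      using ver by simp_all
    show ?case
    proof (cases "g (Suc r) i")
      case (Border l)
      then show ?thesis using IH v by (cases "inner i") auto
    next
      case (Inner h l a b c)
      then show ?thesis using IH v by (cases "inner i") auto
    qed
  qed
  define lab where "lab = (\<lambda>t. case t of Border l \<Rightarrow> l | Inner h l a b c \<Rightarrow> l)"
  define mid where "mid = (\<lambda>t. case t of Border l \<Rightarrow> blank | Inner h l a b c \<Rightarrow> b)"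
  define l where "l = (\<lambda>r. lab (g r 0))"
  define z where "z = (\<lambda>r i. mid (g r i))"
  have step: "lab (g r (Suc i)) = lab (g r i)" if r: "r < R" and i: "Suc i < W" for r i
  proof -
    \<comment> \<open>As \<open>W\<close> is at least 3, two adjacent columns of a row are never
      both borders, and all other pairs of tiles compare their labels.\<close>
    have "inner i \<or> inner (Suc i)" using i W_pos by (auto simp: inner_def)
    then show ?thesis
      using hor[OF r i] shape[OF r i] shape[OF r Suc_lessD[OF i]]
      by (cases "g r i"; cases "g r (Suc i)") (auto simp: lab_def)
  qed
  have lab: "lab (g r i) = l r" if "r < R" "i < W" for r i
    using that(2)
  proof (induction i)
    case (Suc i)
    then show ?case using step[OF that(1) Suc.prems] by simp
  qed (simp add: l_def)
  have border: "g r i = Border (l r)" if r: "r < R" and i: "i < W" "\<not> inner i" for r i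
  proof -
    obtain l' where "g r i = Border l'" using shape[OF r i(1)] i(2) by blast
    then show ?thesis using lab[OF r i(1)] by (simp add: lab_def)
  qed
  have tile_inner: "g r i = Inner (i = R + 1) (l r) (z r (i - 1)) (z r i) (z r (Suc i))"
    if r: "r < R" and i: "inner i" for r i
  proof -
    have iW: "i < W" "Suc i < W" "i - 1 < W" "Suc (i - 1) = i" using i by (auto simp: inner_def)
    obtain l' a b c where g: "g r i = Inner (i = R + 1) l' a b c" using shape[OF r iW(1)] i by blast
    then have "l' = l r" "b = z r i" using lab[OF r iW(1)] by (simp_all add: lab_def z_def mid_def)
    moreover have "a = z r (i - 1)"
      using hor[OF r, of "i - 1"] iW g by (cases "g r (i - 1)") (simp_all add: z_def mid_def)
    moreover have "c = z r (Suc i)"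
      using hor[OF r iW(2)] g by (cases "g r (Suc i)") (simp_all add: z_def mid_def)
    ultimately show ?thesis using g by simp
  qed
  have "is_tableau R x l z"
    unfolding is_tableau_def Let_def W_def[symmetric]
  proof (intro conjI allI impI)
    show "l 0 = Start" using tile(2)[of 0 0] zone0[of 0] R W_pos by (simp add: l_def lab_def)
    have "2 * W \<le> R * W" using R by (intro mult_le_mono1) simp
    then have "W \<le> R * W - 1" using W_pos by linarith
    then have "zones R x ! (R * W - 1) = Final"
      using nth_zones_ge[OF R, of "R * W - 1" x] W_pos unfolding W_def[symmetric] by simp
    moreover have "R * W - 1 = (R - 1) * W + (W - 1)" using R W_pos by (cases R) auto
    ultimately have "zones R x ! ((R - 1) * W + (W - 1)) = Final" by simp
    then have "g (R - 1) (W - 1) = Border Halt"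
      using tile(2)[of "R - 1" "W - 1"] R W_pos by simp
    then show "l (R - 1) = Halt"
      using lab[of "R - 1" "W - 1"] R W_pos by (simp add: lab_def)
    fix r assume r: "r < R"
    show "l r \<in> labels"
      using tile(1)[OF r, of 0] border[OF r, of 0] W_pos by (auto simp: inner_def tiles_def)
    show "z r 0 = blank" "z r (W - 1) = blank"
      using border[OF r, of 0] border[OF r, of "W - 1"] W_pos by (simp_all add: inner_def z_def mid_def)
    fix i assume i: "i < W"
    show "z r i \<in> columns"
    proof (cases "inner i")
      case True
      then show ?thesis using tile(1)[OF r i] tile_inner[OF r True] by (auto simp: tiles_def)
    next
      case False
      then show ?thesis using border[OF r i] by (simp add: z_def mid_def blank_columns)
    qed
  next
    fix i assume "0 < i \<and> i < W - 1"
    then have i: "inner i" by (simp add: inner_def)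
    show "z 0 i = rel (tm_init M x) (int i - int R - 2)"
      using init[OF i] by (auto simp: z_def mid_def)
  next
    fix r assume r: "Suc r < R"
    have "g r 0 = Border (l r)" "g (Suc r) 0 = Border (l (Suc r))"
      using border r W_pos by (simp_all add: inner_def)
    then show "follows (l r) (l (Suc r))"
      using ver[OF r, of 0] W_pos by simp
  next
    fix r i assume "Suc r < R \<and> 0 < i \<and> i < W - 1"
    then have r: "Suc r < R" and i: "inner i" and iW: "i < W" by (auto simp: inner_def)
    show "writes (i = R + 1) (l (Suc r)) (select k (move (l r)) (z r (i - 1)) (z r i) (z r (Suc i)))
        (z (Suc r) i)"
      using ver[OF r iW] tile_inner[OF r i] tile_inner[OF Suc_lessD[OF r] i] by simp
  qed
  then show ?thesis by blast
qed

end

text \<open>The numbered tiles and their constraints depend on the machine alone; the input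
  determines only the size of the grid and its zones. The number of rows is the time bound plus
  2.\<close>

theorem NP_tiling:
  assumes "A \<in> NP"
  obtains D :: nat and P Q :: "nat \<Rightarrow> nat \<Rightarrow> bool" and ok and p :: "nat poly" where "0 < D"
    "\<And>x :: bool list. x \<in> A \<longleftrightarrow> (\<exists>f. is_tiling (2 * (poly p (length x) + 2) + length x + 3)
       (zones (poly p (length x) + 2) x) {..<D} P Q ok f)"
proof -
  obtain M p where M: "turing_machine M" and acc: "\<And>x. x \<in> A \<longleftrightarrow> (\<exists>t. accepts_in M x t)"
    and time: "\<And>x. x \<in> A \<Longrightarrow> \<exists>t \<le> poly p (length x). accepts_in M x t"
    using assms unfolding NP_def by blast
  interpret tableau_encoding M by unfold_locales (rule M)
  obtain h where h: "bij_betw h {0..<card tiles} tiles"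
    using ex_bij_betw_nat_finite[OF finite_tiles] by blast
  define h' where "h' = inv_into {0..<card tiles} h"
  have h': "h' t < card tiles" "h (h' t) = t" if "t \<in> tiles" for t
    using that bij_betw_inv_into[OF h] bij_betw_inv_into_right[OF h]
    by (auto simp: h'_def bij_betw_def)
  show ?thesis
  proof (rule that)
    have "Border Start \<in> tiles" by (simp add: tiles_def labels_def)
    then show "0 < card tiles" using finite_tiles by (auto simp: card_gt_0_iff)
    fix x :: "bool list"
    let ?R = "poly p (length x) + 2"
    let ?W = "2 * ?R + length x + 3"
    have "x \<in> A \<longleftrightarrow> (\<exists>l z. is_tableau ?R x l z)"
      using accepts_if_tableau[of ?R x] tableau_if_accepts[of x _ ?R] acc time
      by (metis add_le_mono1 le_add2)
    also have "\<dots> \<longleftrightarrow> (\<exists>f. is_tiling ?W (zones ?R x) tiles horizontal vertical zone_ok f)"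
      using tiling_if_tableau[of ?R x] tableau_if_tiling[of ?R x] unfolding width_def
      by (metis le_add2)
    also have "\<dots> \<longleftrightarrow> (\<exists>f. is_tiling ?W (zones ?R x) {..<card tiles} (\<lambda>t u. horizontal (h t) (h u))
        (\<lambda>t u. vertical (h t) (h u)) (\<lambda>y t. zone_ok y (h t)) f)"
    proof
      assume "\<exists>f. is_tiling ?W (zones ?R x) tiles horizontal vertical zone_ok f"
      then obtain f where f: "is_tiling ?W (zones ?R x) tiles horizontal vertical zone_ok f" by blast
      have "is_tiling ?W (zones ?R x) {..<card tiles} (\<lambda>t u. horizontal (h t) (h u))
          (\<lambda>t u. vertical (h t) (h u)) (\<lambda>y t. zone_ok y (h t)) (\<lambda>c. h' (f c))"
        using f h' unfolding is_tiling_def by simp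
      then show "\<exists>f. is_tiling ?W (zones ?R x) {..<card tiles} (\<lambda>t u. horizontal (h t) (h u))
        (\<lambda>t u. vertical (h t) (h u)) (\<lambda>y t. zone_ok y (h t)) f" by blast
    next
      assume "\<exists>f. is_tiling ?W (zones ?R x) {..<card tiles} (\<lambda>t u. horizontal (h t) (h u))
        (\<lambda>t u. vertical (h t) (h u)) (\<lambda>y t. zone_ok y (h t)) f"
      then obtain f where f: "is_tiling ?W (zones ?R x) {..<card tiles} (\<lambda>t u. horizontal (h t) (h u))
        (\<lambda>t u. vertical (h t) (h u)) (\<lambda>y t. zone_ok y (h t)) f" by blast
      have "h t \<in> tiles" if "t < card tiles" for t
        using that h by (auto simp: bij_betw_def)
      then have "is_tiling ?W (zones ?R x) tiles horizontal vertical zone_ok (\<lambda>c. h (f c))"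
        using f unfolding is_tiling_def by simp
      then show "\<exists>f. is_tiling ?W (zones ?R x) tiles horizontal vertical zone_ok f" by blast
    qed
    finally show "x \<in> A \<longleftrightarrow> (\<exists>f. is_tiling ?W (zones ?R x) {..<card tiles} (\<lambda>t u. horizontal (h t) (h u))
        (\<lambda>t u. vertical (h t) (h u)) (\<lambda>y t. zone_ok y (h t)) f)" .
  qed
qed

section \<open>Programs that generate words\<close>

text \<open>Every emitted letter takes a step, so a time bound is also a bound on the output. This
  yields polynomial bounds on the lengths of the paths without computing their sizes.\<close>

lemma length_run_le_cost:
  assumes "\<And>j. fst (run x p s) j \<le> b" and "length x \<le> b"
  shows "length (snd (run x p s)) \<le> length (snd s) + cost p b"
  using assms(1)
proof (induction p arbitrary: s)
  case (Then p q)
  have "fst (run x p s) j \<le> b" for j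
    using Then.prems[of j] run_mono[of "run x p s" j x q] by simp
  then show ?case using Then.IH(1)[of s] Then.IH(2)[of "run x p s"] Then.prems by simp
next
  case (Rep v p)
  define m where "m = fst s v"
  have m: "m \<le> b"
    using Rep.prems[of v] run_mono[of s v x "Rep v p"] by (simp add: m_def)
  have "length (snd ((run x p ^^ i) s)) \<le> length (snd s) + i * cost p b" if "i \<le> m" for i
    using that
  proof (induction i)
    case (Suc i)
    have "fst (run x p ((run x p ^^ i) s)) j \<le> b" for j
    proof -
      have "fst ((run x p ^^ Suc i) s) j \<le> fst ((run x p ^^ m) s) j"
        using Suc.prems by (rule run_funpow_mono)
      then show ?thesis using Rep.prems[of j] by (simp add: m_def)
    qed
    from Rep.IH[OF this] Suc show ?case by simp
  qed simp
  from this[of m] have "length (snd (run x (Rep v p) s)) \<le> length (snd s) + m * cost p b"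
    by (simp add: m_def)
  also have "\<dots> \<le> length (snd s) + cost (Rep v p) b"
    using mult_le_mono[OF m, of "cost p b" "cost p b + 20"] by simp
  finally show ?case .
next
  case (Input p q)
  define g where "g = (\<lambda>b. if b then p else q)"
  define st where "st = (\<lambda>i. fold (\<lambda>b. run x (g b)) (take i x) s)"
  have step: "st (Suc i) = run x (g (x ! i)) (st i)" if "i < length x" for i
    using that by (simp add: st_def take_Suc_conv_app_nth)
  have run: "run x (Input p q) s = st (length x)"
    by (simp add: st_def g_def if_distrib[where f = "run x"])
  have "length (snd (st i)) \<le> length (snd s) + i * (cost p b + cost q b)" if "i \<le> length x" for i
    using that
  proof (induction i)
    case 0
    then show ?case by (simp add: st_def)
  next
    case (Suc i)
    have "fst (run x (g (x ! i)) (st i)) j \<le> b" for j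
      using Input.prems[of j] fold_take_mono[of x g "Suc i" x s j] step[of i] Suc.prems
      unfolding run by (simp add: st_def)
    then have "length (snd (run x (g (x ! i)) (st i))) \<le> length (snd (st i)) + cost (g (x ! i)) b"
      using Input.IH[of "st i"] by (cases "x ! i") (simp_all add: g_def)
    moreover have "cost (g (x ! i)) b \<le> cost p b + cost q b" by (simp add: g_def)
    ultimately show ?case using Suc step[of i] by simp
  qed
  from this[of "length x"]
  have "length (snd (run x (Input p q) s)) \<le> length (snd s) + length x * (cost p b + cost q b)"
    unfolding run by simp
  also have "\<dots> \<le> length (snd s) + cost (Input p q) b"
    using mult_le_mono[OF assms(2), of "cost p b + cost q b" "cost p b + cost q b + 20"] by simp
  finally show ?case .
qed simp_all

section \<open>Unary arithmetic by nested loops\<close>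

text \<open>\<open>VarN\<close> stands for counter 0, which holds the input length, and
  \<open>VarX\<close> for a counter with the index of the current cell or token.\<close>

datatype expr = Cst nat | VarN | VarX | Add expr expr | Mul expr expr

fun ev :: "expr \<Rightarrow> nat \<Rightarrow> nat \<Rightarrow> nat" where
  "ev (Cst k) n c = k"
| "ev VarN n c = n"
| "ev VarX n c = c"
| "ev (Add a b) n c = ev a n c + ev b n c"
| "ev (Mul a b) n c = ev a n c * ev b n c"

fun rep :: "nat \<Rightarrow> expr \<Rightarrow> 'a prog \<Rightarrow> 'a prog" where
  "rep c (Cst k) p = (Then p ^^ k) Nop"
| "rep c VarN p = Rep 0 p"
| "rep c VarX p = Rep c p"
| "rep c (Add a b) p = Then (rep c a p) (rep c b p)"
| "rep c (Mul a b) p = rep c a (rep c b p)"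

text \<open>Sums become sequences and products become nested loops. The counters occurring in the
  expression must stay constant meanwhile, hence the condition on \<open>p\<close>.\<close>

lemma run_rep:
  assumes "\<And>s. fst (run x p s) 0 = fst s 0 \<and> fst (run x p s) c = fst s c"
  shows "run x (rep c e p) s = (run x p ^^ ev e (fst s 0) (fst s c)) s"
  using assms
proof (induction e arbitrary: p s)
  case (Cst k)
  have "run x ((Then p ^^ k) Nop) s = (run x p ^^ k) s" for s
    by (induction k arbitrary: s) (simp_all add: funpow_swap1[of "run x p"])
  then show ?case by simp
next
  case (Add a b)
  have inv: "fst ((run x p ^^ m) s) 0 = fst s 0 \<and> fst ((run x p ^^ m) s) c = fst s c" for m
    using Add.prems by (intro funpow_invariant[where P = "\<lambda>s'. fst s' 0 = fst s 0 \<and> fst s' c = fst s c"]) auto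
  show ?case
    by (simp add: Add.IH(1)[OF Add.prems] Add.IH(2)[OF Add.prems] inv add.commute[of "ev a _ _"] funpow_add)
next
  case (Mul a b)
  have inv: "fst ((run x p ^^ m) s) 0 = fst s 0 \<and> fst ((run x p ^^ m) s) c = fst s c" for m s
    using Mul.prems by (intro funpow_invariant[where P = "\<lambda>s'. fst s' 0 = fst s 0 \<and> fst s' c = fst s c"]) auto
  have b: "run x (rep c b p) s = (run x p ^^ ev b (fst s 0) (fst s c)) s" for s
    by (rule Mul.IH(2)[OF Mul.prems])
  have "run x (rep c a (rep c b p)) s = (run x (rep c b p) ^^ ev a (fst s 0) (fst s c)) s"
    by (rule Mul.IH(1)) (simp add: b inv)
  also have "\<dots> = ((run x p ^^ ev b (fst s 0) (fst s c)) ^^ ev a (fst s 0) (fst s c)) s"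
  proof -
    have "(run x (rep c b p) ^^ m) s = ((run x p ^^ ev b (fst s 0) (fst s c)) ^^ m) s" for m
    proof (induction m)
      case (Suc m)
      let ?u = "((run x p ^^ ev b (fst s 0) (fst s c)) ^^ m) s"
      have u: "fst ?u 0 = fst s 0" "fst ?u c = fst s c"
        unfolding funpow_mult using inv by blast+
      have "(run x (rep c b p) ^^ Suc m) s = run x (rep c b p) ((run x (rep c b p) ^^ m) s)" by simp
      also have "\<dots> = (run x p ^^ ev b (fst s 0) (fst s c)) ?u"
        by (simp only: Suc b u)
      finally show ?case by simp
    qed simp
    then show ?thesis .
  qed
  finally show ?case by (simp add: funpow_mult mult.commute)
qed simp_all

lemma pvars_rep: "pvars (rep c e p) \<subseteq> {0, c} \<union> pvars p"
proof (induction e arbitrary: p)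
  case (Cst k)
  have "pvars ((Then p ^^ k) Nop) \<subseteq> pvars p" by (induction k) auto
  then show ?case by auto
next
  case (Mul a b)
  then show ?case by (fastforce dest!: subsetD)
qed auto

lemma no_input_rep: "no_input p \<Longrightarrow> no_input (rep c e p)"
proof (induction e arbitrary: p)
  case (Cst k)
  have "no_input ((Then p ^^ k) Nop)" using Cst by (induction k) auto
  then show ?case by simp
qed simp_all

fun seqp :: "'a prog list \<Rightarrow> 'a prog" where
  "seqp [] = Nop"
| "seqp (p # ps) = Then p (seqp ps)"

lemma pvars_seqp: "pvars (seqp ps) = (\<Union>p\<in>set ps. pvars p)"
  by (induction ps) auto

lemma no_input_seqp: "(\<And>p. p \<in> set ps \<Longrightarrow> no_input p) \<Longrightarrow> no_input (seqp ps)"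
  by (induction ps) auto

section \<open>Replacing letters by programs\<close>

text \<open>Reuses the description of a label word: a letter is replaced by an increment in order to
  measure the word, or by the code of a matrix row in order to print it.\<close>

fun subst :: "('a \<Rightarrow> 'b prog) \<Rightarrow> 'a prog \<Rightarrow> 'b prog" where
  "subst e Nop = Nop"
| "subst e (Inc v) = Inc v"
| "subst e (Emit a) = e a"
| "subst e (Then p q) = Then (subst e p) (subst e q)"
| "subst e (Rep v p) = Rep v (subst e p)"
| "subst e (Input p q) = Input (subst e p) (subst e q)"

lemma no_input_subst: "no_input p \<Longrightarrow> (\<And>a. no_input (e a)) \<Longrightarrow> no_input (subst e p)"
  by (induction p) auto

lemma flat_input_subst: "flat_input p \<Longrightarrow> (\<And>a. no_input (e a)) \<Longrightarrow> flat_input (subst e p)"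
  by (induction p) (auto simp: no_input_subst no_input_flat_input)

definition rows :: "('a \<Rightarrow> nat \<Rightarrow> 'b list) \<Rightarrow> 'a list \<Rightarrow> 'b list" where
  "rows h w = concat (map (\<lambda>j. h (w ! j) j) [0..<length w])"

lemma rows_snoc: "rows h (w @ [a]) = rows h w @ h a (length w)"
proof -
  have m: "map (\<lambda>j. h ((w @ [a]) ! j) j) [0..<length w] = map (\<lambda>j. h (w ! j) j) [0..<length w]"
    by (intro map_cong) (auto simp: nth_append)
  have "rows h (w @ [a]) = concat (map (\<lambda>j. h ((w @ [a]) ! j) j) [0..<length w]) @ h a (length w)"
    by (simp add: rows_def nth_append)
  then show ?thesis by (simp only: m rows_def)
qed

text \<open>Counter \<open>i\<close> counts the letters that the original program has emitted.\<close>

lemma run_subst: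
  assumes "i \<notin> pvars p"
    and e: "\<And>a s. run x (e a) s = (fst (upd i (Suc (fst s i)) s), snd s @ h a (fst s i))"
  shows "run x (subst e p) (fst (upd i (length (snd s)) s), v @ rows h (snd s)) =
    (fst (upd i (length (snd (run x p s))) (run x p s)), v @ rows h (snd (run x p s)))"
  using assms(1)
proof (induction p arbitrary: s)
  case (Inc w)
  then show ?case by (auto simp: upd_def fun_upd_twist)
next
  case (Emit a)
  then show ?case by (simp add: e rows_snoc fun_eq_iff)
next
  case (Rep w p)
  let ?c = "\<lambda>s. (fst (upd i (length (snd s)) s), v @ rows h (snd s))"
  have "(run x (subst e p) ^^ m) (?c s) = ?c ((run x p ^^ m) s)" for m
    using Rep by (induction m) auto
  moreover have "fst (?c s) w = fst s w" using Rep.prems by simp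
  ultimately show ?case by (simp only: subst.simps run.simps)
next
  case (Input p q)
  let ?c = "\<lambda>s. (fst (upd i (length (snd s)) s), v @ rows h (snd s))"
  have "fold (\<lambda>b. if b then run x (subst e p) else run x (subst e q)) y (?c s) =
      ?c (fold (\<lambda>b. if b then run x p else run x q) y s)" for y
    using Input by (induction y arbitrary: s) auto
  then show ?case by (simp only: subst.simps run.simps)
qed simp_all

section \<open>Contracts of word-generating programs\<close>

text \<open>Counters cannot be reset, so a program owns the counters in \<open>C\<close>: they are 0
  at entry and spent afterwards. Programs in sequence therefore need disjoint sets. \<open>b\<close>
  bounds the growth of each counter.\<close>

definition emits :: "bool list \<Rightarrow> 'a prog \<Rightarrow> nat set \<Rightarrow> 'a list \<Rightarrow> nat \<Rightarrow> bool" where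
  "emits x p C w b \<longleftrightarrow> (\<forall>s. fst s 0 = length x \<and> (\<forall>j \<in> C. fst s j = 0) \<longrightarrow>
     snd (run x p s) = snd s @ w \<and> fst (run x p s) 0 = length x \<and>
     (\<forall>j. j \<notin> C \<longrightarrow> fst (run x p s) j = fst s j) \<and> (\<forall>j. fst (run x p s) j \<le> fst s j + b))"

lemma emitsI:
  assumes "\<And>s. fst s 0 = length x \<Longrightarrow> (\<And>j. j \<in> C \<Longrightarrow> fst s j = 0) \<Longrightarrow> snd (run x p s) = snd s @ w"
    and "\<And>s. fst s 0 = length x \<Longrightarrow> (\<And>j. j \<in> C \<Longrightarrow> fst s j = 0) \<Longrightarrow> fst (run x p s) 0 = length x"
    and "\<And>s j. fst s 0 = length x \<Longrightarrow> (\<And>j. j \<in> C \<Longrightarrow> fst s j = 0) \<Longrightarrow> j \<notin> C \<Longrightarrow> fst (run x p s) j = fst s j"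
    and "\<And>s j. fst s 0 = length x \<Longrightarrow> (\<And>j. j \<in> C \<Longrightarrow> fst s j = 0) \<Longrightarrow> fst (run x p s) j \<le> fst s j + b"
  shows "emits x p C w b"
  using assms by (simp add: emits_def)

lemma emitsD:
  assumes "emits x p C w b" and "fst s 0 = length x" and "\<And>j. j \<in> C \<Longrightarrow> fst s j = 0"
  shows "snd (run x p s) = snd s @ w" "fst (run x p s) 0 = length x"
    "\<And>j. j \<notin> C \<Longrightarrow> fst (run x p s) j = fst s j" "\<And>j. fst (run x p s) j \<le> fst s j + b"
  using assms unfolding emits_def by blast+

lemma emits_Then:
  assumes p: "emits x p C w b" and q: "emits x q C' w' b'" and "C \<inter> C' = {}"
  shows "emits x (Then p q) (C \<union> C') (w @ w') (b + b')"
proof -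
  have *: "fst (run x p s) 0 = length x \<and> (\<forall>j \<in> C'. fst (run x p s) j = 0)"
    if "fst s 0 = length x" "\<And>j. j \<in> C \<union> C' \<Longrightarrow> fst s j = 0" for s
  proof -
    have "fst (run x p s) j = 0" if "j \<in> C'" for j
    proof -
      have "j \<notin> C" using that assms(3) by blast
      then show ?thesis using emitsD(3)[OF p] \<open>fst s 0 = length x\<close> \<open>\<And>j. j \<in> C \<union> C' \<Longrightarrow> fst s j = 0\<close> that by simp
    qed
    moreover have "fst (run x p s) 0 = length x"
      using that by (intro emitsD(2)[OF p]) auto
    ultimately show ?thesis by blast
  qed
  show ?thesis
  proof (rule emitsI)
    fix s :: "(nat \<Rightarrow> nat) \<times> 'a list" and j
    assume s: "fst s 0 = length x" "\<And>j. j \<in> C \<union> C' \<Longrightarrow> fst s j = 0"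
    note s' = conjunct1[OF *[OF s]] bspec[OF conjunct2[OF *[OF s]]]
    have sC: "\<And>j. j \<in> C \<Longrightarrow> fst s j = 0" using s(2) by blast
    show "snd (run x (Then p q) s) = snd s @ w @ w'"
      using emitsD(1)[OF p s(1) sC] emitsD(1)[OF q s'] by simp
    show "fst (run x (Then p q) s) 0 = length x"
      using emitsD(2)[OF q s'] by simp
    show "fst (run x (Then p q) s) j = fst s j" if "j \<notin> C \<union> C'"
      using emitsD(3)[OF q s', of j] emitsD(3)[OF p s(1) sC, of j] that by simp
    show "fst (run x (Then p q) s) j \<le> fst s j + (b + b')"
      using emitsD(4)[OF q s', of j] emitsD(4)[OF p s(1) sC, of j] by simp
  qed
qed

lemma emits_mono: "emits x p C w b \<Longrightarrow> b \<le> b' \<Longrightarrow> emits x p C w b'"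
  unfolding emits_def by (meson add_left_mono le_trans)

lemma emits_Nop: "emits x Nop {} [] 0"
  by (simp add: emits_def)

lemma emits_seqp:
  assumes "\<And>k. k < length ps \<Longrightarrow> emits x (ps ! k) (C k) (w k) b"
    and "\<And>k l. k < l \<Longrightarrow> l < length ps \<Longrightarrow> C k \<inter> C l = {}"
  shows "emits x (seqp ps) (\<Union>k<length ps. C k) (concat (map w [0..<length ps])) (length ps * b)"
  using assms
proof (induction ps arbitrary: C w)
  case Nil
  then show ?case by (simp add: emits_Nop)
next
  case (Cons p ps)
  have IH: "emits x (seqp ps) (\<Union>k<length ps. C (Suc k)) (concat (map (\<lambda>k. w (Suc k)) [0..<length ps]))
      (length ps * b)"
  proof (rule Cons.IH)
    show "emits x (ps ! k) (C (Suc k)) (w (Suc k)) b" if "k < length ps" for k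
      using Cons.prems(1)[of "Suc k"] that by simp
    show "C (Suc k) \<inter> C (Suc l) = {}" if "k < l" "l < length ps" for k l
      using Cons.prems(2)[of "Suc k" "Suc l"] that by simp
  qed
  have p: "emits x p (C 0) (w 0) b" using Cons.prems(1)[of 0] by simp
  have "C 0 \<inter> (\<Union>k<length ps. C (Suc k)) = {}"
    using Cons.prems(2)[of 0] by auto
  from emits_Then[OF p IH this]
  have "emits x (Then p (seqp ps)) (C 0 \<union> (\<Union>k<length ps. C (Suc k)))
      (w 0 @ concat (map (\<lambda>k. w (Suc k)) [0..<length ps])) (b + length ps * b)" .
  moreover have "C 0 \<union> (\<Union>k<length ps. C (Suc k)) = (\<Union>k<length (p # ps). C k)"
    by (auto simp: lessThan_Suc_eq_insert_0)
  moreover have "map w [0..<length (p # ps)] = w 0 # map (\<lambda>k. w (Suc k)) [0..<length ps]"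
    by (simp add: upt_conv_Cons map_Suc_upt[symmetric] comp_def del: upt_Suc)
  ultimately show ?case by simp
qed

lemma run_subst_emits:
  fixes p :: "'a prog" and e :: "'a \<Rightarrow> 'b prog" and s :: "(nat \<Rightarrow> nat) \<times> 'b list"
  assumes p: "emits x p C w b" and i: "i \<notin> pvars p"
    and e: "\<And>a s. run x (e a) s = (fst (upd i (Suc (fst s i)) s), snd s @ h a (fst s i))"
    and s: "fst s 0 = length x" "\<And>j. j \<in> insert i C \<Longrightarrow> fst s j = 0"
  shows "run x (subst e p) s = (fst (upd i (length w) (run x p (fst s, []))), snd s @ rows h w)"
proof -
  define s0 where "s0 = (fst s, [] :: 'a list)"
  have w: "snd (run x p s0) = w"
    using emitsD(1)[OF p, of s0] s by (simp add: s0_def)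
  have init: "(fst (upd i (length (snd s0)) s0), snd s @ rows h (snd s0)) = s"
    using s(2)[of i] by (simp add: s0_def rows_def prod_eq_iff fun_eq_iff)
  show ?thesis
    using run_subst[where i = i and p = p and x = x and e = e and h = h, OF i e,
        where s = s0 and v = "snd s"]
    unfolding init w unfolding s0_def .
qed

lemma emits_subst:
  fixes p :: "'a prog" and e :: "'a \<Rightarrow> 'b prog"
  assumes p: "emits x p C w b" and i: "i \<notin> C" "i \<noteq> 0" "i \<notin> pvars p"
    and e: "\<And>a s. run x (e a) s = (fst (upd i (Suc (fst s i)) s), snd s @ h a (fst s i))"
  shows "emits x (subst e p) (insert i C) (rows h w) (b + length w)"
proof (rule emitsI)
  fix s :: "(nat \<Rightarrow> nat) \<times> 'b list" and j
  assume s: "fst s 0 = length x" "\<And>j. j \<in> insert i C \<Longrightarrow> fst s j = 0"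
  note run = run_subst_emits[where h = h, OF p i(3) e s]
  let ?s = "(fst s, [] :: 'a list)"
  have s': "fst ?s 0 = length x" "\<And>j. j \<in> C \<Longrightarrow> fst ?s j = 0" using s by simp_all
  show "snd (run x (subst e p) s) = snd s @ rows h w" using run by simp
  show "fst (run x (subst e p) s) 0 = length x"
    using run i emitsD(2)[OF p s'] by simp
  show "fst (run x (subst e p) s) j = fst s j" if "j \<notin> insert i C"
    using run emitsD(3)[OF p s', of j] that by simp
  show "fst (run x (subst e p) s) j \<le> fst s j + (b + length w)"
    using run emitsD(4)[OF p s', of j] by simp
qed

text \<open>The contract for loop bodies: all counters are left unchanged, and the word may depend
  on the input length and on the index in \<open>c\<close>.\<close>

definition outputs :: "bool list \<Rightarrow> nat \<Rightarrow> 'a prog \<Rightarrow> (nat \<Rightarrow> nat \<Rightarrow> 'a list) \<Rightarrow> bool" where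
  "outputs x c p w \<longleftrightarrow> (\<forall>s. run x p s = (fst s, snd s @ w (fst s 0) (fst s c)))"

lemma outputs_Emit: "outputs x c (Emit a) (\<lambda>_ _. [a])"
  by (simp add: outputs_def)

lemma outputs_Then: "outputs x c p v \<Longrightarrow> outputs x c q w \<Longrightarrow> outputs x c (Then p q) (\<lambda>n y. v n y @ w n y)"
  by (simp add: outputs_def)

lemma outputs_seqp:
  assumes "\<And>p. p \<in> set ps \<Longrightarrow> outputs x c (g p) (w p)"
  shows "outputs x c (seqp (map g ps)) (\<lambda>n y. concat (map (\<lambda>p. w p n y) ps))"
  using assms by (induction ps) (auto simp: outputs_def)

lemma outputs_rep: "outputs x c (rep c e (Emit a)) (\<lambda>n y. replicate (ev e n y) a)"
proof -
  have "(run x (Emit a) ^^ m) s = (fst s, snd s @ replicate m a)" for m s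
    by (induction m) (auto simp: replicate_append_same prod_eq_iff)
  then show ?thesis
    unfolding outputs_def by (subst run_rep) auto
qed

text \<open>The effect of one pass as a function, so that blocks of different zones can be joined
  into a single fold.\<close>

definition visit :: "nat \<Rightarrow> ('z \<Rightarrow> nat \<Rightarrow> nat \<Rightarrow> 'a list) \<Rightarrow> 'z \<Rightarrow>
    (nat \<Rightarrow> nat) \<times> 'a list \<Rightarrow> (nat \<Rightarrow> nat) \<times> 'a list" where
  "visit c w z s = (fst (upd c (Suc (fst s c)) s), snd s @ w z (fst s 0) (fst s c))"

lemma run_visit: "outputs x c p (w z) \<Longrightarrow> run x (Then p (Inc c)) = visit c w z"
proof
  fix s
  assume "outputs x c p (w z)"
  then have "run x p s = (fst s, snd s @ w z (fst s 0) (fst s c))"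
    unfolding outputs_def by blast
  then show "run x (Then p (Inc c)) s = visit c w z s" by (simp add: visit_def upd_def)
qed

lemma visit_0: "c \<noteq> 0 \<Longrightarrow> fst (visit c w z s) 0 = fst s 0"
  by (simp add: visit_def)

lemma fold_visit:
  assumes "c \<noteq> 0"
  shows "fold (visit c w) zs s = (fst (upd c (fst s c + length zs) s),
    snd s @ concat (map (\<lambda>j. w (zs ! j) (fst s 0) (fst s c + j)) [0..<length zs]))"
proof (induction zs rule: rev_induct)
  case Nil
  then show ?case by (simp add: upd_def prod_eq_iff)
next
  case (snoc z zs)
  have "fold (visit c w) (zs @ [z]) s = visit c w z (fold (visit c w) zs s)" by simp
  then show ?case
    unfolding snoc.IH visit_def fst_conv snd_conv using assms
    by (auto simp: fun_eq_iff nth_append intro!: arg_cong[where f = concat])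
qed

lemma run_rep_visit:
  assumes "outputs x c p (w z)" and "c \<noteq> 0"
  shows "run x (rep 0 e (Then p (Inc c))) s = fold (visit c w) (replicate (ev e (fst s 0) (fst s 0)) z) s"
proof -
  have "fold (visit c w) (replicate m z) s = (visit c w z ^^ m) s" for m s
    by (induction m arbitrary: s) (auto simp: funpow_swap1)
  moreover have "run x (rep 0 e (Then p (Inc c))) s =
      (run x (Then p (Inc c)) ^^ ev e (fst s 0) (fst s 0)) s"
    by (rule run_rep) (simp only: run_visit[of x c p w z, OF assms(1)] visit_0[OF assms(2)] simp_thms)
  ultimately show ?thesis by (simp only: run_visit[of x c p w z, OF assms(1)])
qed

text \<open>The repetition count is evaluated with counter 0 in both roles, because the index
  \<open>c\<close> changes in the body.\<close>

lemma emits_rep: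
  assumes "outputs x c p w" and "c \<noteq> 0"
  shows "emits x (rep 0 e (Then p (Inc c))) {c} (concat (map (w (length x)) [0..<ev e (length x) (length x)]))
    (ev e (length x) (length x))"
proof -
  have "run x (rep 0 e (Then p (Inc c))) s = (fst (upd c (fst s c + ev e (fst s 0) (fst s 0)) s),
      snd s @ concat (map (\<lambda>j. w (fst s 0) (fst s c + j)) [0..<ev e (fst s 0) (fst s 0)]))" for s
    unfolding run_rep_visit[of x c p "\<lambda>_. w" "()", OF assms] fold_visit[OF assms(2)] by simp
  then show ?thesis using assms(2) by (intro emitsI) simp_all
qed

section \<open>Encodings of paths\<close>

text \<open>Unary codes are prefix-free, so a concatenation of codes can be decoded from the
  left.\<close>

lemma enc_nat_inject: "enc_nat m @ r = enc_nat n @ r' \<longleftrightarrow> m = n \<and> r = r'"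
proof (induction m arbitrary: n)
  case 0
  show ?case by (cases n) (auto simp: enc_nat_def)
next
  case (Suc m)
  show ?case using Suc[of "n - 1"] by (cases n) (auto simp: enc_nat_def)
qed

lemma concat_enc_nat_inject:
  "concat (map (\<lambda>v. enc_nat (g v)) xs) @ r = concat (map (\<lambda>v. enc_nat (g' v)) xs) @ r' \<longleftrightarrow>
     (\<forall>v \<in> set xs. g v = g' v) \<and> r = r'"
  by (induction xs) (auto simp: enc_nat_inject)

lemma concat_concat_enc_nat_inject:
  "concat (map (\<lambda>v. concat (map (\<lambda>u. enc_nat (g u v)) (f v))) xs) @ r =
   concat (map (\<lambda>v. concat (map (\<lambda>u. enc_nat (g' u v)) (f v))) xs) @ r' \<longleftrightarrow>
     (\<forall>v \<in> set xs. \<forall>u \<in> set (f v). g u v = g' u v) \<and> r = r'"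
  by (induction xs) (auto simp: concat_enc_nat_inject)

definition edge_code :: "lgraph \<Rightarrow> nat \<Rightarrow> nat \<Rightarrow> nat" where
  "edge_code G u v = (if {u, v} \<in> edges G then Suc (elab G {u, v}) else 0)"

lemma enc_graph_inject:
  assumes "enc_graph G @ r = enc_graph H @ r'"
  shows "card (verts G) = card (verts H) \<and> r = r' \<and>
    (\<forall>v < card (verts G). \<forall>u < v. edge_code G u v = edge_code H u v)"
proof -
  have card: "card (verts G) = card (verts H)"
    using assms by (simp add: enc_graph_def Let_def enc_nat_inject)
  then show ?thesis
    using assms unfolding enc_graph_def Let_def edge_code_def[symmetric]
    by (simp add: enc_nat_inject concat_enc_nat_inject concat_concat_enc_nat_inject)
qed

text \<open>An edge has two distinct endpoints and so corresponds to an entry below the diagonal.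
  Labels are recovered on edges only, as the code says nothing about \<open>elab\<close>
  elsewhere.\<close>

lemma edges_eq_if_edge_code_eq:
  assumes G: "simple_graph G" "verts G = {..<n}" and H: "simple_graph H" "verts H = {..<n}"
    and code: "\<And>u v. v < n \<Longrightarrow> u < v \<Longrightarrow> edge_code G u v = edge_code H u v"
  shows "edges G = edges H" and "e \<in> edges G \<Longrightarrow> elab G e = elab H e"
proof -
  have "e \<in> edges H' \<and> elab G' e = elab H' e"
    if e: "e \<in> edges G'" and G': "simple_graph G'" "verts G' = {..<n}"
      and code: "\<And>u v. v < n \<Longrightarrow> u < v \<Longrightarrow> edge_code G' u v = edge_code H' u v" for e G' H'
  proof -
    from G'(1) e obtain u v where uv: "e = {u, v}" "u \<in> verts G'" "v \<in> verts G'" "u \<noteq> v"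
      by (rule image_of_pair)
    have "\<exists>u v. e = {u, v} \<and> u < v \<and> v < n"
    proof (cases "u < v")
      case True
      then show ?thesis using uv G' by blast
    next
      case False
      then have "e = {v, u} \<and> v < u \<and> u < n" using uv G' by auto
      then show ?thesis by blast
    qed
    then obtain u v where "e = {u, v}" "u < v" "v < n" by blast
    then show ?thesis using code[of v u] e by (simp add: edge_code_def split: if_splits)
  qed
  from this[OF _ G code] this[OF _ H code[symmetric]]
  show "edges G = edges H" and "e \<in> edges G \<Longrightarrow> elab G e = elab H e" by blast+
qed

text \<open>Row \<open>Suc j\<close> of the matrix below the diagonal: vertex \<open>Suc j\<close>
  has \<open>j\<close> as its only smaller neighbour, and each non-edge is coded by a single
  \<open>False\<close>.\<close>

definition row :: "nat \<Rightarrow> nat \<Rightarrow> bool list" where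
  "row l j = replicate j False @ enc_nat (Suc l)"

lemma enc_graph_path_of:
  "enc_graph (path_of w) = enc_nat (Suc (length w)) @ replicate (Suc (length w)) False @ rows row w"
proof -
  let ?n = "Suc (length w)"
  have zeros: "concat (map (\<lambda>v. enc_nat 0) xs) = replicate (length xs) False" for xs :: "nat list"
    by (induction xs) (auto simp: enc_nat_def)
  have "concat (map (\<lambda>u. enc_nat (edge_code (path_of w) u (Suc j))) [0..<Suc j]) = row (w ! j) j"
    if j: "j < length w" for j
  proof -
    have "edge_code (path_of w) u (Suc j) = 0" if "u < j" for u
      using that by (auto simp: edge_code_def doubleton_eq_iff)
    then have "concat (map (\<lambda>u. enc_nat (edge_code (path_of w) u (Suc j))) [0..<j]) =
        concat (map (\<lambda>v. enc_nat 0) [0..<j])"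
      by (intro arg_cong[where f = concat] map_cong) auto
    moreover have "edge_code (path_of w) j (Suc j) = Suc (w ! j)"
      using j by (auto simp: edge_code_def)
    ultimately show ?thesis by (simp add: zeros row_def)
  qed
  then have "concat (map (\<lambda>v. concat (map (\<lambda>u. enc_nat (edge_code (path_of w) u v)) [0..<v])) [0..<?n])
      = rows row w"
    unfolding rows_def
    by (simp add: upt_conv_Cons map_Suc_upt[symmetric] comp_def del: upt_Suc)
      (intro arg_cong[where f = concat] map_cong; simp del: upt_Suc)
  then show ?thesis
    unfolding enc_graph_def Let_def edge_code_def[symmetric]
    by (simp add: zeros del: upt_Suc replicate_Suc)
qed

section \<open>Programs that print an encoded path\<close>

text \<open>Counter \<open>m\<close> holds the number of edges. There is one vertex more, and all
  vertices carry the label 0, whose code is a single \<open>False\<close>.\<close>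

definition size_prog :: "nat \<Rightarrow> bool prog" where
  "size_prog m = Then (Rep m (Emit True)) (Then (seqp (map Emit [True, False]))
     (Then (Rep m (Emit False)) (Emit False)))"

definition row_prog :: "nat \<Rightarrow> nat \<Rightarrow> bool prog" where
  "row_prog i l = Then (Rep i (Emit False)) (Then (seqp (map Emit (enc_nat (Suc l)))) (Inc i))"

text \<open>The length of the word is printed before its rows, so the word is generated twice, by
  copies \<open>p\<close> and \<open>q\<close> with counters of their own. The letters of
  \<open>p\<close> are merely counted in \<open>m\<close>; those of \<open>q\<close> are printed
  with the row number in \<open>i\<close>.\<close>

definition graph_prog :: "nat prog \<Rightarrow> nat prog \<Rightarrow> nat \<Rightarrow> nat \<Rightarrow> bool prog" where
  "graph_prog p q m i =
     Then (Then (subst (\<lambda>_. Inc m) p) (size_prog m)) (subst (row_prog i) q)"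

lemma run_Emits: "run x (seqp (map Emit w)) s = (fst s, snd s @ w)"
  by (induction w arbitrary: s) auto

lemma run_Rep_Emit: "run x (Rep m (Emit a)) s = (fst s, snd s @ replicate (fst s m) a)"
proof -
  have "(run x (Emit a) ^^ k) s = (fst s, snd s @ replicate k a)" for k
    by (induction k) (auto simp: replicate_append_same prod_eq_iff)
  then show ?thesis by simp
qed

lemma run_size_prog:
  "run x (size_prog m) s = (fst s, snd s @ enc_nat (Suc (fst s m)) @ replicate (Suc (fst s m)) False)"
  unfolding size_prog_def run.simps(4) run_Rep_Emit run_Emits
  by (simp add: enc_nat_def replicate_append_same replicate_app_Cons_same)

lemma run_row_prog: "run x (row_prog i l) s = (fst (upd i (Suc (fst s i)) s), snd s @ row l (fst s i))"
  unfolding row_prog_def run.simps(4) run_Rep_Emit run_Emits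
  by (simp add: row_def upd_def)

lemma emits_graph_prog:
  assumes p: "emits x p C w b" and q: "emits x q C' w b'"
    and m: "m \<notin> C" "m \<noteq> 0" "m \<notin> pvars p" and i: "i \<notin> C'" "i \<noteq> 0" "i \<notin> pvars q"
    and disj: "insert m C \<inter> insert i C' = {}"
  shows "emits x (graph_prog p q m i) (insert m C \<union> insert i C') (enc_graph (path_of w))
    ((b + length w) + (b' + length w))"
proof -
  have inc: "run x (Inc m) s = (fst (upd m (Suc (fst s m)) s), snd s @ [])"
    for s :: "(nat \<Rightarrow> nat) \<times> bool list"
    by (simp add: upd_def)
  have "emits x (Then (subst (\<lambda>_. Inc m) p) (size_prog m)) (insert m C)
      (enc_nat (Suc (length w)) @ replicate (Suc (length w)) False) (b + length w)"
  proof (rule emitsI)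
    fix s :: "(nat \<Rightarrow> nat) \<times> bool list" and j
    assume s: "fst s 0 = length x" "\<And>j. j \<in> insert m C \<Longrightarrow> fst s j = 0"
    let ?s = "run x (subst (\<lambda>_. Inc m) p) s"
    note sub = emits_subst[where h = "\<lambda>_ _. []", OF p m inc]
    have "fst ?s m = length w"
      using run_subst_emits[where h = "\<lambda>_ _. []", OF p m(3) inc s] by simp
    moreover have "snd ?s = snd s"
      using emitsD(1)[OF sub s] by (simp add: rows_def)
    ultimately have run: "run x (Then (subst (\<lambda>_. Inc m) p) (size_prog m)) s =
        (fst ?s, snd s @ enc_nat (Suc (length w)) @ replicate (Suc (length w)) False)"
      by (simp add: run_size_prog)
    show "snd (run x (Then (subst (\<lambda>_. Inc m) p) (size_prog m)) s) =
        snd s @ enc_nat (Suc (length w)) @ replicate (Suc (length w)) False"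
      unfolding run by simp
    show "fst (run x (Then (subst (\<lambda>_. Inc m) p) (size_prog m)) s) 0 = length x"
      unfolding run fst_conv by (rule emitsD(2)[OF sub s])
    show "fst (run x (Then (subst (\<lambda>_. Inc m) p) (size_prog m)) s) j = fst s j" if "j \<notin> insert m C"
      unfolding run fst_conv by (rule emitsD(3)[OF sub s that])
    show "fst (run x (Then (subst (\<lambda>_. Inc m) p) (size_prog m)) s) j \<le> fst s j + (b + length w)"
      unfolding run fst_conv by (rule emitsD(4)[OF sub s])
  qed
  from emits_Then[OF this emits_subst[where h = row, OF q i run_row_prog] disj]
  show ?thesis unfolding graph_prog_def enc_graph_path_of by simp
qed

section \<open>Walking along the zones\<close>

text \<open>Follows the layout of \<open>zones\<close> with \<open>c\<close> as the running cell
  number. Only the block of bits consults the input; the other blocks have lengths given by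
  \<open>eR\<close> and \<open>eF\<close>.\<close>

definition skeleton :: "nat \<Rightarrow> expr \<Rightarrow> expr \<Rightarrow> (zone \<Rightarrow> 'a prog) \<Rightarrow> 'a prog" where
  "skeleton c eR eF act = (let cell = (\<lambda>z. Then (act z) (Inc c)) in
     seqp [cell Edge, rep 0 eR (cell Blank), cell Head, Input (cell (Bit True)) (cell (Bit False)),
       rep 0 eR (cell Blank), cell Edge, rep 0 eF (cell Free), cell Final])"

lemma run_skeleton:
  assumes act: "\<And>z. outputs x c (act z) (w z)" and c: "c \<noteq> 0" and n: "fst s 0 = length x"
    and eR: "ev eR (length x) (length x) = R"
    and eF: "ev eF (length x) (length x) = (R - 2) * (2 * R + length x + 3) + (2 * R + length x + 2)"
  shows "run x (skeleton c eR eF act) s = fold (visit c w) (zones R x) s"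
proof -
  have cell: "run x (Then (act z) (Inc c)) = visit c w z" for z
    by (rule run_visit[of x c "act z" w z, OF act])
  have keep: "fst (fold (visit c w) zs s) 0 = fst s 0" for zs s
    by (induction zs arbitrary: s) (simp_all add: visit_0[OF c])
  have rep: "run x (rep 0 e (Then (act z) (Inc c))) s =
      fold (visit c w) (replicate (ev e (length x) (length x)) z) s" if "fst s 0 = length x" for e z s
    using run_rep_visit[of x c "act z" w z, OF act c] that by simp
  have input: "run x (Input (Then (act (Bit True)) (Inc c)) (Then (act (Bit False)) (Inc c))) s =
      fold (visit c w) (map Bit x) s" for s
  proof -
    have "(\<lambda>b. if b then run x (Then (act (Bit True)) (Inc c)) else run x (Then (act (Bit False)) (Inc c))) =
        visit c w \<circ> Bit"
      by (rule ext) (simp add: cell[symmetric])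
    then show ?thesis by (simp only: run.simps fold_map)
  qed
  have "run x (skeleton c eR eF act) s = fold (visit c w) [Final] (fold (visit c w)
      (replicate ((R - 2) * (2 * R + length x + 3) + (2 * R + length x + 2)) Free) (fold (visit c w) [Edge]
      (fold (visit c w) (replicate R Blank) (fold (visit c w) (map Bit x) (fold (visit c w) [Head]
      (fold (visit c w) (replicate R Blank) (fold (visit c w) [Edge] s)))))))"
  proof -
    have single: "fold (visit c w) [z] s = visit c w z s" for z s by simp
    show ?thesis
      unfolding skeleton_def Let_def seqp.simps run.simps(1,4)[of x]
      by (simp only: run.simps(1) cell[unfolded run.simps] run.simps(4)[symmetric] cell rep input single keep visit_0[OF c] n eR eF)
  qed
  also have "\<dots> = fold (visit c w) (zones R x) s"
    by (simp only: zones_def fold_append comp_apply)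
  finally show ?thesis .
qed

lemma emits_skeleton:
  assumes act: "\<And>z. outputs x c (act z) (w z)" and c: "c \<noteq> 0"
    and eR: "ev eR (length x) (length x) = R"
    and eF: "ev eF (length x) (length x) = (R - 2) * (2 * R + length x + 3) + (2 * R + length x + 2)"
  shows "emits x (skeleton c eR eF act) {c}
    (concat (map (\<lambda>j. w (zones R x ! j) (length x) j) [0..<length (zones R x)])) (length (zones R x))"
  using assms by (intro emitsI) (simp_all add: run_skeleton[OF assms(1,2) _ eR eF] fold_visit[OF c])

lemma pvars_skeleton: "(\<And>z. pvars (act z) \<subseteq> {0, c}) \<Longrightarrow> pvars (skeleton c eR eF act) \<subseteq> {0, c}"
  using pvars_rep[of 0 _ "Then (act _) (Inc c)"] by (fastforce simp: skeleton_def Let_def)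

lemma flat_input_skeleton: "(\<And>z. no_input (act z)) \<Longrightarrow> flat_input (skeleton c eR eF act)"
  by (auto simp: skeleton_def Let_def intro!: no_input_flat_input no_input_rep)

text \<open>The closure properties allow repetition counts to be read off the definitions of sizes
  and capacities. Conditions are fixed when the program is written, and differences have to be
  rewritten, as \<open>expr\<close> has no subtraction.\<close>

definition expressible :: "(nat \<Rightarrow> nat \<Rightarrow> nat) \<Rightarrow> bool" where
  "expressible F \<longleftrightarrow> (\<exists>e. \<forall>n c. ev e n c = F n c)"

lemma expressible_intros:
  "expressible (\<lambda>n c. k)" "expressible (\<lambda>n c. n)" "expressible (\<lambda>n c. c)"
  "expressible F \<Longrightarrow> expressible G \<Longrightarrow> expressible (\<lambda>n c. F n c + G n c)"
  "expressible F \<Longrightarrow> expressible G \<Longrightarrow> expressible (\<lambda>n c. F n c * G n c)"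
  "expressible F \<Longrightarrow> expressible G \<Longrightarrow> expressible (\<lambda>n c. if b then F n c else G n c)"
proof -
  show "expressible (\<lambda>n c. k)" unfolding expressible_def by (intro exI[of _ "Cst k"]) simp
  show "expressible (\<lambda>n c. n)" unfolding expressible_def by (intro exI[of _ VarN]) simp
  show "expressible (\<lambda>n c. c)" unfolding expressible_def by (intro exI[of _ VarX]) simp
  assume "expressible F" "expressible G"
  then obtain e e' where e: "\<And>n c. ev e n c = F n c" "\<And>n c. ev e' n c = G n c"
    unfolding expressible_def by blast
  then show "expressible (\<lambda>n c. F n c + G n c)"
    unfolding expressible_def by (intro exI[of _ "Add e e'"]) simp
  show "expressible (\<lambda>n c. F n c * G n c)"
    unfolding expressible_def using e by (intro exI[of _ "Mul e e'"]) simp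
  show "expressible (\<lambda>n c. if b then F n c else G n c)"
    using \<open>expressible F\<close> \<open>expressible G\<close> by (cases b) simp_all
qed

lemma expressible_power: "expressible F \<Longrightarrow> expressible (\<lambda>n c. F n c ^ k)"
  by (induction k) (simp_all add: expressible_intros)

lemma expressible_sum:
  "(\<And>i. i < m \<Longrightarrow> expressible (F i)) \<Longrightarrow> expressible (\<lambda>n c. \<Sum>i<m. F i n c)" for m :: nat
  by (induction m) (simp_all add: expressible_intros)

lemma expressible_poly: "expressible (\<lambda>n c. poly p n)"
  by (induction p) (simp_all add: expressible_intros)

section \<open>The reduction\<close>

definition expr_of :: "(nat \<Rightarrow> nat \<Rightarrow> nat) \<Rightarrow> expr" where
  "expr_of F = (SOME e. \<forall>n c. ev e n c = F n c)"

lemma ev_expr_of: "expressible F \<Longrightarrow> ev (expr_of F) n c = F n c"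
  unfolding expressible_def expr_of_def by (rule someI2_ex) auto

definition item_block :: "nat \<Rightarrow> (nat \<Rightarrow> nat \<Rightarrow> nat) \<Rightarrow> nat \<Rightarrow> nat prog" where
  "item_block c F l = Then (rep c (expr_of F) (Emit 0)) (Emit l)"

lemma outputs_item_block:
  assumes "expressible F"
  shows "outputs x c (item_block c F l) (\<lambda>n y. replicate (F n y) 0 @ [l])"
  using outputs_Then[OF outputs_rep outputs_Emit, of x c "expr_of F" 0 l]
  by (simp add: item_block_def ev_expr_of[OF assms])

lemma pvars_item_block: "pvars (item_block c F l) \<subseteq> {0, c}"
  using pvars_rep[of c "expr_of F" "Emit 0"] by (simp add: item_block_def)

lemma no_input_item_block: "no_input (item_block c F l)"
  by (simp add: item_block_def no_input_rep)

lemma emits_outputs: "outputs x 0 p w \<Longrightarrow> emits x p {} (w (length x) (length x)) 0"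
  by (simp add: outputs_def emits_def)

definition is_poly :: "(nat \<Rightarrow> nat) \<Rightarrow> bool" where
  "is_poly F \<longleftrightarrow> (\<exists>q. \<forall>n. F n = poly q n)"

lemma is_poly_intros:
  "is_poly (\<lambda>n. k)" "is_poly (\<lambda>n. n)" "is_poly (\<lambda>n. poly q n)"
  "is_poly F \<Longrightarrow> is_poly G \<Longrightarrow> is_poly (\<lambda>n. F n + G n)"
  "is_poly F \<Longrightarrow> is_poly G \<Longrightarrow> is_poly (\<lambda>n. F n * G n)"
  "is_poly F \<Longrightarrow> is_poly (\<lambda>n. cost p (F n))"
proof -
  show "is_poly (\<lambda>n. k)" unfolding is_poly_def by (intro exI[of _ "[:k:]"]) simp
  show "is_poly (\<lambda>n. n)" unfolding is_poly_def by (intro exI[of _ "[:0, 1:]"]) simp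
  show "is_poly (\<lambda>n. poly q n)" unfolding is_poly_def by blast
  assume "is_poly F"
  then obtain q where q: "\<And>n. F n = poly q n" unfolding is_poly_def by blast
  obtain q' where q': "\<And>n. cost p n = poly q' n" using cost_poly by blast
  show "is_poly (\<lambda>n. cost p (F n))"
    unfolding is_poly_def by (intro exI[of _ "pcompose q' q"]) (simp add: q q' poly_pcompose)
  assume "is_poly G"
  then obtain r where r: "\<And>n. G n = poly r n" unfolding is_poly_def by blast
  show "is_poly (\<lambda>n. F n + G n)"
    unfolding is_poly_def by (intro exI[of _ "q + r"]) (simp add: q r)
  show "is_poly (\<lambda>n. F n * G n)"
    unfolding is_poly_def by (intro exI[of _ "q * r"]) (simp add: q r)
qed

lemma concat_map_concat: "concat (map f (concat (map g xs))) = concat (map (\<lambda>x. concat (map f (g x))) xs)"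
  by (induction xs) auto

lemma all_True: "set w \<subseteq> {True} \<Longrightarrow> w = replicate (length w) True"
  by (induction w) auto

text \<open>All parameters come from the machine. Tiles and conflicts can thus be enumerated in the
  text of the program, and only cells and tokens are counted at run time.\<close>

locale reduction =
  fixes D :: nat and P Q :: "nat \<Rightarrow> nat \<Rightarrow> bool" and ok :: "zone \<Rightarrow> nat \<Rightarrow> bool" and p :: "nat poly"
  assumes D_pos: "0 < D"
begin

definition R :: "nat \<Rightarrow> nat" where "R n = poly p n + 2"
definition W :: "nat \<Rightarrow> nat" where "W n = 2 * R n + n + 3"
definition N :: "nat \<Rightarrow> nat" where "N n = R n * W n"

text \<open>The Boolean tells vertical conflicts from horizontal ones and thereby fixes the distance
  of the two cells.\<close>

definition conflicts :: "(nat \<times> nat \<times> bool) list" where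
  "conflicts = filter (\<lambda>(d, d', v). if v then \<not> Q d d' else \<not> P d d')
     (List.product [0..<D] (List.product [0..<D] [False, True]))"

definition T :: nat where "T = length conflicts"
definition src :: "nat \<Rightarrow> nat" where "src \<theta> = fst (conflicts ! \<theta>)"
definition tgt :: "nat \<Rightarrow> nat" where "tgt \<theta> = fst (snd (conflicts ! \<theta>))"
definition dist :: "nat \<Rightarrow> nat \<Rightarrow> nat" where
  "dist n \<theta> = (if snd (snd (conflicts ! \<theta>)) then W n else 1)"
definition B :: "nat \<Rightarrow> nat" where "B n = (N n * D + 2 * N n * T + 2) * (2 * N n + 1)\<^sup>2 + 1"

lemma set_conflicts: "(d, d', v) \<in> set conflicts \<longleftrightarrow> d < D \<and> d' < D \<and> (if v then \<not> Q d d' else \<not> P d d')"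
  by (auto simp: conflicts_def)

lemma nth_conflicts:
  assumes "\<theta> < T"
  shows "src \<theta> < D" "tgt \<theta> < D"
    "if snd (snd (conflicts ! \<theta>)) then \<not> Q (src \<theta>) (tgt \<theta>) else \<not> P (src \<theta>) (tgt \<theta>)"
proof -
  have "conflicts ! \<theta> \<in> set conflicts" using assms by (simp add: T_def)
  moreover have "conflicts ! \<theta> = (src \<theta>, tgt \<theta>, snd (snd (conflicts ! \<theta>)))"
    by (simp add: src_def tgt_def)
  ultimately have "(src \<theta>, tgt \<theta>, snd (snd (conflicts ! \<theta>))) \<in> set conflicts" by metis
  then show "src \<theta> < D" "tgt \<theta> < D"
    "if snd (snd (conflicts ! \<theta>)) then \<not> Q (src \<theta>) (tgt \<theta>) else \<not> P (src \<theta>) (tgt \<theta>)"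
    unfolding set_conflicts by blast+
qed

lemma W_le_N: "W n \<le> N n"
  by (simp add: N_def R_def)

lemma W_pos: "0 < W n"
  by (simp add: W_def)

lemma dist_bounds: "0 < dist n \<theta> \<and> dist n \<theta> \<le> N n"
  using W_le_N[of n] W_pos[of n] by (auto simp: dist_def)

lemma choice_packing: "choice_packing (N n) D T (B n) src tgt (dist n)"
  by unfold_locales (use nth_conflicts dist_bounds D_pos in \<open>auto simp: B_def\<close>)

definition okc :: "bool list \<Rightarrow> nat \<Rightarrow> nat \<Rightarrow> bool" where
  "okc x c d = ok (zones (R (length x)) x ! c) d"

lemma length_zones_R: "length (zones (R (length x)) x) = N (length x)"
  by (subst length_zones) (simp_all add: R_def N_def W_def)

lemma tiling_iff_good_choice:
  fixes x
  defines "n \<equiv> length x"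
  shows "is_tiling (W n) (zones (R n) x) {..<D} P Q ok f \<longleftrightarrow>
    choice_packing.good_choice (N n) D T src tgt (dist n) (okc x) f"
proof -
  note good = choice_packing.good_choice_def[OF choice_packing, of n "okc x" f]
  have len: "length (zones (R n) x) = N n" using length_zones_R by (simp add: n_def)
  have okc: "okc x c d = ok (zones (R n) x ! c) d" for c d by (simp add: okc_def n_def)
  show ?thesis
  proof
    assume tiling: "is_tiling (W n) (zones (R n) x) {..<D} P Q ok f"
    show "choice_packing.good_choice (N n) D T src tgt (dist n) (okc x) f"
      unfolding good
    proof (intro conjI allI impI notI)
      fix c assume "c < N n"
      then show "f c < D" "okc x c (f c)"
        using tiling by (simp_all add: is_tiling_def len okc)
    next
      fix \<theta> c
      assume \<theta>: "\<theta> < T" and c: "c + dist n \<theta> < N n" and f: "f c = src \<theta> \<and> f (c + dist n \<theta>) = tgt \<theta>"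
      show False
        using tiling c f nth_conflicts(3)[OF \<theta>]
        by (auto simp: is_tiling_def len dist_def split: if_splits)
    qed
  next
    assume "choice_packing.good_choice (N n) D T src tgt (dist n) (okc x) f"
    then have f: "\<And>c. c < N n \<Longrightarrow> f c < D \<and> okc x c (f c)"
      and free: "\<And>\<theta> c. \<theta> < T \<Longrightarrow> c + dist n \<theta> < N n \<Longrightarrow> \<not> (f c = src \<theta> \<and> f (c + dist n \<theta>) = tgt \<theta>)"
      unfolding good by blast+
    have pair: "if v then Q (f c) (f (c + W n)) else P (f c) (f (c + 1))"
      if c: "c + (if v then W n else 1) < N n" for c v
    proof (rule ccontr)
      let ?d = "if v then W n else 1"
      assume "\<not> (if v then Q (f c) (f (c + W n)) else P (f c) (f (c + 1)))"
      then have "(f c, f (c + ?d), v) \<in> set conflicts"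
        using f[of c] f[of "c + ?d"] c by (auto simp: set_conflicts)
      then obtain \<theta> where \<theta>: "\<theta> < T" "conflicts ! \<theta> = (f c, f (c + ?d), v)"
        by (auto simp: in_set_conv_nth T_def)
      have "dist n \<theta> = ?d" by (simp add: dist_def \<theta>(2))
      then show False
        using free[OF \<theta>(1), of c] c by (simp add: src_def tgt_def \<theta>(2))
    qed
    show "is_tiling (W n) (zones (R n) x) {..<D} P Q ok f"
      unfolding is_tiling_def len
      using f pair[of _ True] pair[of _ False] by (simp add: okc)
  qed
qed

definition bins :: "bool list \<Rightarrow> nat list" where
  "bins x = (let n = length x in
     map (choice_packing.capacity T (B n) src tgt (dist n) (okc x)) (choice_packing.blist (N n) D))"

definition items :: "nat \<Rightarrow> nat list" where
  "items n = map (choice_packing.item_size T (B n)) (choice_packing.ilist (N n) D T (dist n))"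

text \<open>The part of the threshold that depends only on the length of the input, taken from
  \<open>total_size\<close>.\<close>

definition ground :: "nat \<Rightarrow> nat" where
  "ground n = N n * ((D - 1) * (2 * T + 1) + 3 * T + 2 * D - 1) + (\<Sum>\<theta><T. dist n \<theta>)"

definition threshold :: "bool list \<Rightarrow> nat" where
  "threshold x = ground (length x) + (\<Sum>c<N (length x). \<Sum>d<D. if okc x c d then 1 else 0)"

definition reduce :: "bool list \<Rightarrow> bool list" where
  "reduce x = enc_instance (path_of (seg 1 (bins x))) (path_of (seg 2 (items (length x)))) (threshold x)"

lemma length_seg: "length (seg c ss) = sum_list (map Suc ss)"
  by (induction ss) (auto simp: seg_def)

lemma threshold_sum:
  "threshold x + 2 * sum_list (items (length x)) = length (seg 1 (bins x)) + length (seg 2 (items (length x)))"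
proof -
  interpret cp: choice_packing "N (length x)" D T "B (length x)" src tgt "dist (length x)" "okc x"
    by (rule choice_packing)
  show ?thesis
    using cp.total_size
    by (simp add: length_seg threshold_def ground_def items_def bins_def Let_def comp_def cp.M_def)
qed

text \<open>Required by \<open>packable_if_GED_le\<close>. The summand 1 in \<open>q\<close> already
  makes every size positive.\<close>

lemma items_pos: "s \<in> set (items n) \<Longrightarrow> 0 < s"
proof -
  interpret cp: choice_packing "N n" D T "B n" src tgt "dist n" "\<lambda>_ _. True"
    by (rule choice_packing)
  have "0 < B n" by (simp add: B_def)
  then have "0 < cp.item_size i" for i
    by (simp add: cp.item_size_def cp.high_def cp.q_def cp.L_def)
  then show "s \<in> set (items n) \<Longrightarrow> 0 < s" by (auto simp: items_def)
qed

lemma packable_iff_tiling: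
  fixes x
  defines "n \<equiv> length x"
  shows "packable (bins x) (items n) \<longleftrightarrow> (\<exists>f. is_tiling (W n) (zones (R n) x) {..<D} P Q ok f)"
proof -
  interpret cp: choice_packing "N n" D T "B n" src tgt "dist n" "okc x"
    by (rule choice_packing)
  show ?thesis
    using cp.packable_iff_good_choice tiling_iff_good_choice[of x]
    by (simp add: bins_def items_def Let_def n_def)
qed

lemma verts_path_of_lessThan: "verts (path_of w) = {..<card (verts (path_of w))}"
  by (simp add: lessThan_Suc_atMost)

lemma labeled_path_imp_simple_graph: "edge_labeled_path \<Sigma> a G \<Longrightarrow> simple_graph G"
  by (simp add: edge_labeled_path_def labeled_graph_def simple_graph_def)

theorem reduce_correct:
  "reduce x \<in> GED_path_problem {0, 1, 2} C_E \<longleftrightarrow>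
     (\<exists>f. is_tiling (W (length x)) (zones (R (length x)) x) {..<D} P Q ok f)"
proof -
  let ?G = "path_of (seg 1 (bins x))" and ?H = "path_of (seg 2 (items (length x)))"
  have "reduce x \<in> GED_path_problem {0, 1, 2} C_E \<longleftrightarrow> packable (bins x) (items (length x))"
  proof
    assume "packable (bins x) (items (length x))"
    from GED_le_if_packable[OF this threshold_sum]
    have "GED C_E ?G ?H \<le> of_nat (threshold x)" .
    moreover have "edge_labeled_path {0, 1, 2} 0 ?G" "edge_labeled_path {0, 1, 2} 0 ?H"
      using set_seg[of 1 "bins x"] set_seg[of 2 "items (length x)"]
      by (intro edge_labeled_path_path_of; blast)+
    ultimately show "reduce x \<in> GED_path_problem {0, 1, 2} C_E"
      unfolding GED_path_problem_def reduce_def using verts_path_of_lessThan by blast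
  next
    \<comment> \<open>The problem consists of codes of arbitrary graphs, so \<open>G\<close> and
      \<open>H\<close> are first identified with the intended paths, as far as the code determines
      them.\<close>
    assume "reduce x \<in> GED_path_problem {0, 1, 2} C_E"
    then obtain G H k a where enc: "reduce x = enc_instance G H k"
      and path: "edge_labeled_path {0, 1, 2} a G" "edge_labeled_path {0, 1, 2} a H"
      and verts: "verts G = {..<card (verts G)}" "verts H = {..<card (verts H)}"
      and GED: "GED C_E G H \<le> of_nat k"
      unfolding GED_path_problem_def by blast
    have eq: "enc_graph G @ enc_graph H @ enc_nat k =
        enc_graph ?G @ enc_graph ?H @ enc_nat (threshold x)"
      using enc by (simp add: reduce_def enc_instance_def)
    note G = enc_graph_inject[OF eq]
    then have eq': "enc_graph H @ enc_nat k = enc_graph ?H @ enc_nat (threshold x)" by blast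
    note H = enc_graph_inject[OF eq']
    have k: "k = threshold x" using H enc_nat_inject[of k "[]" "threshold x" "[]"] by simp
    note simple = path[THEN labeled_path_imp_simple_graph]
    have vG: "verts G = verts ?G" and vH: "verts H = verts ?H"
      using verts verts_path_of_lessThan G H by metis+
    have codeG: "\<And>u v. v < card (verts G) \<Longrightarrow> u < v \<Longrightarrow> edge_code G u v = edge_code ?G u v"
      using G by blast
    have codeH: "\<And>u v. v < card (verts H) \<Longrightarrow> u < v \<Longrightarrow> edge_code H u v = edge_code ?H u v"
      using H by blast
    note eG = edges_eq_if_edge_code_eq[OF simple(1) verts(1) simple_graph_path_of _ codeG]
    note eH = edges_eq_if_edge_code_eq[OF simple(2) verts(2) simple_graph_path_of _ codeH]
    show "packable (bins x) (items (length x))"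
    proof (rule packable_if_GED_le[OF simple(1) vG _ _ simple(2) vH])
      show "edges G = edges ?G" "\<And>e. e \<in> edges G \<Longrightarrow> elab G e = elab ?G e"
        using eG vG verts(1) by metis+
      show "edges H = edges ?H" "\<And>e. e \<in> edges H \<Longrightarrow> elab H e = elab ?H e"
        using eH vH verts(2) by metis+
    qed (use GED k threshold_sum items_pos in auto)
  qed
  then show ?thesis by (simp add: packable_iff_tiling)
qed

end

section \<open>Programs for bins, items and the threshold\<close>

context reduction
begin

text \<open>A capacity depends on the bits of the input only through one truth value, whether the
  tile is allowed. With this value as a parameter it is an expression in \<open>n\<close> and
  \<open>c\<close>.\<close>

definition cap :: "nat \<Rightarrow> bool \<Rightarrow> nat \<Rightarrow> nat \<Rightarrow> nat" where
  "cap n b c d = choice_packing.capacity T (B n) src tgt (dist n) (\<lambda>_ _. b) (c, d)"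

lemma capacity_eq_cap:
  "choice_packing.capacity T (B n) src tgt (dist n) (okc x) (c, d) = cap n (okc x c d) c d"
  unfolding cap_def choice_packing.capacity_def[OF choice_packing] choice_packing.Low_def[OF choice_packing]
  by simp

lemma expressible_R: "expressible (\<lambda>n c. R n)"
  unfolding R_def by (intro expressible_intros expressible_poly)

lemma expressible_W: "expressible (\<lambda>n c. W n)"
  unfolding W_def by (intro expressible_intros expressible_R)

lemma expressible_N: "expressible (\<lambda>n c. N n)"
  unfolding N_def by (intro expressible_intros expressible_R expressible_W)

lemma expressible_dist: "expressible (\<lambda>n c. dist n \<theta>)"
  unfolding dist_def by (intro expressible_intros expressible_W)

lemma expressible_B: "expressible (\<lambda>n c. B n)"
  unfolding B_def by (intro expressible_intros expressible_power expressible_N)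

lemma expressible_q:
  "expressible F \<Longrightarrow> expressible (\<lambda>n c. choice_packing.q (B n) (F n c))"
  unfolding choice_packing.q_def[OF choice_packing]
  by (intro expressible_intros expressible_power expressible_B)

lemma expressible_cap: "expressible (\<lambda>n c. cap n b c d)"
  unfolding cap_def choice_packing.capacity_def[OF choice_packing] choice_packing.Low_def[OF choice_packing]
    choice_packing.High_def[OF choice_packing] choice_packing.block_def[OF choice_packing]
    choice_packing.slots_def[OF choice_packing] fst_conv snd_conv
  by (intro expressible_intros expressible_sum expressible_power expressible_B expressible_q
      expressible_dist)

lemma expressible_item_size:
  "expressible (\<lambda>n c. choice_packing.item_size T (B n) (Cell c j))"
  "expressible F \<Longrightarrow> expressible (\<lambda>n c. choice_packing.item_size T (B n) (Conf \<theta> (F n c) b))"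
  unfolding choice_packing.item_size_def[OF choice_packing] choice_packing.high_def[OF choice_packing]
    choice_packing.low.simps[OF choice_packing] choice_packing.kind.simps[OF choice_packing]
    choice_packing.ident.simps[OF choice_packing]
  by (intro expressible_intros expressible_power expressible_B expressible_q; assumption)+

definition free_cells :: "nat \<Rightarrow> nat" where
  "free_cells n = (R n - 2) * (2 * R n + n + 3) + (2 * R n + n + 2)"

text \<open>\<open>R n - 2\<close> is \<open>poly p n\<close>, which removes the
  subtraction.\<close>

lemma expressible_free_cells: "expressible (\<lambda>n c. free_cells n)"
proof -
  have "free_cells n = poly p n * (2 * R n + n + 3) + (2 * R n + n + 2)" for n
    by (simp add: free_cells_def R_def)
  then show ?thesis
    by (simp only:) (intro expressible_intros expressible_R expressible_poly)
qed

text \<open>Taking one row or one cell away from \<open>R n\<close> rows leaves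
  \<open>poly p n + 1\<close> full rows, and in the second case a row without one cell.\<close>

lemma expressible_N_minus_dist: "expressible (\<lambda>n c. N n - dist n \<theta>)"
proof -
  have "N n - dist n \<theta> = (if snd (snd (conflicts ! \<theta>)) then (poly p n + 1) * W n
      else (poly p n + 1) * W n + (2 * R n + n + 2))" for n
    by (simp add: N_def dist_def) (simp add: R_def W_def algebra_simps)
  then show ?thesis
    by (simp only:) (intro expressible_intros expressible_R expressible_W expressible_poly)
qed

lemma expressible_ground: "expressible (\<lambda>n c. ground n)"
  unfolding ground_def by (intro expressible_intros expressible_sum expressible_N expressible_dist)

definition zone_skeleton :: "nat \<Rightarrow> (zone \<Rightarrow> 'a prog) \<Rightarrow> 'a prog" where
  "zone_skeleton c = skeleton c (expr_of (\<lambda>n _. R n)) (expr_of (\<lambda>n _. free_cells n))"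

lemma emits_zone_skeleton:
  assumes "\<And>z. outputs x c (act z) (w z)" and "c \<noteq> 0"
  shows "emits x (zone_skeleton c act) {c}
    (concat (map (\<lambda>j. w (zones (R (length x)) x ! j) (length x) j) [0..<N (length x)])) (N (length x))"
  unfolding zone_skeleton_def length_zones_R[symmetric]
proof (rule emits_skeleton[where act = act and w = w, OF assms])
  show "ev (expr_of (\<lambda>n _. R n)) (length x) (length x) = R (length x)"
    by (rule ev_expr_of[OF expressible_R])
  show "ev (expr_of (\<lambda>n _. free_cells n)) (length x) (length x) =
      (R (length x) - 2) * (2 * R (length x) + length x + 3) + (2 * R (length x) + length x + 2)"
    unfolding ev_expr_of[OF expressible_free_cells] by (rule free_cells_def)
qed

text \<open>The tiles are unrolled in the text, and \<open>ok z d\<close> is decided for each zone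
  when the program is written.\<close>

definition bins_prog :: "nat \<Rightarrow> nat prog" where
  "bins_prog c = zone_skeleton c (\<lambda>z. seqp (map (\<lambda>d. item_block c (\<lambda>n y. cap n (ok z d) y d) 1) [0..<D]))"

lemma emits_bins_prog:
  assumes "c \<noteq> 0"
  shows "emits x (bins_prog c) {c} (seg 1 (bins x)) (N (length x))"
proof -
  let ?n = "length x"
  have "emits x (bins_prog c) {c} (concat (map (\<lambda>j. concat (map (\<lambda>d.
      replicate (cap ?n (ok (zones (R ?n) x ! j) d) j d) 0 @ [1]) [0..<D])) [0..<N ?n])) (N ?n)"
    unfolding bins_prog_def
    by (rule emits_zone_skeleton[OF outputs_seqp[OF outputs_item_block[OF expressible_cap]] assms])
  moreover have "seg 1 (bins x) = concat (map (\<lambda>j. concat (map (\<lambda>d.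
      replicate (cap ?n (ok (zones (R ?n) x ! j) d) j d) 0 @ [1]) [0..<D])) [0..<N ?n])"
    unfolding seg_def bins_def Let_def choice_packing.blist_def[OF choice_packing] map_map concat_map_concat
    by (simp add: comp_def capacity_eq_cap okc_def)
  ultimately show ?thesis by simp
qed

lemma pvars_bins_prog: "pvars (bins_prog c) \<subseteq> {0, c}"
  unfolding bins_prog_def zone_skeleton_def
  by (rule pvars_skeleton) (use pvars_item_block in \<open>fastforce simp: pvars_seqp\<close>)

lemma flat_input_bins_prog: "flat_input (bins_prog c)"
  unfolding bins_prog_def zone_skeleton_def
  by (rule flat_input_skeleton) (auto intro!: no_input_seqp simp: no_input_item_block)

text \<open>Prints the part of the threshold that depends on the bits of the input, one
  \<open>True\<close> for each allowed pair of cell and tile.\<close>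

definition ok_prog :: "nat \<Rightarrow> bool prog" where
  "ok_prog c = zone_skeleton c (\<lambda>z. seqp (map (\<lambda>d. if ok z d then Emit True else Nop) [0..<D]))"

lemma emits_ok_prog:
  assumes "c \<noteq> 0"
  shows "emits x (ok_prog c) {c} (replicate (\<Sum>c<N (length x). \<Sum>d<D. if okc x c d then 1 else 0) True)
    (N (length x))"
proof -
  let ?w = "\<lambda>z. concat (map (\<lambda>d. if ok z d then [True] else []) [0..<D])"
  have "outputs x c (if ok z d then Emit True else Nop) (\<lambda>_ _. if ok z d then [True] else [])" for z d
    by (simp add: outputs_def)
  then have "emits x (ok_prog c) {c} (concat (map (\<lambda>j. ?w (zones (R (length x)) x ! j)) [0..<N (length x)]))
      (N (length x))"
    unfolding ok_prog_def by (intro emits_zone_skeleton outputs_seqp assms)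
  moreover have "concat (map (\<lambda>j. ?w (zones (R (length x)) x ! j)) [0..<N (length x)]) =
      replicate (\<Sum>c<N (length x). \<Sum>d<D. if okc x c d then 1 else 0) True"
  proof -
    let ?c = "concat (map (\<lambda>j. ?w (zones (R (length x)) x ! j)) [0..<N (length x)])"
    have "length ?c = (\<Sum>c<N (length x). \<Sum>d<D. if okc x c d then 1 else 0)"
      by (simp add: length_concat comp_def okc_def interv_sum_list_conv_sum_set_nat
          lessThan_atLeast0 if_distrib[where f = length] cong: if_cong)
    moreover have "?c = replicate (length ?c) True"
      by (rule all_True) (auto split: if_splits)
    ultimately show ?thesis by simp
  qed
  ultimately show ?thesis by simp
qed

lemma flat_input_ok_prog: "flat_input (ok_prog c)"
  unfolding ok_prog_def zone_skeleton_def
  by (rule flat_input_skeleton) (auto intro!: no_input_seqp)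

definition threshold_prog :: "nat \<Rightarrow> bool prog" where
  "threshold_prog c = Then (rep 0 (expr_of (\<lambda>n _. ground n)) (Emit True)) (Then (ok_prog c) (Emit False))"

lemma emits_threshold_prog:
  assumes "c \<noteq> 0"
  shows "emits x (threshold_prog c) {c} (enc_nat (threshold x)) (N (length x))"
proof -
  have 1: "emits x (rep 0 (expr_of (\<lambda>n _. ground n)) (Emit True)) {} (replicate (ground (length x)) True) 0"
    using emits_outputs[OF outputs_rep[of x 0 "expr_of (\<lambda>n _. ground n)" True]]
    by (simp add: ev_expr_of[OF expressible_ground])
  have 2: "emits x (Emit False) {} [False] 0"
    by (rule emits_outputs[OF outputs_Emit])
  from emits_Then[OF 1 emits_Then[OF emits_ok_prog[OF assms] 2]]
  show ?thesis
    by (simp add: threshold_prog_def enc_nat_def threshold_def replicate_add)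
qed

definition loop :: "nat \<Rightarrow> (nat \<Rightarrow> nat \<Rightarrow> nat) \<Rightarrow> 'a prog \<Rightarrow> 'a prog" where
  "loop c F q = rep 0 (expr_of F) (Then q (Inc c))"

lemma emits_loop:
  assumes "outputs x c q w" and "c \<noteq> 0" and "expressible F"
  shows "emits x (loop c F q) {c} (concat (map (w (length x)) [0..<F (length x) (length x)]))
    (F (length x) (length x))"
  using emits_rep[OF assms(1,2), of "expr_of F"] by (simp add: loop_def ev_expr_of[OF assms(3)])

text \<open>Real tokens and dummies need a counter each. The dummies have identifiers from
  \<open>dist n \<theta>\<close> on, hence the shift of an index that starts at 0.\<close>

definition conflict_prog :: "nat \<Rightarrow> nat \<Rightarrow> nat prog" where
  "conflict_prog c \<theta> = Then
     (loop c (\<lambda>n _. N n + dist n \<theta>)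
       (item_block c (\<lambda>n y. choice_packing.item_size T (B n) (Conf \<theta> y True)) 2))
     (loop (Suc c) (\<lambda>n _. N n - dist n \<theta>)
       (item_block (Suc c) (\<lambda>n y. choice_packing.item_size T (B n) (Conf \<theta> (y + dist n \<theta>) False)) 2))"

lemma emits_conflict_prog:
  assumes "c \<noteq> 0"
  shows "emits x (conflict_prog c \<theta>) {c, Suc c}
    (seg 2 (map (choice_packing.item_size T (B (length x)))
      (map (\<lambda>y. Conf \<theta> y True) [0..<N (length x) + dist (length x) \<theta>] @
       map (\<lambda>y. Conf \<theta> y False) [dist (length x) \<theta>..<N (length x)]))) (2 * N (length x))"
proof -
  let ?n = "length x"
  let ?s = "choice_packing.item_size T (B ?n)"
  have real: "outputs x c (item_block c (\<lambda>n y. choice_packing.item_size T (B n) (Conf \<theta> y True)) 2)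
      (\<lambda>n y. replicate (choice_packing.item_size T (B n) (Conf \<theta> y True)) 0 @ [2])"
    by (intro outputs_item_block expressible_item_size expressible_intros)
  have dummy: "outputs x (Suc c)
      (item_block (Suc c) (\<lambda>n y. choice_packing.item_size T (B n) (Conf \<theta> (y + dist n \<theta>) False)) 2)
      (\<lambda>n y. replicate (choice_packing.item_size T (B n) (Conf \<theta> (y + dist n \<theta>) False)) 0 @ [2])"
    by (intro outputs_item_block expressible_item_size expressible_intros expressible_dist)
  have "emits x (conflict_prog c \<theta>) ({c} \<union> {Suc c})
     (concat (map (\<lambda>y. replicate (?s (Conf \<theta> y True)) 0 @ [2]) [0..<N ?n + dist ?n \<theta>]) @
      concat (map (\<lambda>y. replicate (?s (Conf \<theta> (y + dist ?n \<theta>) False)) 0 @ [2]) [0..<N ?n - dist ?n \<theta>]))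
     ((N ?n + dist ?n \<theta>) + (N ?n - dist ?n \<theta>))"
    unfolding conflict_prog_def using assms
    by (intro emits_Then emits_loop[OF real] emits_loop[OF dummy] expressible_N_minus_dist
        expressible_intros expressible_N expressible_dist) auto
  moreover have "[dist ?n \<theta>..<N ?n] = map (\<lambda>y. y + dist ?n \<theta>) [0..<N ?n - dist ?n \<theta>]"
    using dist_bounds[of ?n \<theta>] by (simp add: map_add_upt)
  moreover have "N ?n + dist ?n \<theta> + (N ?n - dist ?n \<theta>) = 2 * N ?n"
    using dist_bounds[of ?n \<theta>] by simp
  ultimately show ?thesis
    by (simp add: seg_def comp_def insert_commute)
qed

definition cells_prog :: "nat \<Rightarrow> nat prog" where
  "cells_prog c = loop c (\<lambda>n _. N n)
     (seqp (map (\<lambda>j. item_block c (\<lambda>n y. choice_packing.item_size T (B n) (Cell y j)) 2) [0..<D]))"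

lemma emits_cells_prog:
  assumes "c \<noteq> 0"
  shows "emits x (cells_prog c) {c}
    (seg 2 (map (choice_packing.item_size T (B (length x)))
      (concat (map (\<lambda>c. map (Cell c) [0..<D]) [0..<N (length x)])))) (N (length x))"
proof -
  let ?n = "length x"
  let ?s = "choice_packing.item_size T (B ?n)"
  have "emits x (cells_prog c) {c}
     (concat (map (\<lambda>y. concat (map (\<lambda>j. replicate (?s (Cell y j)) 0 @ [2]) [0..<D])) [0..<N ?n])) (N ?n)"
    unfolding cells_prog_def
    by (rule emits_loop[OF outputs_seqp[OF outputs_item_block[OF expressible_item_size(1)]]
          assms expressible_N])
  then show ?thesis
    unfolding seg_def map_map concat_map_concat by (simp add: comp_def)
qed

text \<open>Counter \<open>c\<close> serves the cells, and each conflict gets the next two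
  counters.\<close>

definition items_prog :: "nat \<Rightarrow> nat prog" where
  "items_prog c = Then (cells_prog c) (seqp (map (\<lambda>\<theta>. conflict_prog (c + 1 + 2 * \<theta>) \<theta>) [0..<T]))"

lemma seg_append: "seg c (xs @ ys) = seg c xs @ seg c ys"
  by (simp add: seg_def)

lemma seg_concat: "seg c (map f (concat xss)) = concat (map (\<lambda>xs. seg c (map f xs)) xss)"
  by (induction xss) (simp_all add: seg_def)

lemma emits_items_prog:
  assumes "c \<noteq> 0"
  shows "emits x (items_prog c) {c..c + 2 * T} (seg 2 (items (length x))) (N (length x) * (2 * T + 1))"
proof -
  let ?n = "length x"
  let ?s = "choice_packing.item_size T (B ?n)"
  let ?ps = "map (\<lambda>\<theta>. conflict_prog (c + 1 + 2 * \<theta>) \<theta>) [0..<T]"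
  let ?C = "\<lambda>\<theta>. {c + 1 + 2 * \<theta>, Suc (c + 1 + 2 * \<theta>)}"
  let ?w = "\<lambda>\<theta>. seg 2 (map ?s (map (\<lambda>y. Conf \<theta> y True) [0..<N ?n + dist ?n \<theta>] @
       map (\<lambda>y. Conf \<theta> y False) [dist ?n \<theta>..<N ?n]))"
  have "emits x (seqp ?ps) (\<Union>\<theta><length ?ps. ?C \<theta>) (concat (map ?w [0..<length ?ps])) (length ?ps * (2 * N ?n))"
  proof (rule emits_seqp)
    show "emits x (?ps ! \<theta>) (?C \<theta>) (?w \<theta>) (2 * N ?n)" if "\<theta> < length ?ps" for \<theta>
      using that emits_conflict_prog[of "c + 1 + 2 * \<theta>" x \<theta>] by simp
    show "?C k \<inter> ?C l = {}" if "k < l" for k l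
      using that by auto
  qed
  then have "emits x (seqp ?ps) (\<Union>\<theta><T. ?C \<theta>) (concat (map ?w [0..<T])) (T * (2 * N ?n))"
    by (simp only: length_map length_upt diff_zero)
  from emits_Then[OF emits_cells_prog[OF assms] this]
  have "emits x (items_prog c) ({c} \<union> (\<Union>\<theta><T. ?C \<theta>))
      (seg 2 (map ?s (concat (map (\<lambda>c. map (Cell c) [0..<D]) [0..<N ?n]))) @ concat (map ?w [0..<T]))
      (N ?n + T * (2 * N ?n))"
    unfolding items_prog_def by auto
  moreover have "{c} \<union> (\<Union>\<theta><T. ?C \<theta>) = {c..c + 2 * T}"
  proof (intro equalityI subsetI)
    fix j assume j: "j \<in> {c..c + 2 * T}"
    show "j \<in> {c} \<union> (\<Union>\<theta><T. ?C \<theta>)"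
    proof (cases "j = c")
      case False
      define \<theta> where "\<theta> = (j - c - 1) div 2"
      have "\<theta> < T" "j = c + 1 + 2 * \<theta> \<or> j = Suc (c + 1 + 2 * \<theta>)"
        using False j by (auto simp: \<theta>_def)
      then show ?thesis by blast
    qed simp
  qed auto
  moreover have "seg 2 (map ?s (concat (map (\<lambda>c. map (Cell c) [0..<D]) [0..<N ?n]))) @ concat (map ?w [0..<T])
      = seg 2 (items ?n)"
    unfolding items_def choice_packing.ilist_def[OF choice_packing] map_append[of _ "concat _"] seg_append seg_concat
    by (simp only: map_map comp_def)
  ultimately show ?thesis by (simp add: algebra_simps)
qed

lemma pvars_loop: "pvars (loop c F q) \<subseteq> insert c ({0} \<union> pvars q)"
  using pvars_rep[of 0 "expr_of F" "Then q (Inc c)"] by (auto simp: loop_def)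

lemma pvars_conflict_prog: "pvars (conflict_prog c \<theta>) \<subseteq> {0, c, Suc c}"
  unfolding conflict_prog_def pvars.simps
  by (intro Un_least order_trans[OF pvars_loop]) (use pvars_item_block in \<open>blast intro: order_trans\<close>)+

lemma pvars_items_prog: "pvars (items_prog c) \<subseteq> {0} \<union> {c..c + 2 * T}"
proof -
  have "pvars (cells_prog c) \<subseteq> {0} \<union> {c..c + 2 * T}"
  proof -
    have "pvars (seqp (map (\<lambda>j. item_block c (\<lambda>n y. choice_packing.item_size T (B n) (Cell y j)) 2) [0..<D]))
        \<subseteq> {0, c}"
      unfolding pvars_seqp using pvars_item_block by (simp add: UN_subset_iff)
    then show ?thesis
      unfolding cells_prog_def by (intro order_trans[OF pvars_loop]) auto
  qed
  moreover have "pvars (conflict_prog (c + 1 + 2 * \<theta>) \<theta>) \<subseteq> {0} \<union> {c..c + 2 * T}" if "\<theta> < T" for \<theta>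
    using that by (intro order_trans[OF pvars_conflict_prog]) auto
  ultimately show ?thesis
    unfolding items_prog_def pvars.simps pvars_seqp by (auto simp: UN_subset_iff)
qed

lemma no_input_loop: "no_input q \<Longrightarrow> no_input (loop c F q)"
  by (simp add: loop_def no_input_rep)

lemma flat_input_items_prog: "flat_input (items_prog c)"
  unfolding items_prog_def cells_prog_def conflict_prog_def
  by (auto intro!: no_input_flat_input no_input_loop no_input_seqp simp: no_input_item_block)

section \<open>The program of the whole reduction\<close>

text \<open>Counter 0 holds the input length, 1 and 2 belong to the two generations of the bins, 3
  to 6 count edges and rows of the two graphs, and 7 serves the threshold. The two generations of
  the items own \<open>2 * T + 1\<close> counters each, from 8 and from \<open>c\<close> on.\<close>

definition reduce_prog :: "bool prog" where
  "reduce_prog = (let c = 9 + 2 * T in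
     Then (graph_prog (bins_prog 1) (bins_prog 2) 3 4)
       (Then (graph_prog (items_prog 8) (items_prog c) 5 6) (threshold_prog 7)))"

definition bins_length_bound :: "nat \<Rightarrow> nat" where
  "bins_length_bound n = cost (bins_prog 1) (n + N n)"

definition items_length_bound :: "nat \<Rightarrow> nat" where
  "items_length_bound n = cost (items_prog 8) (n + N n * (2 * T + 1))"

text \<open>Bounds the edge and row counters of \<open>graph_prog\<close>, which grow up to the
  length of the label word.\<close>

lemma length_emitted_le:
  fixes q :: "'a prog"
  assumes "emits x q C w b" and "0 \<notin> C"
  shows "length w \<le> cost q (length x + b)"
proof -
  let ?s = "((\<lambda>j. if j = 0 then length x else 0), []) :: (nat \<Rightarrow> nat) \<times> 'a list"
  have s: "fst ?s 0 = length x" "\<And>j. j \<in> C \<Longrightarrow> fst ?s j = 0" using assms(2) by auto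
  have "fst (run x q ?s) j \<le> length x + b" for j
    using emitsD(4)[OF assms(1) s, of j] by (simp split: if_splits)
  then have "length (snd (run x q ?s)) \<le> length (snd ?s) + cost q (length x + b)"
    by (rule length_run_le_cost) simp
  then show ?thesis using emitsD(1)[OF assms(1) s] by simp
qed

definition increment_bound :: "nat \<Rightarrow> nat" where
  "increment_bound n = 3 * N n + 2 * bins_length_bound n + 2 * (N n * (2 * T + 1)) + 2 * items_length_bound n"

lemma emits_reduce_prog:
  "\<exists>C. 0 \<notin> C \<and> emits x reduce_prog C (reduce x) (increment_bound (length x))"
proof -
  let ?n = "length x"
  define c where "c = 9 + 2 * T"
  let ?CG = "insert 3 {1} \<union> insert 4 {2}"
  let ?CH = "insert 5 {8..8 + 2 * T} \<union> insert 6 {c..c + 2 * T}"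
  have G: "emits x (graph_prog (bins_prog 1) (bins_prog 2) 3 4) ?CG (enc_graph (path_of (seg 1 (bins x))))
      ((N ?n + length (seg 1 (bins x))) + (N ?n + length (seg 1 (bins x))))"
    using pvars_bins_prog[of 1] pvars_bins_prog[of 2]
    by (intro emits_graph_prog emits_bins_prog) auto
  have H: "emits x (graph_prog (items_prog 8) (items_prog c) 5 6) ?CH
      (enc_graph (path_of (seg 2 (items ?n))))
      ((N ?n * (2 * T + 1) + length (seg 2 (items ?n))) + (N ?n * (2 * T + 1) + length (seg 2 (items ?n))))"
    using pvars_items_prog[of 8] pvars_items_prog[of c]
    by (intro emits_graph_prog emits_items_prog) (auto simp: c_def)
  have th: "emits x (threshold_prog 7) {7} (enc_nat (threshold x)) (N ?n)"
    by (rule emits_threshold_prog) simp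
  have disj: "?CH \<inter> {7} = {}" "?CG \<inter> (?CH \<union> {7}) = {}"
    by (auto simp: c_def)
  have emits: "emits x reduce_prog (?CG \<union> (?CH \<union> {7})) (reduce x)
      ((N ?n + length (seg 1 (bins x))) + (N ?n + length (seg 1 (bins x))) +
       ((N ?n * (2 * T + 1) + length (seg 2 (items ?n))) + (N ?n * (2 * T + 1) + length (seg 2 (items ?n))) + N ?n))"
    unfolding reduce_prog_def Let_def c_def[symmetric] reduce_def enc_instance_def
    by (rule emits_Then[OF G emits_Then[OF H th disj(1)] disj(2)])
  have "length (seg 1 (bins x)) \<le> bins_length_bound ?n"
    unfolding bins_length_bound_def by (rule length_emitted_le[OF emits_bins_prog]) simp_all
  moreover have "length (seg 2 (items ?n)) \<le> items_length_bound ?n"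
    unfolding items_length_bound_def by (rule length_emitted_le[OF emits_items_prog]) simp_all
  ultimately have "(N ?n + length (seg 1 (bins x))) + (N ?n + length (seg 1 (bins x))) +
       ((N ?n * (2 * T + 1) + length (seg 2 (items ?n))) + (N ?n * (2 * T + 1) + length (seg 2 (items ?n))) + N ?n)
      \<le> increment_bound ?n"
    unfolding increment_bound_def by linarith
  with emits have "emits x reduce_prog (?CG \<union> (?CH \<union> {7})) (reduce x) (increment_bound ?n)"
    by (rule emits_mono)
  moreover have "0 \<notin> ?CG \<union> (?CH \<union> {7})" by (auto simp: c_def)
  ultimately show ?thesis by (intro exI[of _ "?CG \<union> (?CH \<union> {7})"] conjI)
qed

lemma flat_input_graph_prog:
  assumes "flat_input q" and "flat_input q'"
  shows "flat_input (graph_prog q q' m i)"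
proof -
  have "no_input (row_prog i l)" for l
    by (auto simp: row_prog_def intro!: no_input_seqp)
  then have "flat_input (subst (row_prog i) q')"
    using assms(2) by (intro flat_input_subst)
  moreover have "flat_input (subst (\<lambda>_. Inc m) q :: bool prog)"
    using assms(1) by (intro flat_input_subst) simp_all
  ultimately show ?thesis by (simp add: graph_prog_def size_prog_def)
qed

lemma flat_input_reduce_prog: "flat_input reduce_prog"
proof -
  have "flat_input (threshold_prog 7)"
    unfolding threshold_prog_def
    by (simp add: flat_input_ok_prog no_input_flat_input no_input_rep)
  then show ?thesis
    unfolding reduce_prog_def Let_def
    by (simp add: flat_input_graph_prog flat_input_bins_prog flat_input_items_prog)
qed

lemma is_poly_N: "is_poly N"
  unfolding N_def[abs_def] W_def R_def by (intro is_poly_intros)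

lemma is_poly_increment_bound: "is_poly increment_bound"
  unfolding increment_bound_def[abs_def] bins_length_bound_def items_length_bound_def
  by (intro is_poly_intros is_poly_N)

theorem polytime_computable_reduce: "polytime_computable reduce"
proof -
  \<comment> \<open>The prefix scans the input once to put its length into counter 0, as
    \<open>emits\<close> presupposes.\<close>
  let ?p = "Then (Input (Inc 0) (Inc 0)) reduce_prog"
  let ?s = "(\<lambda>_. 0, []) :: (nat \<Rightarrow> nat) \<times> bool list"
  obtain r where r: "\<And>n. n + increment_bound n = poly r n"
    using is_poly_intros(4)[OF is_poly_intros(2) is_poly_increment_bound] unfolding is_poly_def by blast
  have input: "run x (Input (Inc 0) (Inc 0)) ?s = ((\<lambda>j. if j = 0 then length x else 0), [])" for x
  proof -
    have "fold (\<lambda>b. if b then run x (Inc 0) else run x (Inc 0)) y (f, u) = (f(0 := f 0 + length y), u)"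
      for y f and u :: "bool list"
      by (induction y arbitrary: f) auto
    then show ?thesis by (auto simp: fun_eq_iff)
  qed
  have run: "snd (run x ?p ?s) = reduce x \<and> fst (run x ?p ?s) v \<le> poly r (length x)" for x v
  proof -
    let ?t = "((\<lambda>j. if j = 0 then length x else 0), []) :: (nat \<Rightarrow> nat) \<times> bool list"
    obtain C where C: "0 \<notin> C" "emits x reduce_prog C (reduce x) (increment_bound (length x))"
      using emits_reduce_prog by blast
    have t: "fst ?t 0 = length x" "\<And>j. j \<in> C \<Longrightarrow> fst ?t j = 0" using C(1) by auto
    have "run x ?p ?s = run x reduce_prog ?t" using input by simp
    moreover have "snd (run x reduce_prog ?t) = reduce x"
      using emitsD(1)[OF C(2) t] by simp
    moreover have "fst (run x reduce_prog ?t) v \<le> poly r (length x)"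
      using emitsD(4)[OF C(2) t, of v] r[of "length x"] by (simp split: if_splits)
    ultimately show ?thesis by simp
  qed
  show ?thesis
  proof (rule polytime_computable_run[of ?p _ r])
    show "flat_input ?p" using flat_input_reduce_prog by simp
    show "snd (run x ?p ?s) = reduce x" for x using run by blast
    show "fst (run x ?p ?s) v \<le> poly r (length x)" for x v using run by blast
  qed
qed

end

theorem mainTheorem3:
  shows "\<exists>\<Sigma> :: nat set. finite \<Sigma> \<and> NP_hard (GED_path_problem \<Sigma> C_E)"
proof (intro exI[of _ "{0, 1, 2}"] conjI)
  show "NP_hard (GED_path_problem {0, 1, 2} C_E)"
    unfolding NP_hard_def
  proof
    fix A assume "A \<in> NP"
    then obtain D :: nat and P Q ok and p :: "nat poly" where D: "0 < D"
      and tiling: "\<And>x :: bool list. x \<in> A \<longleftrightarrow> (\<exists>f. is_tiling (2 * (poly p (length x) + 2) + length x + 3)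
        (zones (poly p (length x) + 2) x) {..<D} P Q ok f)"
      by (rule NP_tiling) blast
    interpret reduction D P Q ok p by unfold_locales (rule D)
    have "x \<in> A \<longleftrightarrow> reduce x \<in> GED_path_problem {0, 1, 2} C_E" for x
      using tiling[of x] by (simp only: reduce_correct W_def R_def)
    then show "polytime_reducible A (GED_path_problem {0, 1, 2} C_E)"
      unfolding polytime_reducible_def using polytime_computable_reduce by blast
  qed
qed simp

end
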